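(* Let $s\in(0,1)$, $n\in\mathbb{N}$ with $n>2s$, $p\in\left(1,\frac{n+2s}{n-2s}\right)$, and let $\Omega\subset\mathbb{R}^n$ be a bounded smooth domain. There exist $\varepsilon_0>0$ and $C>0$ such that, for every $\varepsilon\in(0,\varepsilon_0)$ and every $\xi\in\Omega_\varepsilon$ with $d:=\mathrm{dist}(\xi,\partial\Omega_\varepsilon)\ge5$, $$\mathcal{H}_\varepsilon(\xi)\le\frac{C}{d^{n+4s}}.$$
   Context: $(-\Delta)^s$ is the fractional Laplacian on $\mathbb{R}^n$ (Fourier symbol $|\xi|^{2s}$). $\Omega_\varepsilon:=\{x/\varepsilon:\ x\in\Omega\}$. $w$ denotes the unique radial positive least energy solution of $(-\Delta)^sw+w=w^p$ in $\mathbb{R}^n$, $w\in H^s(\mathbb{R}^n)$. It is known to be smooth and bounded above and below by positive constants times $|x|^{-(n+2s)}$ for $|x|\ge1$. Set $w_\xi(x):=w(x-\xi)$. $\Gamma$ is the unique decaying fundamental solution of $(-\Delta)^s\Gamma+\Gamma=\delta_0$ in $\mathbb{R}^n$; it is known to be radial, positive, of integral $1$, and bounded above and below by positive constants times $|x|^{-(n+2s)}$ for $|x|\ge1$. For fixed $y$, $H_\varepsilon(\cdot,y)$ is the solution of $(-\Delta)^sH_\varepsilon(x,y)+H_\varepsilon(x,y)=0$ for $x\in\Omega_\varepsilon$, with $H_\varepsilon(x,y)=\Gamma(x-y)$ for $x\in\mathbb{R}^n\setminus\Omega_\varepsilon$. $\mathcal{H}_\varepsilon(\xi):=\int_{\Omega_\varepsilon}\int_{\Omega_\varepsilon}H_\varepsilon(x,y)\,w_\xi^p(x)\,w_\xi^p(y)\,dx\,dy$.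 *)

theory Defs
  imports "HOL-Analysis.Analysis"
begin

subsection \<open>Smooth functions and domains\<close>

fun iter_deriv :: "'a::real_normed_vector list \<Rightarrow> ('a \<Rightarrow> 'b::real_normed_vector) \<Rightarrow> 'a \<Rightarrow> 'b" where
  "iter_deriv [] f = f"
| "iter_deriv (v # vs) f = (\<lambda>x. frechet_derivative (iter_deriv vs f) (at x) v)"

text \<open>For open \<open>S\<close> this is \<open>C\<^sup>\<infinity>\<close> regularity: every iterated directional derivative
  is itself Frechet differentiable, hence continuous, on \<open>S\<close>.\<close>

definition smooth_on :: "'a::real_normed_vector set \<Rightarrow> ('a \<Rightarrow> 'b::real_normed_vector) \<Rightarrow> bool" where
  "smooth_on S f \<longleftrightarrow> (\<forall>vs. \<forall>x\<in>S. iter_deriv vs f differentiable (at x))"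

text \<open>The boundary is described by local defining functions with nonvanishing gradient; the
  condition \<open>\<Omega> \<inter> U = {\<rho> < 0}\<close> puts the domain on one side of its boundary.\<close>

definition bounded_smooth_domain :: "'a::euclidean_space set \<Rightarrow> bool" where
  "bounded_smooth_domain \<Omega> \<longleftrightarrow>
     open \<Omega> \<and> connected \<Omega> \<and> \<Omega> \<noteq> {} \<and> bounded \<Omega> \<and>
     (\<forall>x0\<in>frontier \<Omega>. \<exists>U (\<rho> :: 'a \<Rightarrow> real).
        open U \<and> x0 \<in> U \<and> smooth_on U \<rho> \<and>
        (\<forall>x\<in>U. frechet_derivative \<rho> (at x) \<noteq> (\<lambda>v. 0)) \<and>
        \<Omega> \<inter> U = {x \<in> U. \<rho> x < 0})"

definition dilated :: "'a::euclidean_space set \<Rightarrow> real \<Rightarrow> 'a set" where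
  "dilated \<Omega> \<epsilon> = (\<lambda>x. x /\<^sub>R \<epsilon>) ` \<Omega>"

definition radial :: "('a::euclidean_space \<Rightarrow> real) \<Rightarrow> bool" where
  "radial f \<longleftrightarrow> (\<forall>x y. norm x = norm y \<longrightarrow> f x = f y)"

definition two_sided_decay :: "real \<Rightarrow> ('a::euclidean_space \<Rightarrow> real) \<Rightarrow> bool" where
  "two_sided_decay m f \<longleftrightarrow>
     (\<exists>c1>0. \<exists>c2>0. \<forall>x. norm x \<ge> 1 \<longrightarrow>
        c1 * norm x powr (- m) \<le> f x \<and> f x \<le> c2 * norm x powr (- m))"


subsection \<open>Fourier transform\<close>

text \<open>Convention: the kernel is \<open>exp (- i x \<bullet> \<xi>)\<close>, so that \<open>- \<Delta>\<close> has symbol \<open>\<bar>\<xi>\<bar>\<^sup>2\<close> and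
  inversion and Plancherel carry the factor \<open>(2 \<pi>)\<^sup>-\<^sup>n\<close>.\<close>

definition fourier :: "('a::euclidean_space \<Rightarrow> real) \<Rightarrow> 'a \<Rightarrow> complex" where
  "fourier f \<xi> = (LINT x|lborel. of_real (f x) * cis (- (x \<bullet> \<xi>)))"

text \<open>The Plancherel extension to \<open>L\<^sup>2\<close>: \<open>F\<close> is the \<open>L\<^sup>2\<close> limit, as \<open>R\<close> tends to infinity, of
  the Fourier transforms of the truncations of \<open>f\<close> to the balls of radius \<open>R\<close>. Functions are
  Borel measurable representatives of their classes.\<close>

definition in_L2 :: "('a::euclidean_space \<Rightarrow> 'b::real_normed_vector) \<Rightarrow> bool" where
  "in_L2 f \<longleftrightarrow> f \<in> borel_measurable lborel \<and> integrable lborel (\<lambda>x. (norm (f x))\<^sup>2)"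

definition is_fourier_L2 :: "('a::euclidean_space \<Rightarrow> real) \<Rightarrow> ('a \<Rightarrow> complex) \<Rightarrow> bool" where
  "is_fourier_L2 f F \<longleftrightarrow> in_L2 f \<and> in_L2 F \<and>
     ((\<lambda>R. \<integral>\<^sup>+ \<xi>. ennreal ((cmod (F \<xi> - fourier (\<lambda>x. indicator (cball 0 R) x * f x) \<xi>))\<^sup>2) \<partial>lborel)
        \<longlongrightarrow> 0) at_top"

text \<open>Determined up to a null set when \<open>f\<close> is in \<open>L\<^sup>2\<close>.\<close>

definition fourier_L2 :: "('a::euclidean_space \<Rightarrow> real) \<Rightarrow> 'a \<Rightarrow> complex" where
  "fourier_L2 f = (SOME F. is_fourier_L2 f F)"


subsection \<open>The fractional Laplacian\<close>

text \<open>Functions of rapid decay with all derivatives.\<close>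

definition schwartz :: "('a::euclidean_space \<Rightarrow> real) \<Rightarrow> bool" where
  "schwartz \<phi> \<longleftrightarrow> smooth_on UNIV \<phi> \<and>
     (\<forall>k::nat. \<forall>vs. bounded (range (\<lambda>x. norm x ^ k * iter_deriv vs \<phi> x)))"

text \<open>The Fourier multiplier with symbol \<open>\<bar>\<xi>\<bar>\<^sup>2\<^sup>s\<close> on Schwartz functions. The value is real since
  the symbol is even and \<open>\<phi>\<close> is real-valued.\<close>

definition frac_laplacian :: "real \<Rightarrow> ('a::euclidean_space \<Rightarrow> real) \<Rightarrow> 'a \<Rightarrow> real" where
  "frac_laplacian s \<phi> x =
     Re (LINT \<xi>|lborel. of_real (norm \<xi> powr (2 * s)) * fourier \<phi> \<xi> * cis (x \<bullet> \<xi>))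
       / (2 * pi) ^ DIM('a)"

text \<open>The Sobolev space \<open>H\<^sup>s\<close> of the whole space, and the pairing
  \<open>\<langle>(-\<Delta>)\<^sup>s u, v\<rangle>\<close> of its elements, written on the Fourier side.\<close>

definition in_Hs :: "real \<Rightarrow> ('a::euclidean_space \<Rightarrow> real) \<Rightarrow> bool" where
  "in_Hs s u \<longleftrightarrow>
     (\<exists>F. is_fourier_L2 u F \<and> integrable lborel (\<lambda>\<xi>. norm \<xi> powr (2 * s) * (cmod (F \<xi>))\<^sup>2))"

definition frac_form :: "real \<Rightarrow> ('a::euclidean_space \<Rightarrow> real) \<Rightarrow> ('a \<Rightarrow> real) \<Rightarrow> real" where
  "frac_form s u v =
     (LINT \<xi>|lborel. norm \<xi> powr (2 * s) * Re (fourier_L2 u \<xi> * cnj (fourier_L2 v \<xi>)))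
       / (2 * pi) ^ DIM('a)"

text \<open>\<open>u\<close> is a weak (finite energy) solution of \<open>(-\<Delta>)\<^sup>s u + u = f\<close> in \<open>U\<close>. The admissible test
  functions are the elements of \<open>H\<^sup>s\<close> of the whole space vanishing outside \<open>U\<close>.\<close>

definition weak_solution ::
  "real \<Rightarrow> 'a::euclidean_space set \<Rightarrow> ('a \<Rightarrow> real) \<Rightarrow> ('a \<Rightarrow> real) \<Rightarrow> bool" where
  "weak_solution s U f u \<longleftrightarrow> in_Hs s u \<and>
     (\<forall>\<phi>. in_Hs s \<phi> \<and> (\<forall>x. x \<notin> U \<longrightarrow> \<phi> x = 0) \<longrightarrow>
        frac_form s u \<phi> + (LINT x|lborel. u x * \<phi> x) = (LINT x|lborel. f x * \<phi> x))"


subsection \<open>Ground state, fundamental solution and regular part\<close>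

text \<open>For sign-changing competitors the power \<open>v\<^sup>p\<close> is read as \<open>\<bar>v\<bar>\<^sup>p\<^sup>-\<^sup>1 v\<close>. Least energy means
  least energy among all nontrivial finite energy solutions.\<close>

definition signed_power :: "real \<Rightarrow> real \<Rightarrow> real" where
  "signed_power p t = \<bar>t\<bar> powr (p - 1) * t"

definition energy :: "real \<Rightarrow> real \<Rightarrow> ('a::euclidean_space \<Rightarrow> real) \<Rightarrow> real" where
  "energy s p v = (frac_form s v v + (LINT x|lborel. (v x)\<^sup>2)) / 2
     - (LINT x|lborel. \<bar>v x\<bar> powr (p + 1)) / (p + 1)"

definition radial_ground_state :: "real \<Rightarrow> real \<Rightarrow> ('a::euclidean_space \<Rightarrow> real) \<Rightarrow> bool" where
  "radial_ground_state s p w \<longleftrightarrow>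
     weak_solution s UNIV (\<lambda>x. w x powr p) w \<and> radial w \<and> (\<forall>x. w x > 0) \<and>
     (\<forall>v :: 'a \<Rightarrow> real. weak_solution s UNIV (\<lambda>x. signed_power p (v x)) v \<and>
          \<not> (AE x in lborel. v x = 0) \<longrightarrow>
        energy s p w \<le> energy s p v)"

text \<open>\<open>(-\<Delta>)\<^sup>s \<Gamma> + \<Gamma> = \<delta>\<^sub>0\<close> in the sense of tempered distributions. The value \<open>\<Gamma> 0\<close> is
  immaterial, as \<open>\<Gamma>\<close> is singular at the origin.\<close>

definition decaying_fundamental_solution :: "real \<Rightarrow> ('a::euclidean_space \<Rightarrow> real) \<Rightarrow> bool" where
  "decaying_fundamental_solution s \<Gamma> \<longleftrightarrow>
     integrable lborel \<Gamma> \<and> (\<Gamma> \<longlongrightarrow> 0) at_infinity \<and>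
     (\<forall>\<phi>. schwartz \<phi> \<longrightarrow> (LINT x|lborel. \<Gamma> x * (frac_laplacian s \<phi> x + \<phi> x)) = \<phi> 0)"

text \<open>\<open>h = H\<^sub>\<epsilon>(\<cdot>, y)\<close> with \<open>U = \<Omega>\<^sub>\<epsilon>\<close>. For \<open>y\<close> in the open set \<open>U\<close>, the exterior datum is away from the
  singularity of \<open>\<Gamma>(\<cdot> - y)\<close>.\<close>

definition regular_part ::
  "real \<Rightarrow> ('a::euclidean_space \<Rightarrow> real) \<Rightarrow> 'a set \<Rightarrow> 'a \<Rightarrow> ('a \<Rightarrow> real) \<Rightarrow> bool" where
  "regular_part s \<Gamma> U y h \<longleftrightarrow>
     weak_solution s U (\<lambda>x. 0) h \<and> (\<forall>x. x \<notin> U \<longrightarrow> h x = \<Gamma> (x - y))"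

text \<open>\<open>\<H>\<^sub>\<epsilon>(\<xi>)\<close> for \<open>U = \<Omega>\<^sub>\<epsilon>\<close> and \<open>H = H\<^sub>\<epsilon>\<close>. The integral over \<open>x\<close> is the inner one, so that the
  value depends on each \<open>H\<^sub>\<epsilon>(\<cdot>, y)\<close> only up to null sets.\<close>

definition interaction ::
  "real \<Rightarrow> ('a::euclidean_space \<Rightarrow> real) \<Rightarrow> 'a set \<Rightarrow> ('a \<Rightarrow> 'a \<Rightarrow> real) \<Rightarrow> 'a \<Rightarrow> real" where
  "interaction p w U H \<xi> =
     (LINT y:U|lborel. (LINT x:U|lborel. H x y * w (x - \<xi>) powr p * w (y - \<xi>) powr p))"

end

theory Submission
  imports Defs "HOL-Probability.Characteristic_Functions"
begin

text \<open>
  Let \<open>a\<close> be the inner product of \<open>H\<^sup>s\<close>, \<open>U = \<Omega>\<^sub>\<epsilon>\<close>, \<open>W = w\<^sub>\<xi>\<close> and \<open>f = W\<^sup>p\<close>, so that \<open>a W \<phi> = \<integral> f \<phi>\<close>. Let \<open>h\<close>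
  be the projection of \<open>W\<close> on the closed span of the potentials \<open>\<Gamma> * \<mu>\<close> with \<open>\<mu> = 0\<close> on \<open>U\<close>. Then \<open>h = W\<close>
  off \<open>U\<close>, and \<open>a h h \<le> a v v\<close> whenever \<open>v = W\<close> off \<open>U\<close>. As \<open>H(\<cdot>, y)\<close> is \<open>\<Gamma>(\<cdot> - y)\<close> off \<open>U\<close> and is orthogonal
  to all functions vanishing off \<open>U\<close>, it satisfies \<open>a (\<Gamma> * \<mu>) (H(\<cdot>, y)) = (\<Gamma> * \<mu>)(y)\<close>, and in the limit
  \<open>\<integral> f H(\<cdot>, y) = a W (H(\<cdot>, y)) = a h (H(\<cdot>, y)) = h y\<close> for almost every \<open>y \<in> U\<close>. Since all integrands
  off \<open>U\<close> are nonnegative, the interaction is at most \<open>\<integral> f h = a W h = a h h \<le> a v v\<close>.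

  For \<open>v\<close> take \<open>\<eta> W\<close>, where the cutoff \<open>\<eta>\<close> rises from \<open>0\<close> to \<open>1\<close> between the spheres of radius \<open>d/2\<close> and
  \<open>d\<close> around \<open>\<xi>\<close>. The symbol \<open>\<bar>\<zeta>\<bar>\<^sup>2\<^sup>s\<close> is an average of \<open>1 - exp (- t \<bar>\<zeta>\<bar>\<^sup>2)\<close> over \<open>t > 0\<close> with weight
  \<open>t\<^sup>-\<^sup>1\<^sup>-\<^sup>s\<close>, so by Plancherel the energy of \<open>\<eta> W\<close> is \<open>a W (\<eta>\<^sup>2 W) = \<integral> \<eta>\<^sup>2 W\<^sup>p\<^sup>+\<^sup>1\<close> plus an average of
  \<open>\<integral>\<integral> W x W y (\<eta> x - \<eta> y)\<^sup>2 G\<^sub>t(x - y)\<close>, with \<open>G\<^sub>t\<close> the heat kernel. The decay of \<open>W\<close> and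
  \<open>\<integral> (\<eta> x - \<eta> y)\<^sup>2 G\<^sub>t(x - y) dy \<le> min 1 (C t / d\<^sup>2)\<close> make both terms \<open>O(d\<^sup>-\<^sup>(\<^sup>n\<^sup>+\<^sup>4\<^sup>s\<^sup>))\<close>.
\<close>

text \<open>The obstacle is twofold. The kernel \<open>\<Gamma> (x - y)\<close>, whose transform has
  modulus 1 / (1 + |\<xi>|^(2s)), has infinite energy when n > 2s. And \<open>H\<close> is given
  separately for each \<open>y\<close>, with neither symmetry nor joint measurability. So \<Gamma>
  enters only through smoothed potentials \<Gamma> * \<mu>, and densities \<mu> vanishing on U see
  no difference between \<open>\<Gamma> (x - y)\<close> and \<open>H x y\<close>. In the energy
  product the regular part at \<open>y\<close> thus acts on these potentials as evaluation at
  \<open>y\<close>: the inner integral is identified for almost every \<open>y\<close>, and no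
  double integral of \<open>H\<close> has to be exchanged.

  The exponent n + 4s is (n + 2s) + 2s. The supremum of W outside the ball of radius d / 2 gives (d
  / 2)^(-(n + 2s)). The remaining (d / 2)^(-2s) is the tail integral of W in one term and the
  scaling (2 / d)^(2s) of the cutoff energy in the other.\<close>

subsection \<open>The heat kernel\<close>

text \<open>This is the characteristic function of the standard normal distribution after a
  dilation: with \<open>c = sqrt (2 * t)\<close> the normal density at \<open>c * x\<close> is a
  multiple of exp (- t x^2).\<close>

lemma gauss_1d:
  fixes t a :: real assumes t: "t > 0"
  shows "integrable lborel (\<lambda>x::real. complex_of_real (exp (- t * x\<^sup>2)) * cis (x * a))" (is ?A)
    and "(LINT x|lborel. complex_of_real (exp (- t * x\<^sup>2)) * cis (x * a)) = of_real (sqrt (pi / t) * exp (- a\<^sup>2 / (4 * t)))" (is ?B)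
proof -
  define c where "c = sqrt (2 * t)"
  have c: "c > 0" "c\<^sup>2 = 2 * t" using t by (auto simp: c_def)
  have M: "std_normal_density (c * x) = (1 / sqrt (2 * pi)) * exp (- t * x\<^sup>2)" for x
    by (simp add: std_normal_density_def power_mult_distrib c)
  have "integrable lborel (\<lambda>x. std_normal_density x *\<^sub>R iexp (a / c * x))"
    using integrable_std_normal_moment[of 0]
    by (intro Bochner_Integration.integrable_bound[OF integrable_std_normal_moment[of 0]]) auto
  from lborel_integrable_real_affine[OF this, of c 0] c
  have I: "integrable lborel (\<lambda>x. std_normal_density (c * x) *\<^sub>R iexp (a / c * (c * x)))" by simp
  have E: "std_normal_density (c * x) *\<^sub>R iexp (a / c * (c * x)) = of_real (1 / sqrt (2 * pi)) * (complex_of_real (exp (- t * x\<^sup>2)) * cis (x * a))" for x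
    unfolding M using c by (simp add: scaleR_conv_of_real cis_conv_exp mult.commute)
  have "integrable lborel (\<lambda>x. of_real (sqrt (2 * pi)) * (of_real (1 / sqrt (2 * pi)) * (complex_of_real (exp (- t * x\<^sup>2)) * cis (x * a))))"
    using I unfolding E by (rule integrable_mult_right)
  then show ?A by simp
  have "exp (- ((a / c)\<^sup>2) / 2) = char std_normal_distribution (a / c)"
    by (simp add: char_std_normal_distribution)
  also have "\<dots> = (LINT x|lborel. std_normal_density x *\<^sub>R iexp (a / c * x))"
    unfolding char_def by (subst integral_density) (auto simp: normal_density_nonneg)
  also have "\<dots> = \<bar>c\<bar> *\<^sub>R (LINT x|lborel. std_normal_density (0 + c * x) *\<^sub>R iexp (a / c * (0 + c * x)))"
    using c by (intro lborel_integral_real_affine) auto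
  also have "\<dots> = c *\<^sub>R (of_real (1 / sqrt (2 * pi)) * (LINT x|lborel. complex_of_real (exp (- t * x\<^sup>2)) * cis (x * a)))"
    using c unfolding add_0 E by simp
  finally have F: "complex_of_real (exp (- ((a / c)\<^sup>2) / 2)) = of_real (c / sqrt (2 * pi)) * (LINT x|lborel. complex_of_real (exp (- t * x\<^sup>2)) * cis (x * a))"
    by (simp add: scaleR_conv_of_real)
  have "sqrt (2 * pi) / c = sqrt (pi / t)"
    using t unfolding c_def by (simp add: real_sqrt_divide real_sqrt_mult field_simps)
  moreover have "- ((a / c)\<^sup>2) / 2 = - a\<^sup>2 / (4 * t)" using c by (simp add: power_divide)
  ultimately have e: "exp (- ((a / c)\<^sup>2) / 2) = exp (- a\<^sup>2 / (4 * t))"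
    and r: "sqrt (pi / t) * (c / sqrt (2 * pi)) = 1"
    using c by (auto simp: field_simps)
  have r': "complex_of_real (sqrt (pi / t)) * complex_of_real (c / sqrt (2 * pi)) = 1"
    unfolding of_real_mult[symmetric] r by simp
  show ?B
    unfolding of_real_mult e[symmetric] F mult.assoc[symmetric] r' by simp
qed

text \<open>Lebesgue measure is the image of the product of one-dimensional Lebesgue measures under
  the coordinate sum, so the product version of Fubini applies to tensor products.\<close>

lemma lborel_integral_prod_Basis:
  fixes f :: "'a::euclidean_space \<Rightarrow> real \<Rightarrow> complex"
  assumes I: "\<And>b. b \<in> Basis \<Longrightarrow> integrable lborel (f b)"
  shows "integrable lborel (\<lambda>x::'a. \<Prod>b\<in>Basis. f b (x \<bullet> b))"
    and "(LINT x|lborel. (\<Prod>b\<in>Basis. f b ((x::'a) \<bullet> b))) = (\<Prod>b\<in>Basis. LINT y|lborel. f b y)"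
proof -
  interpret product_sigma_finite "\<lambda>_::'a. lborel :: real measure" ..
  let ?S = "\<lambda>g::'a \<Rightarrow> real. \<Sum>b\<in>Basis. g b *\<^sub>R b"
  have m: "?S \<in> measurable (\<Pi>\<^sub>M b\<in>Basis. lborel) borel" by measurable
  have fm: "\<And>b. b \<in> Basis \<Longrightarrow> f b \<in> borel_measurable borel" using I by auto
  have F[measurable]: "(\<lambda>x::'a. \<Prod>b\<in>Basis. f b (x \<bullet> b)) \<in> borel_measurable borel"
    by (intro borel_measurable_prod measurable_compose[OF _ fm]) auto
  have e: "(\<Prod>b\<in>Basis. f b (?S g \<bullet> b)) = (\<Prod>b\<in>Basis. f b (g b))" for g
    by (intro prod.cong) (auto simp: inner_sum_left inner_Basis if_distrib cong: if_cong)
  show "integrable lborel (\<lambda>x::'a. \<Prod>b\<in>Basis. f b (x \<bullet> b))"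
    unfolding lborel_eq[where 'a='a] integrable_distr_eq[OF m F] e
    by (rule product_integrable_prod) (use I in auto)
  show "(LINT x|lborel. (\<Prod>b\<in>Basis. f b ((x::'a) \<bullet> b))) = (\<Prod>b\<in>Basis. LINT y|lborel. f b y)"
    unfolding lborel_eq[where 'a='a] integral_distr[OF m F] e
    by (rule product_integral_prod) (use I in auto)
qed

lemma cis_sum: "cis (sum f A) = (\<Prod>x\<in>A. cis (f x))"
  by (induction A rule: infinite_finite_induct) (auto simp flip: cis_mult)

text \<open>The Gauss-Weierstrass kernel at time t. The prefactor gives it mass 1, and its Fourier
  transform is exp (- t |\<xi>|^2).\<close>

definition heat_kernel :: "real \<Rightarrow> 'a::euclidean_space \<Rightarrow> real" where
  "heat_kernel t z = (4 * pi * t) powr (- real DIM('a) / 2) * exp (- (norm z)\<^sup>2 / (4 * t))"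

lemma gauss_fourier:
  fixes z :: "'a::euclidean_space" assumes t: "t > 0"
  shows "integrable lborel (\<lambda>x::'a. complex_of_real (exp (- t * (norm x)\<^sup>2)) * cis (x \<bullet> z))" (is ?A)
    and "(LINT x|lborel. complex_of_real (exp (- t * (norm x)\<^sup>2)) * cis (x \<bullet> z))
       = of_real ((2 * pi) ^ DIM('a) * heat_kernel t z)" (is ?B)
proof -
  have N: "(norm (x::'a))\<^sup>2 = (\<Sum>b\<in>Basis. (x \<bullet> b)\<^sup>2)" for x
    unfolding power2_norm_eq_inner by (subst euclidean_inner) (simp add: power2_eq_square)
  have e: "complex_of_real (exp (- t * (norm x)\<^sup>2)) * cis (x \<bullet> z)
     = (\<Prod>b\<in>Basis. complex_of_real (exp (- t * (x \<bullet> b)\<^sup>2)) * cis ((x \<bullet> b) * (z \<bullet> b)))" for x :: 'a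
    unfolding N by (subst euclidean_inner[of x z]) (simp add: cis_sum sum_distrib_left exp_sum prod.distrib flip: of_real_prod sum_negf)
  show ?A unfolding e by (rule lborel_integral_prod_Basis) (rule gauss_1d[OF t])
  have "(LINT x|lborel. complex_of_real (exp (- t * (norm (x::'a))\<^sup>2)) * cis (x \<bullet> z))
     = (\<Prod>b\<in>(Basis::'a set). of_real (sqrt (pi / t) * exp (- (z \<bullet> b)\<^sup>2 / (4 * t))))"
    unfolding e by (subst lborel_integral_prod_Basis(2)) (rule gauss_1d[OF t] prod.cong refl)+
  also have "\<dots> = of_real (sqrt (pi / t) ^ DIM('a) * exp (- (norm z)\<^sup>2 / (4 * t)))"
    unfolding N by (simp add: prod.distrib exp_sum sum_divide_distrib flip: of_real_prod sum_negf)
  also have "sqrt (pi / t) ^ DIM('a) * exp (- (norm z)\<^sup>2 / (4 * t)) = (2 * pi) ^ DIM('a) * heat_kernel t z"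
  proof -
    \<comment> \<open>Each coordinate contributes one factor 2 pi to the inversion constant and one
      factor (4 pi t)^(-1/2) to the kernel.\<close>
    have "sqrt (pi / t) = 2 * pi * (4 * pi * t) powr (- 1 / 2)"
      using t by (simp add: powr_minus powr_half_sqrt real_sqrt_divide real_sqrt_mult field_simps)
    then have "sqrt (pi / t) ^ DIM('a) = (2 * pi) ^ DIM('a) * ((4 * pi * t) powr (- 1 / 2)) ^ DIM('a)"
      by (simp add: power_mult_distrib)
    also have "((4 * pi * t) powr (- 1 / 2)) ^ DIM('a) = (4 * pi * t) powr (- real DIM('a) / 2)"
      using t by (simp add: powr_powr flip: powr_realpow)
    finally show ?thesis by (simp add: heat_kernel_def)
  qed
  finally show ?B .
qed

lemma heat_kernel_pos: "t > 0 \<Longrightarrow> heat_kernel t z > 0"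
  by (simp add: heat_kernel_def)

lemma heat_kernel_nonneg: "heat_kernel t z \<ge> 0"
  by (simp add: heat_kernel_def)

lemma heat_kernel_minus [simp]: "heat_kernel t (- z) = heat_kernel t z"
  by (simp add: heat_kernel_def)

lemma heat_kernel_commute: "heat_kernel t (x - y) = heat_kernel t (y - x)"
  by (metis heat_kernel_minus minus_diff_eq)

lemma heat_kernel_measurable [measurable]: "heat_kernel t \<in> borel_measurable borel"
  unfolding heat_kernel_def[abs_def] by measurable

lemma heat_kernel_le: "heat_kernel t z \<le> heat_kernel t (0 :: 'a)" if "t > 0" for z :: "'a::euclidean_space"
  using that by (simp add: heat_kernel_def)

lemma heat_kernel_integral:
  assumes t: "t > 0"
  shows "integrable lborel (heat_kernel t :: 'a::euclidean_space \<Rightarrow> real)"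
    and "(LINT z|lborel. heat_kernel t (z::'a)) = 1"
proof -
  \<comment> \<open>The kernel at time \<open>t\<close> is a Gaussian with exponent
    \<open>r\<close>, so its mass is the Gaussian transform with parameter \<open>r\<close> at
    frequency 0.\<close>
  define r where "r = 1 / (4 * t)"
  have r: "r > 0" using t by (simp add: r_def)
  define c where "c = (4 * pi * t) powr (- real DIM('a) / 2)"
  have h: "heat_kernel t z = c * exp (- r * (norm z)\<^sup>2)" for z :: 'a
    by (simp add: heat_kernel_def r_def c_def)
  note G = gauss_fourier[OF r, of "0::'a"]
  have "integrable lborel (\<lambda>x::'a. complex_of_real (exp (- r * (norm x)\<^sup>2)))" using G(1) by simp
  then have I: "integrable lborel (\<lambda>x::'a. exp (- r * (norm x)\<^sup>2))" using integrable_Re by fastforce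
  then show "integrable lborel (heat_kernel t :: 'a \<Rightarrow> real)" unfolding h by simp
  have "complex_of_real (LINT x|lborel. exp (- r * (norm (x::'a))\<^sup>2)) = of_real ((2 * pi) ^ DIM('a) * heat_kernel r (0::'a))"
    using G(2) by simp
  then have J: "(LINT x|lborel. exp (- r * (norm (x::'a))\<^sup>2)) = (2 * pi) ^ DIM('a) * heat_kernel r (0::'a)"
    using of_real_eq_iff by blast
  have "(4 * pi * t) powr (- real DIM('a) / 2) * (4 * pi * r) powr (- real DIM('a) / 2) = ((2 * pi) powr 2) powr (- real DIM('a) / 2)"
    using t r by (subst powr_mult[symmetric]) (auto simp: r_def power2_eq_square)
  also have "\<dots> = (2 * pi) powr (- real DIM('a))" by (subst powr_powr) simp
  also have "\<dots> = 1 / (2 * pi) ^ DIM('a)" by (simp add: powr_minus powr_realpow inverse_eq_divide)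
  finally have "c * heat_kernel r (0::'a) = 1 / (2 * pi) ^ DIM('a)" by (simp add: c_def heat_kernel_def)
  then show "(LINT z|lborel. heat_kernel t (z::'a)) = 1" unfolding h using J by (simp add: mult.left_commute[of c])
qed

lemma heat_kernel_scale:
  "t > 0 \<Longrightarrow> heat_kernel t (sqrt t *\<^sub>R z) = t powr (- real DIM('a) / 2) * heat_kernel 1 (z :: 'a::euclidean_space)"
  by (simp add: heat_kernel_def powr_mult power_mult_distrib)

section \<open>Dilations, translations and reflections of Lebesgue measure\<close>

lemma lborel_scale:
  fixes f :: "'a::euclidean_space \<Rightarrow> 'b::{banach,second_countable_topology}"
  assumes c: "c > (0::real)" and [measurable]: "f \<in> borel_measurable borel"
  shows "(LINT x|lborel. f x) = (c ^ DIM('a)) *\<^sub>R (LINT x|lborel. f (c *\<^sub>R x))"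
    and "integrable lborel f \<longleftrightarrow> integrable lborel (\<lambda>x. f (c *\<^sub>R x))"
proof -
  have L: "lborel = density (distr lborel borel (\<lambda>x::'a. 0 + c *\<^sub>R x)) (\<lambda>_. \<bar>c\<bar> ^ DIM('a))"
    using c by (intro lborel_affine) auto
  show "(LINT x|lborel. f x) = (c ^ DIM('a)) *\<^sub>R (LINT x|lborel. f (c *\<^sub>R x))"
    using c by (subst L) (simp add: integral_density integral_distr)
  show "integrable lborel f \<longleftrightarrow> integrable lborel (\<lambda>x. f (c *\<^sub>R x))"
  proof -
    have "integrable lborel f \<longleftrightarrow> integrable lborel (\<lambda>x. c ^ DIM('a) *\<^sub>R f (c *\<^sub>R x))"
      using c by (subst L) (simp add: integrable_density integrable_distr_eq)
    also have "\<dots> \<longleftrightarrow> integrable lborel (\<lambda>x. f (c *\<^sub>R x))"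
    proof
      assume "integrable lborel (\<lambda>x. c ^ DIM('a) *\<^sub>R f (c *\<^sub>R x))"
      then have "integrable lborel (\<lambda>x. inverse (c ^ DIM('a)) *\<^sub>R (c ^ DIM('a) *\<^sub>R f (c *\<^sub>R x)))"
        by (rule integrable_scaleR_right)
      then show "integrable lborel (\<lambda>x. f (c *\<^sub>R x))" using c by simp
    qed auto
    finally show ?thesis .
  qed
qed

lemma lborel_translate:
  fixes f :: "'a::euclidean_space \<Rightarrow> 'b::{banach,second_countable_topology}"
  assumes [measurable]: "f \<in> borel_measurable borel"
  shows "(LINT x|lborel. f (a + x)) = (LINT x|lborel. f x)"
    and "integrable lborel (\<lambda>x. f (a + x)) \<longleftrightarrow> integrable lborel f"
  using integral_distr[of "(+) a" lborel borel f] integrable_distr_eq[of "(+) a" lborel borel f]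
  by (auto simp: lborel_distr_plus)

lemma lborel_reflect:
  fixes f :: "'a::euclidean_space \<Rightarrow> 'b::{banach,second_countable_topology}"
  assumes [measurable]: "f \<in> borel_measurable borel"
  shows "(LINT x|lborel. f (a - x)) = (LINT x|lborel. f x)"
    and "integrable lborel (\<lambda>x. f (a - x)) \<longleftrightarrow> integrable lborel f"
proof -
  have L: "lborel = distr lborel borel (\<lambda>x::'a. a - x)"
    using lborel_affine[of "-1" a] by (simp add: density_1)
  show "(LINT x|lborel. f (a - x)) = (LINT x|lborel. f x)"
    by (subst (2) L) (simp add: integral_distr)
  show "integrable lborel (\<lambda>x. f (a - x)) \<longleftrightarrow> integrable lborel f"
    by (subst (2) L) (simp add: integrable_distr_eq)
qed

text \<open>Parabolic scaling reduces everything to time 1, whose moment is the constant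
  \<open>M\<close>. At time 1 the factor \<open>(norm z)\<^sup>2\<close> is absorbed by half of the
  exponent, and the other half is the kernel at time 2. The linear growth in \<open>t\<close> is
  what makes Lipschitz cutoffs cheap for small times.\<close>

lemma heat_kernel_second_moment:
  "\<exists>M. \<forall>t>0. integrable lborel (\<lambda>z::'a::euclidean_space. (norm z)\<^sup>2 * heat_kernel t z) \<and>
      (LINT z|lborel. (norm (z::'a))\<^sup>2 * heat_kernel t z) = M * t"
proof (intro exI allI impI)
  fix t :: real assume t: "t > 0"
  have b: "(norm z)\<^sup>2 * heat_kernel 1 z \<le> 8 * 2 powr (real DIM('a) / 2) * heat_kernel 2 z" for z :: 'a
  proof -
    have "(norm z)\<^sup>2 / 8 \<le> exp ((norm z)\<^sup>2 / 8)" using exp_ge_add_one_self[of "(norm z)\<^sup>2 / 8"] by linarith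
    then have "(norm z)\<^sup>2 * exp (- (norm z)\<^sup>2 / 4) \<le> 8 * exp ((norm z)\<^sup>2 / 8) * exp (- (norm z)\<^sup>2 / 4)"
      by (intro mult_right_mono) auto
    also have "\<dots> = 8 * exp (- (norm z)\<^sup>2 / 8)" by (simp flip: exp_add)
    finally have 1: "(norm z)\<^sup>2 * exp (- (norm z)\<^sup>2 / 4) \<le> 8 * exp (- (norm z)\<^sup>2 / 8)" .
    have 2: "(4 * pi * 2) powr (- real DIM('a) / 2) * 2 powr (real DIM('a) / 2) = (4 * pi) powr (- real DIM('a) / 2)"
      by (subst powr_mult) (auto simp: powr_minus)
    have "(norm z)\<^sup>2 * heat_kernel 1 z = (4 * pi) powr (- real DIM('a) / 2) * ((norm z)\<^sup>2 * exp (- (norm z)\<^sup>2 / 4))"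
      by (simp add: heat_kernel_def)
    also have "\<dots> \<le> (4 * pi) powr (- real DIM('a) / 2) * (8 * exp (- (norm z)\<^sup>2 / 8))"
      using 1 by (intro mult_left_mono) auto
    also have "\<dots> = 8 * 2 powr (real DIM('a) / 2) * heat_kernel 2 z"
      unfolding 2[symmetric] by (simp add: heat_kernel_def)
    finally show ?thesis .
  qed
  have I: "integrable lborel (\<lambda>z::'a. (norm z)\<^sup>2 * heat_kernel 1 z)"
    by (rule Bochner_Integration.integrable_bound[OF integrable_mult_right[OF heat_kernel_integral(1)[of 2], of "8 * 2 powr (real DIM('a) / 2)"]])
       (use b in \<open>auto simp: heat_kernel_nonneg\<close>)
  have s: "sqrt t > 0" using t by simp
  have e: "(norm (sqrt t *\<^sub>R z))\<^sup>2 * heat_kernel t (sqrt t *\<^sub>R z) = (t * t powr (- real DIM('a) / 2)) * ((norm z)\<^sup>2 * heat_kernel 1 z)" for z :: 'a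
    using t by (simp add: heat_kernel_scale power_mult_distrib)
  have m: "(\<lambda>z::'a. (norm z)\<^sup>2 * heat_kernel t z) \<in> borel_measurable borel" by measurable
  have p: "sqrt t ^ DIM('a) * (t * t powr (- real DIM('a) / 2)) = t"
  proof -
    have "sqrt t ^ DIM('a) = t powr (real DIM('a) / 2)"
      using t by (simp add: powr_half_sqrt[symmetric] powr_powr flip: powr_realpow)
    then show ?thesis using t by (simp add: powr_minus field_simps)
  qed
  have p': "sqrt t ^ DIM('a) *\<^sub>R (t * t powr (- real DIM('a) / 2) * X) = X * t" for X :: real
    using p by (metis mult.assoc mult.commute real_scaleR_def)
  show "integrable lborel (\<lambda>z::'a. (norm z)\<^sup>2 * heat_kernel t z) \<and>
      (LINT z|lborel. (norm (z::'a))\<^sup>2 * heat_kernel t z) = (LINT z|lborel. (norm (z::'a))\<^sup>2 * heat_kernel 1 z) * t"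
    unfolding lborel_scale(2)[OF s m] lborel_scale(1)[OF s m] e
    unfolding integral_mult_right_zero p' using I by (auto simp del: mult_eq_0_iff)
qed

section \<open>Fubini for integrable factors and a bounded kernel\<close>

lemma integrable_prod_bounded:
  fixes f :: "'a::euclidean_space \<Rightarrow> 'c::{real_normed_field,banach,second_countable_topology}" and g :: "'b::euclidean_space \<Rightarrow> 'c"
  assumes f: "integrable lborel f" and g: "integrable lborel g"
    and K[measurable]: "(\<lambda>(x,y). K x y) \<in> borel_measurable (lborel \<Otimes>\<^sub>M lborel)"
    and C: "\<And>x y. norm (K x y) \<le> C"
  shows "integrable (lborel \<Otimes>\<^sub>M lborel) (\<lambda>(x,y). f x * g y * K x y)"
proof (rule lborel_pair.Fubini_integrable)
  have [measurable]: "f \<in> borel_measurable borel" "g \<in> borel_measurable borel" using f g by auto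
  show m: "(\<lambda>(x,y). f x * g y * K x y) \<in> borel_measurable (lborel \<Otimes>\<^sub>M lborel)" by measurable
  have C0: "C \<ge> 0" using C[of undefined undefined] norm_ge_zero order_trans by blast
  have gK: "integrable lborel (\<lambda>y. g y * K x y)" for x
  proof (rule Bochner_Integration.integrable_bound[OF integrable_mult_right[OF integrable_norm[OF g], of C]])
    show "(\<lambda>y. g y * K x y) \<in> borel_measurable lborel" by measurable
    show "AE y in lborel. norm (g y * K x y) \<le> norm (C * norm (g y))"
      using C C0 by (auto simp: norm_mult mult.commute[of C] intro!: mult_left_mono)
  qed
  have fgK: "integrable lborel (\<lambda>y. f x * g y * K x y)" for x
    using integrable_mult_right[OF gK, of "f x" x] by (simp add: mult.assoc)
  then show "AE x in lborel. integrable lborel (\<lambda>y. case (x, y) of (x, y) \<Rightarrow> f x * g y * K x y)" by simp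
  show "integrable lborel (\<lambda>x. LINT y|lborel. norm (case (x, y) of (x, y) \<Rightarrow> f x * g y * K x y))"
  proof (rule Bochner_Integration.integrable_bound[OF integrable_mult_left[OF integrable_norm[OF f], of "C * (LINT y|lborel. norm (g y))"]])
    show "(\<lambda>x. LINT y|lborel. norm (case (x, y) of (x, y) \<Rightarrow> f x * g y * K x y)) \<in> borel_measurable lborel" by measurable
    have "(LINT y|lborel. norm (f x * g y * K x y)) \<le> (LINT y|lborel. norm (f x) * C * norm (g y))" for x
      using C by (intro integral_mono integrable_norm fgK integrable_mult_right g)
        (auto simp: norm_mult mult.assoc mult.commute[of C] intro!: mult_left_mono)
    then show "AE x in lborel. norm (LINT y|lborel. norm (case (x, y) of (x, y) \<Rightarrow> f x * g y * K x y)) \<le> norm (norm (f x) * (C * (LINT y|lborel. norm (g y))))"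
      using C0 by (auto simp: abs_mult mult.assoc abs_of_nonneg)
  qed
qed

lemma fubini_prod_bounded:
  fixes f :: "'a::euclidean_space \<Rightarrow> 'c::{real_normed_field,banach,second_countable_topology}" and g :: "'b::euclidean_space \<Rightarrow> 'c"
  assumes f: "integrable lborel f" and g: "integrable lborel g"
    and K: "(\<lambda>(x,y). K x y) \<in> borel_measurable (lborel \<Otimes>\<^sub>M lborel)"
    and C: "\<And>x y. norm (K x y) \<le> C"
  shows "(LINT x|lborel. f x * (LINT y|lborel. g y * K x y)) = (LINT y|lborel. g y * (LINT x|lborel. f x * K x y))"
proof -
  have "(LINT x|lborel. f x * (LINT y|lborel. g y * K x y)) = (LINT x|lborel. LINT y|lborel. f x * g y * K x y)"
    by (simp add: mult.assoc)
  also have "\<dots> = (LINT y|lborel. LINT x|lborel. f x * g y * K x y)"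
    by (rule lborel_pair.Fubini_integral[symmetric]) (rule integrable_prod_bounded[OF assms])
  also have "\<dots> = (LINT y|lborel. g y * (LINT x|lborel. f x * K x y))"
    by (subst integral_mult_right_zero[symmetric]) (simp add: mult.assoc mult.left_commute)
  finally show ?thesis .
qed

subsection \<open>The Plancherel theorem\<close>

lemma cis_measurable [measurable]: "cis \<in> borel_measurable borel"
  by (intro borel_measurable_continuous_onI continuous_intros)

lemma cnj_measurable [measurable]: "cnj \<in> borel_measurable borel"
  by (intro borel_measurable_continuous_onI continuous_intros)

text \<open>On the intersection of L1 and L2 \<open>fourier\<close> is a convergent integral, so
  that Plancherel can be proved without any extension by truncation. The energy product is only
  taken between functions of this class: U is bounded and the data off U are integrable.\<close>

definition L12 :: "('a::euclidean_space \<Rightarrow> real) \<Rightarrow> bool" where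
  "L12 u \<longleftrightarrow> integrable lborel u \<and> integrable lborel (\<lambda>x. (u x)\<^sup>2)"

lemma L12D:
  assumes "L12 u"
  shows "integrable lborel u" "integrable lborel (\<lambda>x. (u x)\<^sup>2)" "u \<in> borel_measurable borel"
  using assms by (auto simp: L12_def)

lemma integrable_L2_mult:
  fixes u v :: "'a::euclidean_space \<Rightarrow> real"
  assumes [measurable]: "u \<in> borel_measurable borel" "v \<in> borel_measurable borel"
    and "integrable lborel (\<lambda>x. (u x)\<^sup>2)" "integrable lborel (\<lambda>x. (v x)\<^sup>2)"
  shows "integrable lborel (\<lambda>x. u x * v x)"
proof (rule Bochner_Integration.integrable_bound)
  show "integrable lborel (\<lambda>x. (u x)\<^sup>2 + (v x)\<^sup>2)" using assms by simp
  have "\<bar>a * b\<bar> \<le> a\<^sup>2 + b\<^sup>2" for a b :: real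
    using sum_squares_bound[of "\<bar>a\<bar>" "\<bar>b\<bar>"] by (simp add: abs_mult mult.assoc) (smt (verit) abs_ge_zero mult_nonneg_nonneg)
  then show "AE x in lborel. norm (u x * v x) \<le> norm ((u x)\<^sup>2 + (v x)\<^sup>2)" by simp
qed simp

lemma L12_mult: "L12 u \<Longrightarrow> L12 v \<Longrightarrow> integrable lborel (\<lambda>x. u x * v x)"
  by (intro integrable_L2_mult) (auto dest: L12D)

lemma L12_add: assumes "L12 u" "L12 v" shows "L12 (\<lambda>x. u x + v x)"
  using assms L12D[OF assms(1)] L12D[OF assms(2)] L12_mult[OF assms] by (auto simp: L12_def power2_sum mult.assoc)

lemma L12_cmult: assumes "L12 u" shows "L12 (\<lambda>x. c * u x)"
  using L12D[OF assms] by (auto simp: L12_def power_mult_distrib)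

lemma L12_diff: assumes "L12 u" "L12 v" shows "L12 (\<lambda>x. u x - v x)"
  using L12_add[OF assms(1) L12_cmult[OF assms(2), of "-1"]] by simp

lemma L12_bounded_mult:
  assumes u: "L12 u" and [measurable]: "g \<in> borel_measurable borel" and g: "\<And>x. \<bar>g x\<bar> \<le> B"
  shows "L12 (\<lambda>x. g x * u x)"
proof -
  have [measurable]: "u \<in> borel_measurable borel" using u by (rule L12D)
  have "\<bar>g x\<bar> \<le> \<bar>B\<bar>" for x using g[of x] by simp
  then have 1: "\<bar>g x * u x\<bar> \<le> \<bar>B * u x\<bar>" for x by (simp add: abs_mult mult_right_mono)
  then have 2: "(g x * u x)\<^sup>2 \<le> (B * u x)\<^sup>2" for x by (metis abs_le_square_iff)
  have "L12 (\<lambda>x. B * u x)" using u by (rule L12_cmult)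
  note Bu = L12D[OF this]
  show ?thesis unfolding L12_def
  proof
    show "integrable lborel (\<lambda>x. g x * u x)"
      by (rule Bochner_Integration.integrable_bound[OF Bu(1)]) (use 1 in auto)
    show "integrable lborel (\<lambda>x. (g x * u x)\<^sup>2)"
      by (rule Bochner_Integration.integrable_bound[OF Bu(2)]) (use 2 in auto)
  qed
qed

lemma fourier_integrand:
  "integrable lborel u \<Longrightarrow> integrable lborel (\<lambda>x::'a::euclidean_space. complex_of_real (u x) * cis (- (x \<bullet> \<xi>)))"
  by (rule Bochner_Integration.integrable_bound[where f=u]) (auto simp: norm_mult)

lemma fourier_measurable [measurable (raw)]:
  assumes "integrable lborel u" shows "fourier u \<in> borel_measurable borel"
proof -
  have [measurable]: "u \<in> borel_measurable borel" using assms by auto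
  show ?thesis unfolding fourier_def[abs_def] by measurable
qed

lemma fourier_bound: "integrable lborel u \<Longrightarrow> cmod (fourier u \<xi>) \<le> (LINT x|lborel. \<bar>u x\<bar>)"
  unfolding fourier_def by (rule integral_norm_bound[THEN order_trans]) (simp add: norm_mult)

lemma fourier_add:
  "integrable lborel u \<Longrightarrow> integrable lborel v \<Longrightarrow> fourier (\<lambda>x. u x + v x) \<xi> = fourier u \<xi> + fourier v \<xi>"
  unfolding fourier_def by (simp add: distrib_right fourier_integrand)

lemma fourier_diff:
  "integrable lborel u \<Longrightarrow> integrable lborel v \<Longrightarrow> fourier (\<lambda>x. u x - v x) \<xi> = fourier u \<xi> - fourier v \<xi>"
  unfolding fourier_def by (simp add: left_diff_distrib fourier_integrand)

lemma fourier_cmult: "fourier (\<lambda>x. c * u x) \<xi> = of_real c * fourier u \<xi>"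
  unfolding fourier_def by (simp add: mult.assoc)

lemma fourier_cong_AE:
  assumes [measurable]: "u \<in> borel_measurable borel" "v \<in> borel_measurable borel" and "AE x in lborel. u x = v x"
  shows "fourier u = fourier v"
  unfolding fourier_def[abs_def] by (intro ext integral_cong_AE) (use assms in auto)

lemma cnj_fourier: "cnj (fourier u \<xi>) = (LINT x|lborel. of_real (u x) * cis (x \<bullet> \<xi>))"
  unfolding fourier_def by (subst Bochner_Integration.integral_cnj[symmetric]) (simp add: cis_cnj)

text \<open>The L2 pairing of \<open>u\<close> with the heat flow of \<open>v\<close> at time
  \<open>t\<close>.\<close>

definition heat_form :: "real \<Rightarrow> ('a::euclidean_space \<Rightarrow> real) \<Rightarrow> ('a \<Rightarrow> real) \<Rightarrow> real" where
  "heat_form t u v = (LINT (x, y)|(lborel \<Otimes>\<^sub>M lborel). u x * v y * heat_kernel t (x - y))"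

lemma heat_form_integrable:
  fixes u v :: "'a::euclidean_space \<Rightarrow> real"
  assumes "t > 0" "integrable lborel u" "integrable lborel v"
  shows "integrable (lborel \<Otimes>\<^sub>M lborel) (\<lambda>(x, y). u x * v y * heat_kernel t (x - y))"
  by (rule integrable_prod_bounded[OF assms(2,3), where C="heat_kernel t (0::'a)"])
     (auto simp: heat_kernel_nonneg heat_kernel_le assms split_beta')

lemma gauss_integrable: "t > 0 \<Longrightarrow> integrable lborel (\<lambda>x::'a::euclidean_space. exp (- t * (norm x)\<^sup>2))"
  using gauss_fourier(1)[of t "0::'a"] integrable_Re[of lborel "\<lambda>x::'a. complex_of_real (exp (- t * (norm x)\<^sup>2)) * cis (x \<bullet> 0)"]
  by simp

text \<open>The Gaussian factor makes the integral over the frequency and both space variables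
  absolutely convergent. Two exchanges of integrals leave the transform of the Gaussian, which is
  the heat kernel. Letting \<open>t\<close> tend to 0 will give Plancherel itself.\<close>

lemma heat_plancherel_complex:
  fixes u v :: "'a::euclidean_space \<Rightarrow> real"
  assumes t: "t > 0" and u: "integrable lborel u" and v: "integrable lborel v"
  shows "(LINT \<xi>|lborel. of_real (exp (- t * (norm \<xi>)\<^sup>2)) * (fourier u \<xi> * cnj (fourier v \<xi>)))
     = of_real ((2 * pi) ^ DIM('a) * heat_form t u v)"
proof -
  let ?G = "\<lambda>\<xi>::'a. complex_of_real (exp (- t * (norm \<xi>)\<^sup>2))"
  have [measurable]: "u \<in> borel_measurable borel" "v \<in> borel_measurable borel" using u v by auto
  have [measurable]: "fourier u \<in> borel_measurable borel" "fourier v \<in> borel_measurable borel"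
    using u v by (auto intro: fourier_measurable)
  have cu: "integrable lborel (\<lambda>x. complex_of_real (u x))" and cv: "integrable lborel (\<lambda>x. complex_of_real (v x))"
    using u v by auto
  have G: "integrable lborel ?G" using gauss_fourier(1)[OF t, of 0] by simp
  have g: "integrable lborel (\<lambda>\<xi>. ?G \<xi> * cnj (fourier v \<xi>))"
  proof (rule Bochner_Integration.integrable_bound[OF integrable_mult_left[OF gauss_integrable[OF t], of "LINT x|lborel. \<bar>v x\<bar>"]])
    show "AE x in lborel. norm (?G x * cnj (fourier v x)) \<le> norm (exp (- t * (norm x)\<^sup>2) * (LINT x|lborel. \<bar>v x\<bar>))"
      using fourier_bound[OF v] by (auto simp: norm_mult intro!: mult_left_mono order_trans[OF _ abs_ge_self])
  qed measurable
  have Gx: "integrable lborel (\<lambda>\<xi>. ?G \<xi> * cis (- (x \<bullet> \<xi>)))" for x :: 'a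
    by (rule Bochner_Integration.integrable_bound[OF gauss_integrable[OF t]]) (auto simp: norm_mult)
  have inner: "(LINT \<xi>|lborel. (?G \<xi> * cnj (fourier v \<xi>)) * cis (- (x \<bullet> \<xi>))) = of_real ((2 * pi) ^ DIM('a) * (LINT y|lborel. v y * heat_kernel t (x - y)))" for x
  proof -
    have "(LINT \<xi>|lborel. (?G \<xi> * cnj (fourier v \<xi>)) * cis (- (x \<bullet> \<xi>)))
       = (LINT \<xi>|lborel. (?G \<xi> * cis (- (x \<bullet> \<xi>))) * (LINT y|lborel. of_real (v y) * cis (y \<bullet> \<xi>)))"
      by (simp add: cnj_fourier mult_ac)
    also have "\<dots> = (LINT y|lborel. of_real (v y) * (LINT \<xi>|lborel. (?G \<xi> * cis (- (x \<bullet> \<xi>))) * cis (y \<bullet> \<xi>)))"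
      by (rule fubini_prod_bounded[OF Gx cv, where C=1]) auto
    also have "\<dots> = (LINT y|lborel. of_real (v y) * (LINT \<xi>|lborel. ?G \<xi> * cis (\<xi> \<bullet> (y - x))))"
      by (simp add: mult.assoc cis_mult inner_diff_right inner_commute)
    also have "\<dots> = (LINT y|lborel. of_real ((2 * pi) ^ DIM('a) * (v y * heat_kernel t (x - y))))"
      unfolding gauss_fourier(2)[OF t] heat_kernel_commute[of t x] by (simp add: mult_ac)
    also have "\<dots> = of_real (LINT y|lborel. (2 * pi) ^ DIM('a) * (v y * heat_kernel t (x - y)))"
      by (rule integral_complex_of_real)
    finally show ?thesis unfolding integral_mult_right_zero .
  qed
  have "(LINT \<xi>|lborel. ?G \<xi> * (fourier u \<xi> * cnj (fourier v \<xi>)))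
     = (LINT \<xi>|lborel. (?G \<xi> * cnj (fourier v \<xi>)) * (LINT x|lborel. of_real (u x) * cis (- (x \<bullet> \<xi>))))"
    by (simp add: fourier_def mult_ac)
  also have "\<dots> = (LINT x|lborel. of_real (u x) * (LINT \<xi>|lborel. (?G \<xi> * cnj (fourier v \<xi>)) * cis (- (x \<bullet> \<xi>))))"
    by (rule fubini_prod_bounded[OF g cu, where C=1]) auto
  also have "\<dots> = (LINT x|lborel. of_real ((2 * pi) ^ DIM('a) * (LINT y|lborel. u x * v y * heat_kernel t (x - y))))"
    unfolding inner by (simp add: mult_ac)
  also have "\<dots> = of_real ((2 * pi) ^ DIM('a) * (LINT x|lborel. LINT y|lborel. u x * v y * heat_kernel t (x - y)))"
    by simp
  also have "(LINT x|lborel. LINT y|lborel. u x * v y * heat_kernel t (x - y)) = heat_form t u v"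
    unfolding heat_form_def
    using lborel_pair.integral_fst[OF heat_form_integrable[OF assms]] by simp
  finally show ?thesis .
qed

lemma fourier_gauss_integrable:
  fixes u v :: "'a::euclidean_space \<Rightarrow> real"
  assumes t: "t > 0" and u: "integrable lborel u" and v: "integrable lborel v"
  shows "integrable lborel (\<lambda>\<xi>. of_real (exp (- t * (norm \<xi>)\<^sup>2)) * (fourier u \<xi> * cnj (fourier v \<xi>)))"
proof -
  have [measurable]: "fourier u \<in> borel_measurable borel" "fourier v \<in> borel_measurable borel"
    using u v by (auto intro: fourier_measurable)
  show ?thesis
  proof (rule Bochner_Integration.integrable_bound[OF integrable_mult_left[OF gauss_integrable[OF t], of "(LINT x|lborel. \<bar>u x\<bar>) * (LINT x|lborel. \<bar>v x\<bar>)"]])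
    show "AE x in lborel. norm (of_real (exp (- t * (norm x)\<^sup>2)) * (fourier u x * cnj (fourier v x))) \<le> norm (exp (- t * (norm x)\<^sup>2) * ((LINT x|lborel. \<bar>u x\<bar>) * (LINT x|lborel. \<bar>v x\<bar>)))"
      using fourier_bound[OF u] fourier_bound[OF v]
      by (auto simp: norm_mult intro!: mult_left_mono mult_mono order_trans[OF _ abs_ge_self])
  qed measurable
qed

lemma heat_plancherel:
  fixes u v :: "'a::euclidean_space \<Rightarrow> real"
  assumes t: "t > 0" and u: "integrable lborel u" and v: "integrable lborel v"
  shows "integrable lborel (\<lambda>\<xi>. exp (- t * (norm \<xi>)\<^sup>2) * Re (fourier u \<xi> * cnj (fourier v \<xi>)))"
    and "(LINT \<xi>|lborel. exp (- t * (norm \<xi>)\<^sup>2) * Re (fourier u \<xi> * cnj (fourier v \<xi>))) = (2 * pi) ^ DIM('a) * heat_form t u v"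
proof -
  have e: "exp (- t * (norm \<xi>)\<^sup>2) * Re (fourier u \<xi> * cnj (fourier v \<xi>)) = Re (of_real (exp (- t * (norm \<xi>)\<^sup>2)) * (fourier u \<xi> * cnj (fourier v \<xi>)))" for \<xi>
    by simp
  show "integrable lborel (\<lambda>\<xi>. exp (- t * (norm \<xi>)\<^sup>2) * Re (fourier u \<xi> * cnj (fourier v \<xi>)))"
    unfolding e by (intro integrable_Re fourier_gauss_integrable assms)
  show "(LINT \<xi>|lborel. exp (- t * (norm \<xi>)\<^sup>2) * Re (fourier u \<xi> * cnj (fourier v \<xi>))) = (2 * pi) ^ DIM('a) * heat_form t u v"
    unfolding e integral_Re[OF fourier_gauss_integrable[OF assms]] heat_plancherel_complex[OF assms] by simp
qed

lemma convolution_integrable: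
  fixes f g :: "'a::euclidean_space \<Rightarrow> real"
  assumes f: "integrable lborel f" and g: "integrable lborel g"
  shows "integrable (lborel \<Otimes>\<^sub>M lborel) (\<lambda>(x,y). f x * g (x - y))"
    and "(LINT (x,y)|(lborel \<Otimes>\<^sub>M lborel). f x * g (x - y)) = (LINT x|lborel. f x) * (LINT x|lborel. g x)"
proof -
  have [measurable]: "f \<in> borel_measurable borel" "g \<in> borel_measurable borel" using f g by auto
  have gi: "integrable lborel (\<lambda>y. g (x - y))" for x using g by (simp add: lborel_reflect(2))
  show I: "integrable (lborel \<Otimes>\<^sub>M lborel) (\<lambda>(x,y). f x * g (x - y))"
  proof (rule lborel_pair.Fubini_integrable)
    show "integrable lborel (\<lambda>x. LINT y|lborel. norm (case (x, y) of (x, y) \<Rightarrow> f x * g (x - y)))"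
      using f lborel_reflect(1)[of "\<lambda>x. norm (g x)"] by (simp add: abs_mult)
  qed (use gi in auto)
  show "(LINT (x,y)|(lborel \<Otimes>\<^sub>M lborel). f x * g (x - y)) = (LINT x|lborel. f x) * (LINT x|lborel. g x)"
    using lborel_pair.integral_fst[OF I] lborel_reflect(1)[of g] by simp
qed

lemma heat_kernel_marginals:
  fixes f :: "'a::euclidean_space \<Rightarrow> real"
  assumes t: "t > 0" and f: "integrable lborel f"
  shows "integrable (lborel \<Otimes>\<^sub>M lborel) (\<lambda>(x,y). f x * heat_kernel t (x - y))"
    and "(LINT (x,y)|(lborel \<Otimes>\<^sub>M lborel). f x * heat_kernel t (x - y)) = (LINT x|lborel. f x)"
    and "integrable (lborel \<Otimes>\<^sub>M lborel) (\<lambda>(x,y). f y * heat_kernel t (x - y))"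
    and "(LINT (x,y)|(lborel \<Otimes>\<^sub>M lborel). f y * heat_kernel t (x - y)) = (LINT x|lborel. f x)"
proof -
  note c = convolution_integrable[OF f heat_kernel_integral(1)[OF t]]
  show 1: "integrable (lborel \<Otimes>\<^sub>M lborel) (\<lambda>(x,y). f x * heat_kernel t (x - y))"
    and 2: "(LINT (x,y)|(lborel \<Otimes>\<^sub>M lborel). f x * heat_kernel t (x - y)) = (LINT x|lborel. f x)"
    using c by (simp_all add: heat_kernel_integral(2)[OF t])
  show "integrable (lborel \<Otimes>\<^sub>M lborel) (\<lambda>(x,y). f y * heat_kernel t (x - y))"
    using lborel_pair.integrable_product_swap[OF 1] by (simp add: heat_kernel_commute split_beta')
  show "(LINT (x,y)|(lborel \<Otimes>\<^sub>M lborel). f y * heat_kernel t (x - y)) = (LINT x|lborel. f x)"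
    using lborel_pair.integral_product_swap[OF borel_measurable_integrable[OF 1]] 2
    by (simp add: heat_kernel_commute split_beta')
qed

text \<open>On the Fourier side this form has the symbol 1 - exp (- t |\<xi>|^2), whose averages
  over \<open>t\<close> produce the fractional symbol.\<close>

definition heat_energy :: "real \<Rightarrow> ('a::euclidean_space \<Rightarrow> real) \<Rightarrow> ('a \<Rightarrow> real) \<Rightarrow> real" where
  "heat_energy t u v = (LINT x|lborel. u x * v x) - heat_form t u v"

text \<open>Expanding the product gives two diagonal terms, each equal to the integral of
  \<open>u x * v x\<close> because the kernel has mass 1, and two cross terms, each equal to
  \<open>heat_form t u v\<close> because the kernel is even. This form shows positivity and makes
  pointwise inequalities available.\<close>

lemma heat_energy_eq:
  fixes u v :: "'a::euclidean_space \<Rightarrow> real"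
  assumes t: "t > 0" and u: "L12 u" and v: "L12 v"
  shows "integrable (lborel \<Otimes>\<^sub>M lborel) (\<lambda>(x,y). (u x - u y) * (v x - v y) * heat_kernel t (x - y))"
    and "2 * heat_energy t u v = (LINT (x,y)|(lborel \<Otimes>\<^sub>M lborel). (u x - u y) * (v x - v y) * heat_kernel t (x - y))"
proof -
  note uv = L12D[OF u] L12D[OF v] L12_mult[OF u v]
  let ?h = "\<lambda>x y. heat_kernel t (x - y :: 'a)"
  note i1 = heat_kernel_marginals[OF t uv(7)]
  note i2 = heat_form_integrable[OF t uv(1,4)]
  note i3 = lborel_pair.integrable_product_swap[OF i2]
  have i3': "integrable (lborel \<Otimes>\<^sub>M lborel) (\<lambda>(x,y). u y * v x * ?h x y)"
    using i3 by (simp add: heat_kernel_commute split_beta')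
  have e3: "(LINT (x,y)|(lborel \<Otimes>\<^sub>M lborel). u y * v x * ?h x y) = heat_form t u v"
    using lborel_pair.integral_product_swap[OF borel_measurable_integrable[OF i2]] unfolding heat_form_def
    by (simp add: heat_kernel_commute split_beta')
  have e: "(\<lambda>(x,y). (u x - u y) * (v x - v y) * ?h x y) = (\<lambda>p. ((case p of (x, y) \<Rightarrow> u x * v x * ?h x y) + (case p of (x, y) \<Rightarrow> u y * v y * ?h x y))
     - ((case p of (x, y) \<Rightarrow> u x * v y * ?h x y) + (case p of (x, y) \<Rightarrow> u y * v x * ?h x y)))"
    by (auto simp: algebra_simps)
  show "integrable (lborel \<Otimes>\<^sub>M lborel) (\<lambda>(x,y). (u x - u y) * (v x - v y) * ?h x y)"
    unfolding e by (intro Bochner_Integration.integrable_diff Bochner_Integration.integrable_add i1 i2 i3')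
  show "2 * heat_energy t u v = (LINT (x,y)|(lborel \<Otimes>\<^sub>M lborel). (u x - u y) * (v x - v y) * ?h x y)"
    unfolding e heat_energy_def
    by (simp only: Bochner_Integration.integral_diff Bochner_Integration.integral_add i1 i2 i3' Bochner_Integration.integrable_add e3) (simp add: heat_form_def)
qed

lemma heat_energy_nonneg: "t > 0 \<Longrightarrow> L12 u \<Longrightarrow> heat_energy t u u \<ge> 0"
  using heat_energy_eq(2)[of t u u]
  by (smt (verit, best) heat_kernel_nonneg integral_nonneg_AE AE_I2 case_prod_beta mult_nonneg_nonneg zero_le_square)

lemma heat_energy_add_le:
  fixes u v :: "'a::euclidean_space \<Rightarrow> real"
  assumes t: "t > 0" and u: "L12 u" and v: "L12 v"
  shows "heat_energy t (\<lambda>x. u x + v x) (\<lambda>x. u x + v x) \<le> 2 * heat_energy t u u + 2 * heat_energy t v v"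
proof -
  let ?h = "\<lambda>x y. heat_kernel t (x - y :: 'a)"
  note a = heat_energy_eq[OF t L12_add[OF u v] L12_add[OF u v]]
  note b = heat_energy_eq[OF t u u] and c = heat_energy_eq[OF t v v]
  have "2 * heat_energy t (\<lambda>x. u x + v x) (\<lambda>x. u x + v x) \<le> (LINT p|(lborel \<Otimes>\<^sub>M lborel). 2 * (case p of (x, y) \<Rightarrow> (u x - u y) * (u x - u y) * ?h x y) + 2 * (case p of (x, y) \<Rightarrow> (v x - v y) * (v x - v y) * ?h x y))"
    unfolding a(2)
  proof (rule integral_mono)
    fix p :: "'a \<times> 'a" obtain x y where p: "p = (x, y)" by force
    have "(u x + v x - (u y + v y))\<^sup>2 \<le> 2 * (u x - u y)\<^sup>2 + 2 * (v x - v y)\<^sup>2"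
      using sum_squares_bound[of "u x - u y" "v x - v y"] by (simp add: power2_eq_square algebra_simps)
    from mult_right_mono[OF this heat_kernel_nonneg[of t "x - y"]]
    show "(case p of (x, y) \<Rightarrow> (u x + v x - (u y + v y)) * (u x + v x - (u y + v y)) * ?h x y) \<le> 2 * (case p of (x, y) \<Rightarrow> (u x - u y) * (u x - u y) * ?h x y) + 2 * (case p of (x, y) \<Rightarrow> (v x - v y) * (v x - v y) * ?h x y)"
      unfolding p power2_eq_square by (simp add: algebra_simps)
  qed (use a b c in auto)
  also have "\<dots> = 2 * (2 * heat_energy t u u + 2 * heat_energy t v v)" using b c by simp
  finally show ?thesis by simp
qed

lemma heat_energy_le:
  fixes u :: "'a::euclidean_space \<Rightarrow> real"
  assumes t: "t > 0" and u: "L12 u"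
  shows "heat_energy t u u \<le> 2 * (LINT x|lborel. (u x)\<^sup>2)"
proof -
  let ?h = "\<lambda>x y. heat_kernel t (x - y :: 'a)"
  note i1 = heat_kernel_marginals[OF t L12D(2)[OF u]]
  have "2 * heat_energy t u u \<le> (LINT p|(lborel \<Otimes>\<^sub>M lborel). 2 * (case p of (x, y) \<Rightarrow> (u x)\<^sup>2 * ?h x y) + 2 * (case p of (x, y) \<Rightarrow> (u y)\<^sup>2 * ?h x y))"
    unfolding heat_energy_eq(2)[OF t u u]
  proof (rule integral_mono)
    fix p :: "'a \<times> 'a" obtain x y where p: "p = (x, y)" by force
    have "0 \<le> (u x + u y)\<^sup>2" by simp
    then have "(u x - u y)\<^sup>2 \<le> 2 * (u x)\<^sup>2 + 2 * (u y)\<^sup>2" by (simp add: power2_eq_square algebra_simps)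
    from mult_right_mono[OF this heat_kernel_nonneg[of t "x - y"]]
    show "(case p of (x, y) \<Rightarrow> (u x - u y) * (u x - u y) * ?h x y) \<le> 2 * (case p of (x, y) \<Rightarrow> (u x)\<^sup>2 * ?h x y) + 2 * (case p of (x, y) \<Rightarrow> (u y)\<^sup>2 * ?h x y)"
      unfolding p power2_eq_square by (simp add: algebra_simps)
  qed (use i1 heat_energy_eq(1)[OF t u u] in auto)
  also have "\<dots> = 4 * (LINT x|lborel. (u x)\<^sup>2)" using i1 by simp
  finally show ?thesis by simp
qed

section \<open>Approximation in L2 by continuous functions of bounded support\<close>

lemma L2_approx_bounded:
  fixes u :: "'a::euclidean_space \<Rightarrow> real"
  assumes u: "L12 u" and e: "e > 0"
  shows "\<exists>v M. v \<in> borel_measurable borel \<and> (\<forall>x. \<bar>v x\<bar> \<le> M) \<and> (\<forall>x. norm x > M \<longrightarrow> v x = 0) \<and>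
     (LINT x|lborel. (u x - v x)\<^sup>2) < e"
proof -
  have [measurable]: "u \<in> borel_measurable borel" using u by (rule L12D)
  define v where "v k x = (if norm x \<le> real k then max (- real k) (min (real k) (u x)) else 0)" for k :: nat and x
  have [measurable]: "v k \<in> borel_measurable borel" for k unfolding v_def by measurable
  have "(\<lambda>k. LINT x|lborel. (u x - v k x)\<^sup>2) \<longlonglongrightarrow> (LINT x|(lborel::'a measure). (0::real))"
  proof (rule integral_dominated_convergence[where w="\<lambda>x::'a. (u x)\<^sup>2"])
    show "integrable lborel (\<lambda>x. (u x)\<^sup>2)" using u by (rule L12D)
    show "AE x in lborel. (\<lambda>k. (u x - v k x)\<^sup>2) \<longlonglongrightarrow> 0"
    proof (rule AE_I2, rule tendsto_eventually)
      fix x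
      obtain m :: nat where m: "norm x \<le> real m" "\<bar>u x\<bar> \<le> real m"
        using real_arch_simple[of "max (norm x) \<bar>u x\<bar>"] by auto
      show "\<forall>\<^sub>F k in sequentially. (u x - v k x)\<^sup>2 = 0"
      proof (rule eventually_sequentiallyI)
        fix k assume "m \<le> k"
        then have "real m \<le> real k" by simp
        with m have "norm x \<le> real k" "- real k \<le> u x" "u x \<le> real k" by linarith+
        then show "(u x - v k x)\<^sup>2 = 0" by (simp add: v_def)
      qed
    qed
    have "\<bar>u x - v k x\<bar> \<le> \<bar>u x\<bar>" for k x unfolding v_def by auto
    then show "AE x in lborel. norm ((u x - v k x)\<^sup>2) \<le> (u x)\<^sup>2" for k
      by (simp add: abs_le_square_iff)
  qed measurable
  then have "\<forall>\<^sub>F k in sequentially. (LINT x|lborel. (u x - v k x)\<^sup>2) < e"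
    using e by (auto dest: order_tendstoD(2))
  then obtain k where "(LINT x|lborel. (u x - v k x)\<^sup>2) < e" by (meson eventually_sequentially order_refl)
  then show ?thesis by (intro exI[of _ "v k"] exI[of _ "real k"]) (auto simp: v_def)
qed

lemma integrable_indicator_cball: "integrable lborel (\<lambda>x::'a::euclidean_space. M * indicator (cball 0 R) x :: real)"
  using emeasure_lborel_cball_finite[of "0::'a" R] by (intro integrable_mult_right integrable_real_indicator) auto

lemma L12_bounded_support:
  fixes v :: "'a::euclidean_space \<Rightarrow> real"
  assumes [measurable]: "v \<in> borel_measurable borel" and v: "\<And>x. \<bar>v x\<bar> \<le> M" "\<And>x. norm x > R \<Longrightarrow> v x = 0"
  shows "L12 v"
  unfolding L12_def
proof
  have M0: "M \<ge> 0" using v(1)[of 0] by linarith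
  have "\<bar>v x\<bar> \<le> M * indicator (cball 0 R) x" for x using v[of x] by (auto simp: indicator_def not_le)
  then show "integrable lborel v"
    using M0 by (intro Bochner_Integration.integrable_bound[OF integrable_indicator_cball[of M R]]) auto
  have "(v x)\<^sup>2 \<le> M\<^sup>2 * indicator (cball 0 R) x" for x
    using v[of x] by (auto simp: indicator_def not_le abs_le_square_iff[symmetric])
  then show "integrable lborel (\<lambda>x. (v x)\<^sup>2)"
    by (intro Bochner_Integration.integrable_bound[OF integrable_indicator_cball[of "M\<^sup>2" R]]) auto
qed

text \<open>A measurable function is almost everywhere a limit of continuous functions
  \<open>g n\<close>. Clipping these at height \<open>M\<close> and multiplying by a continuous
  cutoff that is 1 where \<open>v\<close> may be nonzero preserves the limit and bounds all terms by
  a multiple of the indicator of one ball, so dominated convergence applies.\<close>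

lemma L2_approx_continuous_of_bounded:
  fixes v :: "'a::euclidean_space \<Rightarrow> real"
  assumes [measurable]: "v \<in> borel_measurable borel" and v: "\<And>x. \<bar>v x\<bar> \<le> M" "\<And>x. norm x > M \<Longrightarrow> v x = 0" and e: "e > 0"
  shows "\<exists>\<phi>. continuous_on UNIV \<phi> \<and> (\<forall>x. \<bar>\<phi> x\<bar> \<le> M) \<and> (\<forall>x. norm x > M + 1 \<longrightarrow> \<phi> x = 0) \<and>
     (LINT x|lborel. (v x - \<phi> x)\<^sup>2) < e"
proof -
  have M0: "M \<ge> 0" using v(1)[of 0] by linarith
  have "v \<in> borel_measurable lebesgue" by (simp add: measurable_completion)
  then have "v measurable_on UNIV" by (rule lebesgue_measurable_imp_measurable_on_real) auto
  then obtain N g where N: "negligible N" and g: "\<And>n. continuous_on UNIV (g n)"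
      "\<And>x. x \<notin> N \<Longrightarrow> (\<lambda>n. g n x) \<longlonglongrightarrow> v x"
    unfolding measurable_on_def by auto
  define \<eta> where "\<eta> x = max 0 (min 1 (M + 1 - norm x))" for x :: 'a
  define f where "f n x = max (- M) (min M (g n x)) * \<eta> x" for n x
  have fc: "continuous_on UNIV (f n)" for n
    unfolding f_def \<eta>_def by (intro continuous_intros g)
  have [measurable]: "f n \<in> borel_measurable borel" for n by (rule borel_measurable_continuous_onI[OF fc])
  have \<eta>: "0 \<le> \<eta> x" "\<eta> x \<le> 1" for x by (auto simp: \<eta>_def)
  have fM: "\<bar>f n x\<bar> \<le> M" for n x
  proof -
    have "\<bar>max (- M) (min M (g n x))\<bar> \<le> M" using M0 by auto
    then have "\<bar>max (- M) (min M (g n x))\<bar> * \<eta> x \<le> M * 1" using \<eta> M0 by (intro mult_mono) auto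
    then show ?thesis using \<eta> by (simp add: f_def abs_mult)
  qed
  have f0: "f n x = 0" if "norm x > M + 1" for n x using that by (simp add: f_def \<eta>_def)
  have "AE x in lebesgue. x \<notin> N" using N eventually_ae_filter_negligible by (auto simp: eventually_ae_filter_negligible)
  then have "AE x in lebesgue. (\<lambda>n. g n x) \<longlonglongrightarrow> v x" using g(2) by (auto elim: eventually_mono)
  then have "AE x in lborel. (\<lambda>n. g n x) \<longlonglongrightarrow> v x" by (simp add: AE_completion_iff)
  then have lim: "AE x in lborel. (\<lambda>n. (v x - f n x)\<^sup>2) \<longlonglongrightarrow> 0"
  proof (rule eventually_mono)
    fix x assume x: "(\<lambda>n. g n x) \<longlonglongrightarrow> v x"
    have "(\<lambda>n. f n x) \<longlonglongrightarrow> max (- M) (min M (v x)) * \<eta> x"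
      unfolding f_def by (intro tendsto_intros x)
    also have "max (- M) (min M (v x)) * \<eta> x = v x"
    proof (cases "norm x > M")
      case True then show ?thesis using v M0 by simp
    next
      case False then show ?thesis using v(1)[of x] by (simp add: \<eta>_def abs_le_iff)
    qed
    finally have "(\<lambda>n. (v x - f n x)\<^sup>2) \<longlonglongrightarrow> (v x - v x)\<^sup>2" by (intro tendsto_intros)
    then show "(\<lambda>n. (v x - f n x)\<^sup>2) \<longlonglongrightarrow> 0" by simp
  qed
  have "(\<lambda>k. LINT x|lborel. (v x - f k x)\<^sup>2) \<longlonglongrightarrow> (LINT x|(lborel::'a measure). (0::real))"
  proof (rule integral_dominated_convergence[where w="\<lambda>x::'a. (2 * M)\<^sup>2 * indicator (cball 0 (M+1)) x"])
    show "AE x in lborel. norm ((v x - f k x)\<^sup>2) \<le> (2 * M)\<^sup>2 * indicator (cball 0 (M+1)) x" for k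
    proof (rule AE_I2)
      fix x
      show "norm ((v x - f k x)\<^sup>2) \<le> (2 * M)\<^sup>2 * indicator (cball 0 (M+1)) x"
      proof (cases "norm x > M + 1")
        case True then show ?thesis using v(2)[of x] f0[of x k] by simp
      next
        case False
        have "\<bar>v x - f k x\<bar> \<le> \<bar>2 * M\<bar>" using v(1)[of x] fM[of k x] by linarith
        then show ?thesis using False by (simp only: abs_le_square_iff) simp
      qed
    qed
  qed (use lim integrable_indicator_cball in auto)
  then have "\<forall>\<^sub>F k in sequentially. (LINT x|lborel. (v x - f k x)\<^sup>2) < e"
    using e by (auto dest: order_tendstoD(2))
  then obtain k where "(LINT x|lborel. (v x - f k x)\<^sup>2) < e" by (meson eventually_sequentially order_refl)
  then show ?thesis using fc fM f0 by blast
qed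

lemma L2_approx_continuous:
  fixes u :: "'a::euclidean_space \<Rightarrow> real"
  assumes u: "L12 u" and e: "e > 0"
  shows "\<exists>\<phi> M. continuous_on UNIV \<phi> \<and> (\<forall>x. \<bar>\<phi> x\<bar> \<le> M) \<and> (\<forall>x. norm x > M \<longrightarrow> \<phi> x = 0) \<and>
     (LINT x|lborel. (u x - \<phi> x)\<^sup>2) < e"
proof -
  obtain v M where v[measurable]: "v \<in> borel_measurable borel" and v1: "\<And>x. \<bar>v x\<bar> \<le> M" and v2: "\<And>x. norm x > M \<Longrightarrow> v x = 0"
    and uv: "(LINT x|lborel. (u x - v x)\<^sup>2) < e / 4"
    using L2_approx_bounded[OF u, of "e/4"] e by auto
  obtain \<phi> where p: "continuous_on UNIV \<phi>" "\<And>x. \<bar>\<phi> x\<bar> \<le> M" "\<And>x. norm x > M + 1 \<Longrightarrow> \<phi> x = 0"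
    and vp: "(LINT x|lborel. (v x - \<phi> x)\<^sup>2) < e / 4"
    using L2_approx_continuous_of_bounded[OF v v1 v2, of "e/4"] e by auto
  have L: "L12 v" "L12 \<phi>"
    using v1 v2 p L12_bounded_support[OF v, of M M] L12_bounded_support[OF borel_measurable_continuous_onI, of \<phi> M "M+1"] by auto
  have "(LINT x|lborel. (u x - \<phi> x)\<^sup>2) \<le> (LINT x|lborel. 2 * (u x - v x)\<^sup>2 + 2 * (v x - \<phi> x)\<^sup>2)"
  proof (rule integral_mono)
    show "(u x - \<phi> x)\<^sup>2 \<le> 2 * (u x - v x)\<^sup>2 + 2 * (v x - \<phi> x)\<^sup>2" for x
      using sum_squares_bound[of "u x - v x" "v x - \<phi> x"] by (simp add: power2_eq_square algebra_simps)
  qed (use L12D(2)[OF L12_diff[OF u L(2)]] L12D(2)[OF L12_diff[OF u L(1)]] L12D(2)[OF L12_diff[OF L]] in auto)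
  also have "\<dots> = 2 * (LINT x|lborel. (u x - v x)\<^sup>2) + 2 * (LINT x|lborel. (v x - \<phi> x)\<^sup>2)"
    using L12D(2)[OF L12_diff[OF u L(1)]] L12D(2)[OF L12_diff[OF L]] by simp
  also have "\<dots> < e" using uv vp by simp
  finally have "(LINT x|lborel. (u x - \<phi> x)\<^sup>2) < e" .
  moreover have "\<bar>\<phi> x\<bar> \<le> M + 1" for x using p(2)[of x] by linarith
  ultimately show ?thesis using p by blast
qed

section \<open>Small times and the Plancherel identity\<close>

text \<open>The substitution y = x - sqrt t z moves the time from the kernel into the argument of
  \<open>\<phi>\<close>. The kernel is then the fixed one at time 1, continuity gives the pointwise
  limit, and boundedness of \<open>\<phi>\<close> gives domination.\<close>

lemma heat_energy_tendsto_0_continuous: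
  fixes \<phi> :: "'a::euclidean_space \<Rightarrow> real"
  assumes c: "continuous_on UNIV \<phi>" and b: "\<And>x. \<bar>\<phi> x\<bar> \<le> M" "\<And>x. norm x > M \<Longrightarrow> \<phi> x = 0"
  shows "(\<lambda>k. heat_energy (1 / Suc k) \<phi> \<phi>) \<longlonglongrightarrow> 0"
proof -
  have [measurable]: "\<phi> \<in> borel_measurable borel" using c by (rule borel_measurable_continuous_onI)
  have L: "L12 \<phi>" using b by (intro L12_bounded_support) auto
  have M0: "M \<ge> 0" using b(1)[of 0] by linarith
  let ?f = "\<lambda>t (x, z). \<phi> x * heat_kernel 1 z * \<phi> (x - sqrt t *\<^sub>R z)"
  have ms: "(\<lambda>(x, z). \<phi> (x - sqrt t *\<^sub>R z)) \<in> borel_measurable (lborel \<Otimes>\<^sub>M lborel)" for t by measurable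
  have If: "integrable (lborel \<Otimes>\<^sub>M lborel) (?f t)" for t
    by (rule integrable_prod_bounded[OF L12D(1)[OF L] heat_kernel_integral(1)[OF zero_less_one] ms]) (use b in simp)
  have e: "heat_form t \<phi> \<phi> = (LINT p|(lborel \<Otimes>\<^sub>M lborel). ?f t p)" if t: "t > 0" for t
  proof -
    have "(LINT y|lborel. \<phi> y * heat_kernel t (x - y)) = (LINT z|lborel. heat_kernel 1 z * \<phi> (x - sqrt t *\<^sub>R z))" for x
    proof -
      have "(LINT y|lborel. \<phi> y * heat_kernel t (x - y)) = (LINT y|lborel. \<phi> (x - y) * heat_kernel t y)"
        using lborel_reflect(1)[of "\<lambda>y. \<phi> y * heat_kernel t (x - y)" x] by simp
      also have "\<dots> = (sqrt t ^ DIM('a)) *\<^sub>R (LINT z|lborel. \<phi> (x - sqrt t *\<^sub>R z) * heat_kernel t (sqrt t *\<^sub>R z))"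
        using t by (intro lborel_scale) auto
      also have "\<dots> = (sqrt t ^ DIM('a)) * (t powr (- real DIM('a) / 2)) * (LINT z|lborel. heat_kernel 1 z * \<phi> (x - sqrt t *\<^sub>R z))"
        unfolding heat_kernel_scale[OF t] mult.left_commute[of "\<phi> _"] integral_mult_right_zero
        by (simp add: mult_ac)
      also have "sqrt t ^ DIM('a) * t powr (- real DIM('a) / 2) = 1"
        using t by (simp add: powr_half_sqrt[symmetric] powr_powr powr_minus flip: powr_realpow)
      finally show ?thesis by simp
    qed
    then have "(LINT x|lborel. LINT y|lborel. \<phi> x * \<phi> y * heat_kernel t (x - y)) = (LINT x|lborel. LINT z|lborel. \<phi> x * heat_kernel 1 z * \<phi> (x - sqrt t *\<^sub>R z))"
      by (simp add: mult.assoc)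
    then show ?thesis
      unfolding heat_form_def
      using lborel_pair.integral_fst[OF heat_form_integrable[OF t L12D(1)[OF L] L12D(1)[OF L]]] lborel_pair.integral_fst[OF If[of t]]
      by simp
  qed
  have "(\<lambda>k. LINT p|(lborel \<Otimes>\<^sub>M lborel). ?f (1 / Suc k) p) \<longlonglongrightarrow> (LINT p|(lborel \<Otimes>\<^sub>M lborel). ?f 0 p)"
  proof (rule integral_dominated_convergence[where w="\<lambda>(x,z). \<bar>\<phi> x\<bar> * heat_kernel 1 z * M"])
    show "integrable (lborel \<Otimes>\<^sub>M lborel) (\<lambda>(x, z). \<bar>\<phi> x\<bar> * heat_kernel 1 z * M)"
      using L12D(1)[OF L] by (intro integrable_prod_bounded[where C=M] heat_kernel_integral(1)) (auto simp: M0)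
    show "AE p in lborel \<Otimes>\<^sub>M lborel. (\<lambda>k. ?f (1 / real (Suc k)) p) \<longlonglongrightarrow> ?f 0 p"
    proof (rule AE_I2)
      fix p :: "'a \<times> 'a" obtain x z where p: "p = (x, z)" by force
      have "(\<lambda>k. sqrt (1 / real (Suc k))) \<longlonglongrightarrow> sqrt 0"
        by (intro tendsto_real_sqrt) (rule lim_1_over_n[THEN LIMSEQ_Suc])
      then have "(\<lambda>k. x - sqrt (1 / real (Suc k)) *\<^sub>R z) \<longlonglongrightarrow> x - sqrt 0 *\<^sub>R z"
        by (intro tendsto_diff tendsto_scaleR tendsto_const)
      then have "(\<lambda>k. \<phi> (x - sqrt (1 / real (Suc k)) *\<^sub>R z)) \<longlonglongrightarrow> \<phi> (x - sqrt 0 *\<^sub>R z)"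
        by (rule continuous_on_tendsto_compose[OF c]) auto
      then show "(\<lambda>k. ?f (1 / real (Suc k)) p) \<longlonglongrightarrow> ?f 0 p" unfolding p by (simp del: of_nat_Suc) (intro tendsto_intros)
    qed
    show "AE p in lborel \<Otimes>\<^sub>M lborel. norm (?f (1 / real (Suc k)) p) \<le> (case p of (x, z) \<Rightarrow> \<bar>\<phi> x\<bar> * heat_kernel 1 z * M)" for k
      using b(1) by (intro AE_I2) (auto simp: abs_mult heat_kernel_nonneg split_beta' intro!: mult_left_mono)
  qed (use If in auto)
  moreover have "(LINT p|(lborel \<Otimes>\<^sub>M lborel). ?f 0 p) = (LINT x|lborel. \<phi> x * \<phi> x)"
    using lborel_pair.integral_fst[OF If[of 0]] by (simp add: mult.assoc mult.left_commute[of "\<phi> _" "heat_kernel 1 _"] heat_kernel_integral(2))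
  ultimately have "(\<lambda>k. heat_form (1 / Suc k) \<phi> \<phi>) \<longlonglongrightarrow> (LINT x|lborel. \<phi> x * \<phi> x)"
    using e by simp
  then have "(\<lambda>k. (LINT x|lborel. \<phi> x * \<phi> x) - heat_form (1 / Suc k) \<phi> \<phi>) \<longlonglongrightarrow> (LINT x|lborel. \<phi> x * \<phi> x) - (LINT x|lborel. \<phi> x * \<phi> x)"
    by (intro tendsto_intros)
  then show ?thesis by (simp add: heat_energy_def)
qed

text \<open>The bound \<open>heat_energy_le\<close> is uniform in \<open>t\<close>, so the limit
  extends from continuous functions by density. The shares e / 4 and e / 8 are chosen so that 2 (e /
  4) + 2 * 2 (e / 8) = e.\<close>

lemma heat_energy_tendsto_0:
  fixes u :: "'a::euclidean_space \<Rightarrow> real"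
  assumes u: "L12 u"
  shows "(\<lambda>k. heat_energy (1 / Suc k) u u) \<longlonglongrightarrow> 0"
proof (rule tendstoI)
  fix e :: real assume e: "e > 0"
  obtain \<phi> M where c: "continuous_on UNIV \<phi>" and b: "\<And>x. \<bar>\<phi> x\<bar> \<le> M" "\<And>x. norm x > M \<Longrightarrow> \<phi> x = 0"
    and d: "(LINT x|lborel. (u x - \<phi> x)\<^sup>2) < e / 8"
    using L2_approx_continuous[OF u, of "e/8"] e by auto
  have L: "L12 \<phi>" using b c by (intro L12_bounded_support borel_measurable_continuous_onI) auto
  have "\<forall>\<^sub>F k in sequentially. heat_energy (1 / Suc k) \<phi> \<phi> < e / 4"
    by (rule order_tendstoD(2)[OF heat_energy_tendsto_0_continuous[OF c b]]) (use e in auto)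
  then show "\<forall>\<^sub>F k in sequentially. dist (heat_energy (1 / Suc k) u u) 0 < e"
  proof (rule eventually_mono)
    fix k assume k: "heat_energy (1 / Suc k) \<phi> \<phi> < e / 4"
    have t: "1 / real (Suc k) > 0" by simp
    have "heat_energy (1 / Suc k) (\<lambda>x. \<phi> x + (u x - \<phi> x)) (\<lambda>x. \<phi> x + (u x - \<phi> x))
       \<le> 2 * heat_energy (1 / Suc k) \<phi> \<phi> + 2 * heat_energy (1 / Suc k) (\<lambda>x. u x - \<phi> x) (\<lambda>x. u x - \<phi> x)"
      by (rule heat_energy_add_le[OF t L L12_diff[OF u L]])
    moreover have "heat_energy (1 / Suc k) (\<lambda>x. u x - \<phi> x) (\<lambda>x. u x - \<phi> x) \<le> 2 * (LINT x|lborel. (u x - \<phi> x)\<^sup>2)"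
      by (rule heat_energy_le[OF t L12_diff[OF u L]])
    ultimately have "heat_energy (1 / Suc k) u u < e" using k d by simp
    then show "dist (heat_energy (1 / Suc k) u u) 0 < e" using heat_energy_nonneg[OF t u] by simp
  qed
qed

text \<open>Along the times 1 / (k + 1) the Gaussian factors increase to 1 while the regularized
  integrals converge by \<open>heat_energy_tendsto_0\<close>. Monotone convergence yields the
  integrability and the value together.\<close>

theorem plancherel_norm:
  fixes u :: "'a::euclidean_space \<Rightarrow> real"
  assumes u: "L12 u"
  shows "integrable lborel (\<lambda>\<xi>. (cmod (fourier u \<xi>))\<^sup>2)"
    and "(LINT \<xi>|lborel. (cmod (fourier u \<xi>))\<^sup>2) = (2 * pi) ^ DIM('a) * (LINT x|lborel. (u x)\<^sup>2)"
proof -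
  have [measurable]: "fourier u \<in> borel_measurable borel" using L12D(1)[OF u] by (rule fourier_measurable)
  let ?f = "\<lambda>k \<xi>. exp (- (1 / real (Suc k)) * (norm \<xi>)\<^sup>2) * Re (fourier u \<xi> * cnj (fourier u \<xi>))"
  have r: "Re (z * cnj z) = (cmod z)\<^sup>2" for z by (simp add: complex_mult_cnj cmod_power2)
  have t: "1 / real (Suc k) > 0" for k by simp
  note hp = heat_plancherel[OF t L12D(1)[OF u] L12D(1)[OF u]]
  have lim: "(\<lambda>k. heat_form (1 / Suc k) u u) \<longlonglongrightarrow> (LINT x|lborel. (u x)\<^sup>2) - 0"
    using tendsto_diff[OF tendsto_const heat_energy_tendsto_0[OF u], of "LINT x|lborel. (u x)\<^sup>2"]
    by (simp add: heat_energy_def power2_eq_square)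
  have i: "integrable lborel (?f k)" for k by (rule hp)
  have mono: "AE \<xi> in lborel. mono (\<lambda>k. ?f k \<xi>)"
    unfolding r by (intro AE_I2 monoI mult_right_mono) (auto simp: field_simps intro!: mult_right_mono)
  have "(\<lambda>k. exp (- (1 / real (Suc k)) * (norm \<xi>)\<^sup>2) * (cmod (fourier u \<xi>))\<^sup>2) \<longlonglongrightarrow> exp (- 0 * (norm \<xi>)\<^sup>2) * (cmod (fourier u \<xi>))\<^sup>2" for \<xi> :: 'a
    by (intro tendsto_intros) (rule lim_1_over_n[THEN LIMSEQ_Suc])
  then have l: "AE \<xi> in lborel. (\<lambda>k. ?f k \<xi>) \<longlonglongrightarrow> (cmod (fourier u \<xi>))\<^sup>2"
    unfolding r by simp
  have il: "(\<lambda>k. LINT \<xi>|lborel. ?f k \<xi>) \<longlonglongrightarrow> (2 * pi) ^ DIM('a) * (LINT x|lborel. (u x)\<^sup>2)"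
    unfolding hp using lim by (intro tendsto_intros) simp
  show "integrable lborel (\<lambda>\<xi>. (cmod (fourier u \<xi>))\<^sup>2)"
    by (rule integrable_monotone_convergence[OF i mono l il]) measurable
  show "(LINT \<xi>|lborel. (cmod (fourier u \<xi>))\<^sup>2) = (2 * pi) ^ DIM('a) * (LINT x|lborel. (u x)\<^sup>2)"
    by (rule integral_monotone_convergence[OF i mono l il]) measurable
qed

lemma integrable_fourier_mult:
  fixes u v :: "'a::euclidean_space \<Rightarrow> real" and g :: "'a \<Rightarrow> real"
  assumes "integrable lborel u" "integrable lborel v" and [measurable]: "g \<in> borel_measurable borel"
    and "\<And>\<xi>. g \<xi> \<ge> 0"
    and "integrable lborel (\<lambda>\<xi>. g \<xi> * (cmod (fourier u \<xi>))\<^sup>2)" "integrable lborel (\<lambda>\<xi>. g \<xi> * (cmod (fourier v \<xi>))\<^sup>2)"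
  shows "integrable lborel (\<lambda>\<xi>. g \<xi> * Re (fourier u \<xi> * cnj (fourier v \<xi>)))"
proof (rule Bochner_Integration.integrable_bound[OF Bochner_Integration.integrable_add[OF assms(5,6)]])
  have [measurable]: "fourier u \<in> borel_measurable borel" "fourier v \<in> borel_measurable borel"
    using assms by (auto intro: fourier_measurable)
  show "(\<lambda>\<xi>. g \<xi> * Re (fourier u \<xi> * cnj (fourier v \<xi>))) \<in> borel_measurable lborel" by measurable
  have "\<bar>Re (a * cnj b)\<bar> \<le> (cmod a)\<^sup>2 + (cmod b)\<^sup>2" for a b
  proof -
    have "\<bar>Re (a * cnj b)\<bar> \<le> cmod a * cmod b" by (metis abs_Re_le_cmod complex_mod_cnj norm_mult)
    also have "\<dots> \<le> (cmod a)\<^sup>2 + (cmod b)\<^sup>2"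
      using sum_squares_bound[of "cmod a" "cmod b"] mult_nonneg_nonneg[of "cmod a" "cmod b"]
      unfolding mult.assoc by (smt (verit) norm_ge_zero)
    finally show ?thesis .
  qed
  then have "g \<xi> * \<bar>Re (fourier u \<xi> * cnj (fourier v \<xi>))\<bar> \<le> g \<xi> * ((cmod (fourier u \<xi>))\<^sup>2 + (cmod (fourier v \<xi>))\<^sup>2)" for \<xi>
    using assms(4) by (intro mult_left_mono)
  then have "norm (g \<xi> * Re (fourier u \<xi> * cnj (fourier v \<xi>))) \<le> norm (g \<xi> * (cmod (fourier u \<xi>))\<^sup>2 + g \<xi> * (cmod (fourier v \<xi>))\<^sup>2)" for \<xi>
    unfolding norm_mult real_norm_def distrib_left[symmetric] abs_mult using assms(4)[of \<xi>]
    by (metis abs_ge_self abs_of_nonneg mult_nonneg_nonneg add_nonneg_nonneg zero_le_power2)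
  then show "AE \<xi> in lborel. norm (g \<xi> * Re (fourier u \<xi> * cnj (fourier v \<xi>))) \<le> norm (g \<xi> * (cmod (fourier u \<xi>))\<^sup>2 + g \<xi> * (cmod (fourier v \<xi>))\<^sup>2)"
    by blast
qed

text \<open>Polarization of \<open>plancherel_norm\<close>.\<close>

theorem plancherel:
  fixes u v :: "'a::euclidean_space \<Rightarrow> real"
  assumes u: "L12 u" and v: "L12 v"
  shows "integrable lborel (\<lambda>\<xi>. Re (fourier u \<xi> * cnj (fourier v \<xi>)))"
    and "(LINT \<xi>|lborel. Re (fourier u \<xi> * cnj (fourier v \<xi>))) = (2 * pi) ^ DIM('a) * (LINT x|lborel. u x * v x)"
proof -
  note U = L12D[OF u] L12D[OF v]
  have c: "4 * Re (fourier u \<xi> * cnj (fourier v \<xi>)) = (cmod (fourier (\<lambda>x. u x + v x) \<xi>))\<^sup>2 - (cmod (fourier (\<lambda>x. u x - v x) \<xi>))\<^sup>2" for \<xi>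
    unfolding fourier_add[OF U(1,4)] fourier_diff[OF U(1,4)] cmod_power2 by (simp add: power2_eq_square algebra_simps)
  note p = plancherel_norm[OF L12_add[OF u v]] and m = plancherel_norm[OF L12_diff[OF u v]]
  show "integrable lborel (\<lambda>\<xi>. Re (fourier u \<xi> * cnj (fourier v \<xi>)))"
    using integrable_fourier_mult[OF U(1,4), of "\<lambda>_. 1"] plancherel_norm(1)[OF u] plancherel_norm(1)[OF v] by simp
  have "4 * (LINT \<xi>|lborel. Re (fourier u \<xi> * cnj (fourier v \<xi>))) = (LINT \<xi>|lborel. 4 * Re (fourier u \<xi> * cnj (fourier v \<xi>)))"
    by (rule integral_mult_right_zero[symmetric])
  also have "\<dots> = (2 * pi) ^ DIM('a) * ((LINT x|lborel. (u x + v x)\<^sup>2) - (LINT x|lborel. (u x - v x)\<^sup>2))"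
    unfolding c using p m by (simp add: algebra_simps)
  also have "(LINT x|lborel. (u x + v x)\<^sup>2) - (LINT x|lborel. (u x - v x)\<^sup>2) = (LINT x|lborel. 4 * (u x * v x))"
    using L12D(2)[OF L12_add[OF u v]] L12D(2)[OF L12_diff[OF u v]]
    by (subst Bochner_Integration.integral_diff[symmetric]) (auto simp: power2_eq_square algebra_simps intro!: Bochner_Integration.integral_cong)
  finally show "(LINT \<xi>|lborel. Re (fourier u \<xi> * cnj (fourier v \<xi>))) = (2 * pi) ^ DIM('a) * (LINT x|lborel. u x * v x)"
    by simp
qed

subsection \<open>The energy as an average of heat energies\<close>

text \<open>The extension by 0 to t <= 0 lets all averages over time be integrals over the whole
  real line.\<close>

definition frac_weight :: "real \<Rightarrow> real \<Rightarrow> real" where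
  "frac_weight s t = (if t > 0 then t powr (- 1 - s) else 0)"

lemma frac_weight_nonneg: "frac_weight s t \<ge> 0"
  by (simp add: frac_weight_def)

lemma frac_weight_measurable [measurable]: "frac_weight s \<in> borel_measurable borel"
  unfolding frac_weight_def[abs_def] by measurable

lemma integrable_of_has_integral:
  fixes f :: "real \<Rightarrow> real"
  assumes "(f has_integral I) S" "\<And>x. x \<in> S \<Longrightarrow> f x \<ge> 0"
    and [measurable]: "f \<in> borel_measurable borel" "S \<in> sets borel"
  shows "integrable lborel (\<lambda>x. indicator S x * f x)"
proof (rule integrableI_nonneg)
  have "(\<integral>\<^sup>+ x. ennreal (indicator S x * f x) \<partial>lborel) = ennreal I"
    using nn_integral_has_integral_lebesgue[OF assms(2,1)] by simp
  then show "(\<integral>\<^sup>+ x. ennreal (indicator S x * f x) \<partial>lborel) < \<infinity>" by simp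
qed (use assms(2) in \<open>auto simp: indicator_def\<close>)

text \<open>The integrand is t^(-s) near 0 and t^(-1-s) near infinity; the two ends converge because
  s < 1 and s > 0 respectively.\<close>

lemma frac_weight_integrable:
  assumes s: "0 < s" "s < 1"
  shows "integrable lborel (\<lambda>t. frac_weight s t * min 1 t)"
proof (rule Bochner_Integration.integrable_bound)
  show "integrable lborel (\<lambda>t. indicator {0..1} t * t powr (- s) + indicator {1..} t * t powr (- 1 - s))"
    using s by (intro Bochner_Integration.integrable_add integrable_of_has_integral[OF has_integral_powr_from_0]
      integrable_of_has_integral[OF has_integral_powr_to_inf]) auto
  have p: "t powr (- 1 - s) * t = t powr (- s)" if "t > 0" for t :: real
    using powr_add[of t "-1-s" 1] that by simp
  show "AE t in lborel. norm (frac_weight s t * min 1 t) \<le> norm (indicator {0..1} t * t powr (- s) + indicator {1..} t * t powr (- 1 - s))"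
    by (rule AE_I2) (auto simp: frac_weight_def indicator_def p min_def)
qed measurable

text \<open>The measure t^(-1-s) dt is homogeneous of degree -s under dilations. This is the common
  source of the power |\<xi>|^(2s) of the symbol and of the power L^(2s) in the cost of a cutoff
  with Lipschitz constant L.\<close>

lemma frac_weight_scale:
  fixes f :: "real \<Rightarrow> real"
  assumes D: "D > 0"
  shows "(LINT t|lborel. frac_weight s t * f (t / D)) = D powr (- s) * (LINT t|lborel. frac_weight s t * f t)"
    and "integrable lborel (\<lambda>t. frac_weight s t * f (t / D)) \<longleftrightarrow> integrable lborel (\<lambda>t. frac_weight s t * f t)"
proof -
  have e: "frac_weight s (0 + D * t) * f ((0 + D * t) / D) = D powr (- 1 - s) * (frac_weight s t * f t)" for t
    using D by (simp add: frac_weight_def zero_less_mult_iff powr_mult)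
  have "(LINT t|lborel. frac_weight s t * f (t / D)) = \<bar>D\<bar> *\<^sub>R (LINT t|lborel. frac_weight s (0 + D * t) * f ((0 + D * t) / D))"
    using D by (intro lborel_integral_real_affine) auto
  also have "\<dots> = (D * D powr (- 1 - s)) * (LINT t|lborel. frac_weight s t * f t)"
    using D unfolding e by simp
  also have "D * D powr (- 1 - s) = D powr (- s)"
    using powr_add[of D "-1-s" 1] D by (simp add: mult.commute)
  finally show "(LINT t|lborel. frac_weight s t * f (t / D)) = D powr (- s) * (LINT t|lborel. frac_weight s t * f t)" .
  have "integrable lborel (\<lambda>t. frac_weight s t * f (t / D)) \<longleftrightarrow> integrable lborel (\<lambda>t. frac_weight s (0 + D * t) * f ((0 + D * t) / D))"
    using D by (intro lborel_integrable_real_affine_iff[symmetric]) auto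
  also have "\<dots> \<longleftrightarrow> integrable lborel (\<lambda>t. frac_weight s t * f t)"
    unfolding e
  proof
    assume "integrable lborel (\<lambda>t. D powr (- 1 - s) * (frac_weight s t * f t))"
    from integrable_mult_right[OF this, of "1 / D powr (- 1 - s)"] show "integrable lborel (\<lambda>t. frac_weight s t * f t)"
      using D by simp
  qed auto
  finally show "integrable lborel (\<lambda>t. frac_weight s t * f (t / D)) \<longleftrightarrow> integrable lborel (\<lambda>t. frac_weight s t * f t)" .
qed

text \<open>By parts this is Euler's Gamma function at 1 - s, divided by s. It normalizes the
  average that represents the fractional symbol.\<close>

definition frac_const :: "real \<Rightarrow> real" where
  "frac_const s = (LINT t|lborel. frac_weight s t * (1 - exp (- t)))"

lemma one_minus_exp_bounds: "t \<ge> 0 \<Longrightarrow> 0 \<le> 1 - exp (- t)" "1 - exp (- t) \<le> min 1 (t :: real)"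
  using exp_ge_add_one_self[of "- t"] by auto

lemma frac_symbol_integrable_1:
  assumes s: "0 < s" "s < 1"
  shows "integrable lborel (\<lambda>t. frac_weight s t * (1 - exp (- t)))"
proof (rule Bochner_Integration.integrable_bound[OF frac_weight_integrable[OF s]])
  show "AE t in lborel. norm (frac_weight s t * (1 - exp (- t))) \<le> norm (frac_weight s t * min 1 t)"
  proof (rule AE_I2)
    fix t :: real
    show "norm (frac_weight s t * (1 - exp (- t))) \<le> norm (frac_weight s t * min 1 t)"
      using one_minus_exp_bounds[of t] by (cases "t > 0") (auto simp: abs_mult frac_weight_def intro!: mult_left_mono)
  qed
qed measurable

lemma frac_const_pos:
  assumes s: "0 < s" "s < 1"
  shows "frac_const s > 0"
proof -
  \<comment> \<open>On [1, 2] the decreasing weight is at least its value at 2 and the increasing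
    factor at least its value at 1.\<close>
  let ?c = "2 powr (- 1 - s) * (1 - exp (- 1))"
  have "?c = (LINT t|lborel. indicator {1..2::real} t * ?c)" by simp
  also have "\<dots> \<le> frac_const s"
    unfolding frac_const_def
  proof (rule integral_mono[OF _ frac_symbol_integrable_1[OF s]])
    show "integrable lborel (\<lambda>t::real. indicator {1..2} t * ?c)" by (intro integrable_mult_left integrable_real_indicator) auto
    fix t :: real
    show "indicator {1..2} t * ?c \<le> frac_weight s t * (1 - exp (- t))"
    proof (cases "t \<in> {1..2}")
      case True
      then have "2 powr (- 1 - s) \<le> t powr (- 1 - s)" using s by (intro powr_mono2') auto
      then show ?thesis using True by (auto simp: frac_weight_def intro!: mult_mono)
    next
      case False then show ?thesis
        using one_minus_exp_bounds(1)[of t] by (cases "t > 0") (auto simp: frac_weight_def)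
    qed
  qed
  finally show ?thesis by (rule less_le_trans[rotated]) (simp add: mult_pos_pos)
qed

text \<open>Dilating time by 1 / |\<xi>|^2 reduces the integral to the defining one of
  \<open>frac_const\<close>. At \<xi> = 0 both sides vanish, since
  \<open>0 powr (2 * s) = 0\<close>.\<close>

lemma frac_symbol:
  fixes \<xi> :: "'a::euclidean_space"
  assumes s: "0 < s" "s < 1"
  shows "integrable lborel (\<lambda>t. frac_weight s t * (1 - exp (- t * (norm \<xi>)\<^sup>2)))"
    and "(LINT t|lborel. frac_weight s t * (1 - exp (- t * (norm \<xi>)\<^sup>2))) = frac_const s * norm \<xi> powr (2 * s)"
proof -
  show "integrable lborel (\<lambda>t. frac_weight s t * (1 - exp (- t * (norm \<xi>)\<^sup>2)))"
  proof (cases "\<xi> = 0")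
    case False
    then have D: "1 / (norm \<xi>)\<^sup>2 > 0" by simp
    show ?thesis
      using frac_weight_scale(2)[OF D, of s "\<lambda>t. 1 - exp (- t)"] frac_symbol_integrable_1[OF s] by simp
  qed simp
  show "(LINT t|lborel. frac_weight s t * (1 - exp (- t * (norm \<xi>)\<^sup>2))) = frac_const s * norm \<xi> powr (2 * s)"
  proof (cases "\<xi> = 0")
    case False
    then have D: "1 / (norm \<xi>)\<^sup>2 > 0" by simp
    have "(1 / (norm \<xi>)\<^sup>2) powr (- s) = norm \<xi> powr (2 * s)"
      using False by (simp add: powr_divide powr_minus powr_powr flip: powr_numeral)
    then show ?thesis
      using frac_weight_scale(1)[OF D, of s "\<lambda>t. 1 - exp (- t)"] by (simp add: frac_const_def)
  qed simp
qed

text \<open>The counterpart of \<open>in_Hs\<close> on \<open>L12\<close>, written with the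
  pointwise Fourier integral in place of an L2 limit.\<close>

definition sobolev :: "real \<Rightarrow> ('a::euclidean_space \<Rightarrow> real) \<Rightarrow> bool" where
  "sobolev s u \<longleftrightarrow> L12 u \<and> integrable lborel (\<lambda>\<xi>. norm \<xi> powr (2 * s) * (cmod (fourier u \<xi>))\<^sup>2)"

lemma sobolev_L12: "sobolev s u \<Longrightarrow> L12 u"
  by (simp add: sobolev_def)

lemma heat_energy_fourier:
  fixes u v :: "'a::euclidean_space \<Rightarrow> real"
  assumes t: "t > 0" and u: "L12 u" and v: "L12 v"
  shows "integrable lborel (\<lambda>\<xi>. (1 - exp (- t * (norm \<xi>)\<^sup>2)) * Re (fourier u \<xi> * cnj (fourier v \<xi>)))"
    and "(LINT \<xi>|lborel. (1 - exp (- t * (norm \<xi>)\<^sup>2)) * Re (fourier u \<xi> * cnj (fourier v \<xi>))) = (2 * pi) ^ DIM('a) * heat_energy t u v"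
proof -
  note p = plancherel[OF u v] and h = heat_plancherel[OF t L12D(1)[OF u] L12D(1)[OF v]]
  have e: "(1 - exp (- t * (norm \<xi>)\<^sup>2)) * Re (fourier u \<xi> * cnj (fourier v \<xi>)) = Re (fourier u \<xi> * cnj (fourier v \<xi>)) - exp (- t * (norm \<xi>)\<^sup>2) * Re (fourier u \<xi> * cnj (fourier v \<xi>))" for \<xi>
    by (simp only: left_diff_distrib mult_1)
  show "integrable lborel (\<lambda>\<xi>. (1 - exp (- t * (norm \<xi>)\<^sup>2)) * Re (fourier u \<xi> * cnj (fourier v \<xi>)))"
    unfolding e by (rule Bochner_Integration.integrable_diff[OF p(1) h(1)])
  show "(LINT \<xi>|lborel. (1 - exp (- t * (norm \<xi>)\<^sup>2)) * Re (fourier u \<xi> * cnj (fourier v \<xi>))) = (2 * pi) ^ DIM('a) * heat_energy t u v"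
    unfolding e Bochner_Integration.integral_diff[OF p(1) h(1)] p(2) h(2) heat_energy_def by (simp only: right_diff_distrib)
qed

text \<open>All integrands are nonnegative, so time and frequency may be exchanged and the time
  integral is the symbol. Products with cutoffs are shown to have finite energy in this way, through
  estimates in space only.\<close>

lemma sobolevI_heat_energy:
  fixes u :: "'a::euclidean_space \<Rightarrow> real"
  assumes s: "0 < s" "s < 1" and u: "L12 u" and I: "integrable lborel (\<lambda>t. frac_weight s t * heat_energy t u u)"
  shows "sobolev s u"
proof -
  have [measurable]: "fourier u \<in> borel_measurable borel" using L12D(1)[OF u] by (rule fourier_measurable)
  let ?f = "\<lambda>(t::real) (\<xi>::'a). frac_weight s t * ((1 - exp (- t * (norm \<xi>)\<^sup>2)) * Re (fourier u \<xi> * cnj (fourier u \<xi>)))"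
  have nn: "?f t \<xi> \<ge> 0" for t \<xi>
  proof (cases "t > 0")
    case True
    then show ?thesis using one_minus_exp_bounds(1)[of "t * (norm \<xi>)\<^sup>2"] frac_weight_nonneg[of s t] by (intro mult_nonneg_nonneg) auto
  qed (simp add: frac_weight_def)
  have i: "integrable lborel (?f t)" for t
    using heat_energy_fourier(1)[of t, OF _ u u] by (cases "t > 0") (auto simp: frac_weight_def)
  have l: "(LINT \<xi>|lborel. ?f t \<xi>) = (2 * pi) ^ DIM('a) * (frac_weight s t * heat_energy t u u)" for t
    using heat_energy_fourier(2)[of t, OF _ u u] by (cases "t > 0") (simp_all add: frac_weight_def)
  have F: "integrable (lborel \<Otimes>\<^sub>M lborel) (\<lambda>(t, \<xi>). ?f t \<xi>)"
  proof (rule lborel_pair.Fubini_integrable)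
    show "integrable lborel (\<lambda>t. LINT \<xi>|lborel. norm (case (t, \<xi>) of (t, \<xi>) \<Rightarrow> ?f t \<xi>))"
      using integrable_mult_right[OF I, of "(2 * pi) ^ DIM('a)"]
      unfolding prod.case real_norm_def abs_of_nonneg[OF nn] l .
  qed (use i in auto)
  from lborel_pair.integrable_snd[OF F]
  have "integrable lborel (\<lambda>\<xi>. LINT t|lborel. (frac_weight s t * (1 - exp (- t * (norm \<xi>)\<^sup>2))) * Re (fourier u \<xi> * cnj (fourier u \<xi>)))"
    by (simp only: mult.assoc)
  then have "integrable lborel (\<lambda>\<xi>. (frac_const s * norm \<xi> powr (2 * s)) * Re (fourier u \<xi> * cnj (fourier u \<xi>)))"
    by (simp only: integral_mult_left_zero frac_symbol[OF s])
  moreover have "Re (z * cnj z) = (cmod z)\<^sup>2" for z by (simp add: complex_mult_cnj cmod_power2)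
  ultimately have "integrable lborel (\<lambda>\<xi>. (frac_const s * norm \<xi> powr (2 * s)) * (cmod (fourier u \<xi>))\<^sup>2)"
    by (simp only:)
  from integrable_mult_right[OF this, of "1 / frac_const s"] show ?thesis
    using frac_const_pos[OF s] u by (simp add: sobolev_def)
qed

text \<open>Here the integrand may change sign. The time integral of its absolute value is
  \<open>frac_const s\<close> times the absolute value of the weighted product of transforms, which
  is integrable for functions of finite energy, so Fubini applies.\<close>

lemma frac_form_heat:
  fixes u v :: "'a::euclidean_space \<Rightarrow> real"
  assumes s: "0 < s" "s < 1" and u: "sobolev s u" and v: "sobolev s v"
  shows "integrable lborel (\<lambda>t. frac_weight s t * heat_energy t u v)"
    and "(LINT t|lborel. frac_weight s t * heat_energy t u v)
      = frac_const s * (LINT \<xi>|lborel. norm \<xi> powr (2 * s) * Re (fourier u \<xi> * cnj (fourier v \<xi>))) / (2 * pi) ^ DIM('a)"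
proof -
  note U = sobolev_L12[OF u] and V = sobolev_L12[OF v]
  have [measurable]: "fourier u \<in> borel_measurable borel" "fourier v \<in> borel_measurable borel"
    using U V by (auto intro: fourier_measurable dest: L12D)
  define R where "R \<xi> = Re (fourier u \<xi> * cnj (fourier v \<xi>))" for \<xi>
  have [measurable]: "R \<in> borel_measurable borel" unfolding R_def by measurable
  let ?f = "\<lambda>(\<xi>::'a) (t::real). R \<xi> * (frac_weight s t * (1 - exp (- t * (norm \<xi>)\<^sup>2)))"
  have nn: "frac_weight s t * (1 - exp (- t * (norm \<xi>)\<^sup>2)) \<ge> 0" for t and \<xi> :: 'a
  proof (cases "t > 0")
    case True
    then show ?thesis using one_minus_exp_bounds(1)[of "t * (norm \<xi>)\<^sup>2"] frac_weight_nonneg[of s t] by (intro mult_nonneg_nonneg) auto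
  qed (simp add: frac_weight_def)
  have i: "integrable lborel (?f \<xi>)" for \<xi> using frac_symbol(1)[OF s] by (intro integrable_mult_right) auto
  have IR: "integrable lborel (\<lambda>\<xi>. norm \<xi> powr (2 * s) * R \<xi>)"
    unfolding R_def using u v by (intro integrable_fourier_mult) (auto simp: sobolev_def dest: L12D)
  have F: "integrable (lborel \<Otimes>\<^sub>M lborel) (\<lambda>(\<xi>, t). ?f \<xi> t)"
  proof (rule lborel_pair.Fubini_integrable)
    have "integrable lborel (\<lambda>\<xi>. frac_const s * norm (norm \<xi> powr (2 * s) * R \<xi>))"
      using IR by (intro integrable_mult_right integrable_norm)
    moreover have "(LINT t|lborel. norm (?f \<xi> t)) = frac_const s * norm (norm \<xi> powr (2 * s) * R \<xi>)" for \<xi>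
    proof -
      have "norm (?f \<xi> t) = \<bar>R \<xi>\<bar> * (frac_weight s t * (1 - exp (- t * (norm \<xi>)\<^sup>2)))" for t
        using nn[of t \<xi>] by (metis abs_mult abs_of_nonneg real_norm_def)
      then show ?thesis
        by (simp only: integral_mult_right_zero frac_symbol(2)[OF s]) (simp add: abs_mult)
    qed
    ultimately show "integrable lborel (\<lambda>\<xi>. LINT t|lborel. norm (case (\<xi>, t) of (\<xi>, t) \<Rightarrow> ?f \<xi> t))" by simp
  qed (use i in auto)
  have l: "(LINT \<xi>|lborel. ?f \<xi> t) = (2 * pi) ^ DIM('a) * (frac_weight s t * heat_energy t u v)" for t
  proof (cases "t > 0")
    case True
    have "(LINT \<xi>|lborel. ?f \<xi> t) = (LINT \<xi>|lborel. frac_weight s t * ((1 - exp (- t * (norm \<xi>)\<^sup>2)) * R \<xi>))"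
      by (simp add: mult_ac)
    also have "\<dots> = frac_weight s t * ((2 * pi) ^ DIM('a) * heat_energy t u v)"
      unfolding integral_mult_right_zero R_def heat_energy_fourier(2)[OF True U V] by simp
    finally show ?thesis by simp
  qed (simp add: frac_weight_def)
  have "integrable lborel (\<lambda>t. (2 * pi) ^ DIM('a) * (frac_weight s t * heat_energy t u v))"
    using lborel_pair.integrable_snd[OF F] unfolding l .
  from integrable_mult_right[OF this, of "1 / (2 * pi) ^ DIM('a)"]
  show "integrable lborel (\<lambda>t. frac_weight s t * heat_energy t u v)" by simp
  have "(2 * pi) ^ DIM('a) * (LINT t|lborel. frac_weight s t * heat_energy t u v) = (LINT t|lborel. LINT \<xi>|lborel. ?f \<xi> t)"
    unfolding l by simp
  also have "\<dots> = (LINT \<xi>|lborel. LINT t|lborel. ?f \<xi> t)"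
    by (rule lborel_pair.Fubini_integral[OF F])
  also have "\<dots> = (LINT \<xi>|lborel. frac_const s * (norm \<xi> powr (2 * s) * R \<xi>))"
    unfolding integral_mult_right_zero frac_symbol(2)[OF s] by (simp add: mult_ac flip: integral_mult_right_zero)
  finally show "(LINT t|lborel. frac_weight s t * heat_energy t u v)
      = frac_const s * (LINT \<xi>|lborel. norm \<xi> powr (2 * s) * Re (fourier u \<xi> * cnj (fourier v \<xi>))) / (2 * pi) ^ DIM('a)"
    unfolding integral_mult_right_zero R_def by (simp add: field_simps)
qed

section \<open>Comparison with the Plancherel extension\<close>

text \<open>By Plancherel the L2 distance to the transform of a truncation is a constant times the
  L2 norm of the part cut away, which tends to 0.\<close>

lemma is_fourier_L2_fourier:
  fixes u :: "'a::euclidean_space \<Rightarrow> real"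
  assumes u: "L12 u"
  shows "is_fourier_L2 u (fourier u)"
  unfolding is_fourier_L2_def in_L2_def
proof (intro conjI)
  show m: "u \<in> borel_measurable lborel" using L12D[OF u] by simp
  then have [measurable]: "u \<in> borel_measurable borel" by simp
  show "integrable lborel (\<lambda>x. (norm (u x))\<^sup>2)" using L12D[OF u] by simp
  show "fourier u \<in> borel_measurable lborel" using fourier_measurable[OF L12D(1)[OF u]] by simp
  show "integrable lborel (\<lambda>x. (cmod (fourier u x))\<^sup>2)" by (rule plancherel_norm[OF u])
  have [measurable]: "cball (0::'a) R \<in> sets borel" for R by simp
  have uR: "L12 (\<lambda>x. indicator (cball 0 R) x * u x)" for R
    by (rule L12_bounded_mult[OF u, where B=1]) (auto simp: indicator_def)
  have e: "(\<integral>\<^sup>+ \<xi>. ennreal ((cmod (fourier u \<xi> - fourier (\<lambda>x. indicator (cball 0 R) x * u x) \<xi>))\<^sup>2) \<partial>lborel)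
     = ennreal ((2 * pi) ^ DIM('a) * (LINT x|lborel. (u x - indicator (cball 0 R) x * u x)\<^sup>2))" for R
    unfolding fourier_diff[OF L12D(1)[OF u] L12D(1)[OF uR], symmetric] plancherel_norm(2)[OF L12_diff[OF u uR], symmetric]
    by (rule nn_integral_eq_integral[OF plancherel_norm(1)[OF L12_diff[OF u uR]]]) auto
  have "((\<lambda>R. LINT x|lborel. (u x - indicator (cball 0 R) x * u x)\<^sup>2) \<longlongrightarrow> (LINT x|(lborel::'a measure). 0)) at_top"
  proof (rule integral_dominated_convergence_at_top[where w="\<lambda>x. (u x)\<^sup>2"])
    show "AE x in lborel. ((\<lambda>R. (u x - indicator (cball 0 R) x * u x)\<^sup>2) \<longlongrightarrow> 0) at_top"
    proof (rule AE_I2, rule tendsto_eventually)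
      fix x :: 'a
      show "\<forall>\<^sub>F R in at_top. (u x - indicator (cball 0 R) x * u x)\<^sup>2 = 0"
        using eventually_ge_at_top[of "norm x"] by eventually_elim simp
    qed
    show "\<forall>\<^sub>F R in at_top. AE x in lborel. norm ((u x - indicator (cball 0 R) x * u x)\<^sup>2) \<le> (u x)\<^sup>2"
      by (auto simp: indicator_def)
  qed (use L12D[OF u] in auto)
  then have "((\<lambda>R. (2 * pi) ^ DIM('a) * (LINT x|lborel. (u x - indicator (cball 0 R) x * u x)\<^sup>2)) \<longlongrightarrow> (2 * pi) ^ DIM('a) * 0) at_top"
    by (intro tendsto_mult tendsto_const) simp
  from tendsto_ennrealI[OF this]
  show "((\<lambda>R. \<integral>\<^sup>+ \<xi>. ennreal ((cmod (fourier u \<xi> - fourier (\<lambda>x. indicator (cball 0 R) x * u x) \<xi>))\<^sup>2) \<partial>lborel) \<longlongrightarrow> 0) at_top"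
    unfolding e by simp
qed

text \<open>Both candidates are L2 limits of the same truncated transforms. As
  \<open>fourier_L2\<close> is an arbitrary choice among such limits, this is what allows replacing
  it by the Fourier integral under an integral sign.\<close>

lemma is_fourier_L2_unique:
  fixes u :: "'a::euclidean_space \<Rightarrow> real"
  assumes F: "is_fourier_L2 u F" and G: "is_fourier_L2 u G"
  shows "AE \<xi> in lborel. F \<xi> = G \<xi>"
proof -
  have [measurable]: "F \<in> borel_measurable borel" "G \<in> borel_measurable borel" "u \<in> borel_measurable borel"
    and u2: "integrable lborel (\<lambda>x. (u x)\<^sup>2)"
    using F G by (auto simp: is_fourier_L2_def in_L2_def)
  have [measurable]: "cball (0::'a) R \<in> sets borel" for R by simp
  define T where "T R = fourier (\<lambda>x. indicator (cball 0 R) x * u x)" for R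
  have "integrable lborel (\<lambda>x. indicator (cball 0 R) x * u x)" for R
  proof (rule Bochner_Integration.integrable_bound)
    show "integrable lborel (\<lambda>x::'a. 1 * indicator (cball 0 R) x + (u x)\<^sup>2)"
      using u2 integrable_indicator_cball[of 1 R] by (intro Bochner_Integration.integrable_add)
    have "\<bar>a\<bar> \<le> 1 + a\<^sup>2" for a :: real
      using sum_squares_bound[of 1 "\<bar>a\<bar>"] by (simp add: abs_if split: if_splits)
    then show "AE x in lborel. norm (indicator (cball 0 R) x * u x) \<le> norm (1 * indicator (cball 0 R) x + (u x)\<^sup>2)"
      by (auto simp: indicator_def)
  qed measurable
  then have [measurable]: "T R \<in> borel_measurable borel" for R unfolding T_def by (rule fourier_measurable)
  let ?d = "\<lambda>F R. \<integral>\<^sup>+ \<xi>. ennreal ((cmod (F \<xi> - T R \<xi>))\<^sup>2) \<partial>lborel"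
  have b: "(\<integral>\<^sup>+ \<xi>. ennreal ((cmod (F \<xi> - G \<xi>))\<^sup>2) \<partial>lborel) \<le> 2 * ?d F R + 2 * ?d G R" for R
  proof -
    have "(\<integral>\<^sup>+ \<xi>. ennreal ((cmod (F \<xi> - G \<xi>))\<^sup>2) \<partial>lborel) \<le> (\<integral>\<^sup>+ \<xi>. 2 * ennreal ((cmod (F \<xi> - T R \<xi>))\<^sup>2) + 2 * ennreal ((cmod (G \<xi> - T R \<xi>))\<^sup>2) \<partial>lborel)"
    proof (rule nn_integral_mono)
      fix \<xi> :: 'a
      have "cmod (F \<xi> - G \<xi>) \<le> cmod (F \<xi> - T R \<xi>) + cmod (G \<xi> - T R \<xi>)"
        using norm_triangle_ineq4[of "F \<xi> - T R \<xi>" "G \<xi> - T R \<xi>"] by simp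
      then have "(cmod (F \<xi> - G \<xi>))\<^sup>2 \<le> (cmod (F \<xi> - T R \<xi>) + cmod (G \<xi> - T R \<xi>))\<^sup>2" by (intro power_mono) auto
      also have "\<dots> \<le> 2 * (cmod (F \<xi> - T R \<xi>))\<^sup>2 + 2 * (cmod (G \<xi> - T R \<xi>))\<^sup>2"
        using sum_squares_bound[of "cmod (F \<xi> - T R \<xi>)" "cmod (G \<xi> - T R \<xi>)"] by (simp add: power2_sum)
      finally have "ennreal ((cmod (F \<xi> - G \<xi>))\<^sup>2) \<le> ennreal (2 * (cmod (F \<xi> - T R \<xi>))\<^sup>2 + 2 * (cmod (G \<xi> - T R \<xi>))\<^sup>2)"
        by (rule ennreal_leI)
      then show "ennreal ((cmod (F \<xi> - G \<xi>))\<^sup>2) \<le> 2 * ennreal ((cmod (F \<xi> - T R \<xi>))\<^sup>2) + 2 * ennreal ((cmod (G \<xi> - T R \<xi>))\<^sup>2)"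
        by (simp add: ennreal_plus ennreal_mult)
    qed
    also have "\<dots> = 2 * ?d F R + 2 * ?d G R" by (simp add: nn_integral_add nn_integral_cmult)
    finally show ?thesis .
  qed
  have "(?d F \<longlongrightarrow> 0) at_top" "(?d G \<longlongrightarrow> 0) at_top" using F G by (auto simp: is_fourier_L2_def T_def)
  then have "((\<lambda>R. 2 * ?d F R + 2 * ?d G R) \<longlongrightarrow> 2 * 0 + 2 * 0) at_top"
    by (intro tendsto_add tendsto_mult_ennreal tendsto_const) auto
  then have "(\<integral>\<^sup>+ \<xi>. ennreal ((cmod (F \<xi> - G \<xi>))\<^sup>2) \<partial>lborel) \<le> 2 * 0 + 2 * 0"
    by (rule tendsto_lowerbound) (auto simp: b)
  then have "AE \<xi> in lborel. ennreal ((cmod (F \<xi> - G \<xi>))\<^sup>2) = 0"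
    by (subst nn_integral_0_iff_AE[symmetric]) auto
  then show ?thesis by eventually_elim simp
qed

lemma fourier_L2_eq:
  assumes "L12 u"
  shows "AE \<xi> in lborel. fourier_L2 u \<xi> = fourier u \<xi>" "fourier_L2 u \<in> borel_measurable borel"
proof -
  have "is_fourier_L2 u (fourier_L2 u)" unfolding fourier_L2_def by (rule someI[where P="is_fourier_L2 u", OF is_fourier_L2_fourier[OF assms]])
  then show "AE \<xi> in lborel. fourier_L2 u \<xi> = fourier u \<xi>" "fourier_L2 u \<in> borel_measurable borel"
    using is_fourier_L2_unique[OF _ is_fourier_L2_fourier[OF assms]] by (auto simp: is_fourier_L2_def in_L2_def)
qed

lemma in_Hs_iff_sobolev:
  assumes u: "L12 u"
  shows "in_Hs s u \<longleftrightarrow> sobolev s u"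
proof
  assume "in_Hs s u"
  then obtain F where F: "is_fourier_L2 u F" and I: "integrable lborel (\<lambda>\<xi>. norm \<xi> powr (2 * s) * (cmod (F \<xi>))\<^sup>2)"
    by (auto simp: in_Hs_def)
  have [measurable]: "F \<in> borel_measurable borel" "fourier u \<in> borel_measurable borel"
    using F L12D(1)[OF u] by (auto simp: is_fourier_L2_def in_L2_def intro: fourier_measurable)
  have "integrable lborel (\<lambda>\<xi>. norm \<xi> powr (2 * s) * (cmod (fourier u \<xi>))\<^sup>2)"
  proof (rule integrable_cong_AE_imp[OF I])
    show "AE \<xi> in lborel. norm \<xi> powr (2 * s) * (cmod (F \<xi>))\<^sup>2 = norm \<xi> powr (2 * s) * (cmod (fourier u \<xi>))\<^sup>2"
      using is_fourier_L2_unique[OF F is_fourier_L2_fourier[OF u]] by eventually_elim simp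
  qed measurable
  then show "sobolev s u" using u by (simp add: sobolev_def)
next
  assume "sobolev s u"
  then show "in_Hs s u" using is_fourier_L2_fourier[OF u] by (auto simp: sobolev_def in_Hs_def)
qed

lemma in_Hs_L2:
  assumes "in_Hs s u" shows "u \<in> borel_measurable borel" "integrable lborel (\<lambda>x. (u x)\<^sup>2)"
  using assms by (auto simp: in_Hs_def is_fourier_L2_def in_L2_def)

lemma frac_form_eq:
  fixes u v :: "'a::euclidean_space \<Rightarrow> real"
  assumes u: "L12 u" and v: "L12 v"
  shows "frac_form s u v = (LINT \<xi>|lborel. norm \<xi> powr (2 * s) * Re (fourier u \<xi> * cnj (fourier v \<xi>))) / (2 * pi) ^ DIM('a)"
proof -
  have [measurable]: "fourier u \<in> borel_measurable borel" "fourier v \<in> borel_measurable borel"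
    using u v by (auto intro: fourier_measurable dest: L12D)
  note [measurable] = fourier_L2_eq(2)[OF u] fourier_L2_eq(2)[OF v]
  have "(LINT \<xi>|lborel. norm \<xi> powr (2 * s) * Re (fourier_L2 u \<xi> * cnj (fourier_L2 v \<xi>))) = (LINT \<xi>|lborel. norm \<xi> powr (2 * s) * Re (fourier u \<xi> * cnj (fourier v \<xi>)))"
  proof (rule integral_cong_AE)
    show "AE \<xi> in lborel. norm \<xi> powr (2 * s) * Re (fourier_L2 u \<xi> * cnj (fourier_L2 v \<xi>)) = norm \<xi> powr (2 * s) * Re (fourier u \<xi> * cnj (fourier v \<xi>))"
      using fourier_L2_eq(1)[OF u] fourier_L2_eq(1)[OF v] by eventually_elim simp
  qed measurable
  then show ?thesis by (simp add: frac_form_def)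
qed

subsection \<open>The Sobolev inner product\<close>

text \<open>The product called \<open>a\<close> in the overview. The division by the inversion
  constant makes it the sum of \<open>frac_form\<close> and the L2 product, see
  \<open>hs_inner_eq_frac_form\<close>.\<close>

definition hs_inner :: "real \<Rightarrow> ('a::euclidean_space \<Rightarrow> real) \<Rightarrow> ('a \<Rightarrow> real) \<Rightarrow> real" where
  "hs_inner s u v = (LINT \<xi>|lborel. (1 + norm \<xi> powr (2 * s)) * Re (fourier u \<xi> * cnj (fourier v \<xi>))) / (2 * pi) ^ DIM('a)"

lemma Re_mult_cnj: "Re (z * cnj z) = (cmod z)\<^sup>2"
  by (simp add: complex_mult_cnj cmod_power2)

lemma sobolev_weighted:
  assumes u: "L12 u"
  shows "sobolev s u \<longleftrightarrow> integrable lborel (\<lambda>\<xi>. (1 + norm \<xi> powr (2 * s)) * (cmod (fourier u \<xi>))\<^sup>2)" (is "_ = ?I")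
proof
  assume "sobolev s u" then show ?I using plancherel_norm(1)[OF u] by (simp add: sobolev_def distrib_right)
next
  assume ?I
  from Bochner_Integration.integrable_diff[OF this plancherel_norm(1)[OF u]]
  show "sobolev s u" using u by (simp add: sobolev_def distrib_right)
qed

lemma hs_integrable:
  assumes "sobolev s u" "sobolev s v"
  shows "integrable lborel (\<lambda>\<xi>. (1 + norm \<xi> powr (2 * s)) * Re (fourier u \<xi> * cnj (fourier v \<xi>)))"
  using assms sobolev_weighted[of u s] sobolev_weighted[of v s]
  by (intro integrable_fourier_mult) (auto dest: sobolev_L12 L12D)

lemma sobolev_cmult: "sobolev s u \<Longrightarrow> sobolev s (\<lambda>x. c * u x)"
  by (auto simp: sobolev_def L12_cmult fourier_cmult norm_mult power_mult_distrib mult.left_commute)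

lemma sobolev_add:
  fixes u v :: "'a::euclidean_space \<Rightarrow> real"
  assumes u: "sobolev s u" and v: "sobolev s v"
  shows "sobolev s (\<lambda>x. u x + v x)"
proof -
  note U = sobolev_L12[OF u] and V = sobolev_L12[OF v]
  have [measurable]: "fourier u \<in> borel_measurable borel" "fourier v \<in> borel_measurable borel"
    using U V by (auto intro: fourier_measurable dest: L12D)
  have "integrable lborel (\<lambda>\<xi>. norm \<xi> powr (2 * s) * (cmod (fourier u \<xi> + fourier v \<xi>))\<^sup>2)"
  proof (rule Bochner_Integration.integrable_bound)
    show "integrable lborel (\<lambda>\<xi>. 2 * (norm \<xi> powr (2 * s) * (cmod (fourier u \<xi>))\<^sup>2) + 2 * (norm \<xi> powr (2 * s) * (cmod (fourier v \<xi>))\<^sup>2))"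
      using u v by (auto simp: sobolev_def)
    have "(cmod (a + b))\<^sup>2 \<le> 2 * (cmod a)\<^sup>2 + 2 * (cmod b)\<^sup>2" for a b
    proof -
      have "(cmod (a + b))\<^sup>2 \<le> (cmod a + cmod b)\<^sup>2" by (intro power_mono norm_triangle_ineq) auto
      also have "\<dots> \<le> 2 * (cmod a)\<^sup>2 + 2 * (cmod b)\<^sup>2"
        using sum_squares_bound[of "cmod a" "cmod b"] by (simp add: power2_sum)
      finally show ?thesis .
    qed
    then have "norm \<xi> powr (2 * s) * (cmod (fourier u \<xi> + fourier v \<xi>))\<^sup>2 \<le> norm \<xi> powr (2 * s) * (2 * (cmod (fourier u \<xi>))\<^sup>2 + 2 * (cmod (fourier v \<xi>))\<^sup>2)" for \<xi> :: 'a
      by (intro mult_left_mono) auto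
    then show "AE \<xi> in lborel. norm (norm \<xi> powr (2 * s) * (cmod (fourier u \<xi> + fourier v \<xi>))\<^sup>2)
        \<le> norm (2 * (norm \<xi> powr (2 * s) * (cmod (fourier u \<xi>))\<^sup>2) + 2 * (norm \<xi> powr (2 * s) * (cmod (fourier v \<xi>))\<^sup>2))"
      by (simp add: algebra_simps)
  qed measurable
  then show ?thesis using L12_add[OF U V] by (simp add: sobolev_def fourier_add[OF L12D(1)[OF U] L12D(1)[OF V]])
qed

lemma sobolev_diff: "sobolev s u \<Longrightarrow> sobolev s v \<Longrightarrow> sobolev s (\<lambda>x. u x - v x)"
  using sobolev_add[of s u "\<lambda>x. - 1 * v x"] sobolev_cmult[of s v "-1"] by simp

lemma hs_commute: "hs_inner s u v = hs_inner s v u"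
  unfolding hs_inner_def by (simp add: mult.commute)

lemma hs_add_left:
  assumes "sobolev s u" "sobolev s v" "sobolev s w"
  shows "hs_inner s (\<lambda>x. u x + v x) w = hs_inner s u w + hs_inner s v w"
proof -
  have "(1 + norm \<xi> powr (2 * s)) * Re (fourier (\<lambda>x. u x + v x) \<xi> * cnj (fourier w \<xi>))
     = (1 + norm \<xi> powr (2 * s)) * Re (fourier u \<xi> * cnj (fourier w \<xi>)) + (1 + norm \<xi> powr (2 * s)) * Re (fourier v \<xi> * cnj (fourier w \<xi>))" for \<xi>
    using assms by (subst fourier_add) (auto dest: sobolev_L12 L12D simp: algebra_simps)
  then show ?thesis unfolding hs_inner_def
    by (simp only: Bochner_Integration.integral_add[OF hs_integrable[OF assms(1,3)] hs_integrable[OF assms(2,3)]] add_divide_distrib)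
qed

lemma hs_cmult_left: "hs_inner s (\<lambda>x. c * u x) v = c * hs_inner s u v"
proof -
  have "(1 + norm \<xi> powr (2 * s)) * Re (fourier (\<lambda>x. c * u x) \<xi> * cnj (fourier v \<xi>))
     = c * ((1 + norm \<xi> powr (2 * s)) * Re (fourier u \<xi> * cnj (fourier v \<xi>)))" for \<xi>
    unfolding fourier_cmult by (simp add: algebra_simps)
  then show ?thesis unfolding hs_inner_def by (simp only: integral_mult_right_zero times_divide_eq_right)
qed

lemma hs_diff_left:
  assumes "sobolev s u" "sobolev s v" "sobolev s w"
  shows "hs_inner s (\<lambda>x. u x - v x) w = hs_inner s u w - hs_inner s v w"
  using hs_add_left[OF assms(1) sobolev_cmult[OF assms(2), of "-1"] assms(3)] hs_cmult_left[of s "-1" v w] by simp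

lemma hs_diff_right:
  assumes "sobolev s u" "sobolev s v" "sobolev s w"
  shows "hs_inner s w (\<lambda>x. u x - v x) = hs_inner s w u - hs_inner s w v"
  using hs_diff_left[OF assms] by (simp add: hs_commute)

lemma hs_inner_eq_frac_form:
  assumes u: "sobolev s u" and v: "sobolev s v"
  shows "hs_inner s u v = frac_form s u v + (LINT x|lborel. u x * v x)"
proof -
  note U = sobolev_L12[OF u] and V = sobolev_L12[OF v]
  note p = plancherel[OF U V]
  have I: "integrable lborel (\<lambda>\<xi>. norm \<xi> powr (2 * s) * Re (fourier u \<xi> * cnj (fourier v \<xi>)))"
    using u v L12D[OF U] L12D[OF V] by (intro integrable_fourier_mult) (auto simp: sobolev_def)
  show ?thesis
    unfolding hs_inner_def frac_form_eq[OF U V]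
    by (simp only: distrib_right mult_1 Bochner_Integration.integral_add[OF p(1) I] p(2)) (simp add: field_simps)
qed

text \<open>The fractional part of the energy is nonnegative. Consequently Cauchy sequences for the
  energy are Cauchy in L2 at the same rate.\<close>

lemma hs_ge_L2:
  assumes u: "sobolev s u"
  shows "(LINT x|lborel. (u x)\<^sup>2) \<le> hs_inner s u u"
proof -
  have "0 \<le> frac_form s u u"
    unfolding frac_form_eq[OF sobolev_L12[OF u] sobolev_L12[OF u]] Re_mult_cnj
    by (intro divide_nonneg_nonneg integral_nonneg_AE) auto
  then show ?thesis unfolding hs_inner_eq_frac_form[OF u u] by (simp add: power2_eq_square)
qed

lemma hs_nonneg: "sobolev s u \<Longrightarrow> 0 \<le> hs_inner s u u"
  using hs_ge_L2[of s u] by (rule order_trans[rotated]) (auto intro: integral_nonneg_AE)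

lemma hs_square_expand:
  assumes u: "sobolev s u" and v: "sobolev s v"
  shows "hs_inner s (\<lambda>x. u x - c * v x) (\<lambda>x. u x - c * v x) = hs_inner s u u - 2 * c * hs_inner s u v + c\<^sup>2 * hs_inner s v v"
proof -
  note cv = sobolev_cmult[OF v, of c]
  note d = sobolev_diff[OF u cv]
  show ?thesis
    unfolding hs_diff_left[OF u cv d] hs_diff_right[OF u cv u] hs_diff_right[OF u cv cv]
    unfolding hs_cmult_left hs_commute[of s _ "\<lambda>x. c * v x"] hs_commute[of s v u]
    by (simp add: power2_eq_square algebra_simps)
qed

text \<open>The discriminant of a nonnegative quadratic polynomial, with the degenerate case. It
  serves for Cauchy-Schwarz in the energy, in L2 and for averages against \<Gamma>, and for the
  approximate orthogonality of a minimizing sequence.\<close>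

lemma quadratic_bound:
  fixes a b c :: real
  assumes "\<And>t. 0 \<le> a - 2 * t * b + t\<^sup>2 * c" and c: "c \<ge> 0"
  shows "b\<^sup>2 \<le> a * c"
proof (cases "c = 0")
  case True
  have "b = 0"
  proof (rule ccontr)
    assume "b \<noteq> 0"
    \<comment> \<open>This value of \<open>t\<close> makes the affine function
      \<open>a - 2 * t * b\<close> equal to -1.\<close>
    then show False using assms(1)[of "(a + 1) / (2 * b)"] True by simp
  qed
  then show ?thesis using True by simp
next
  case False
  then have "0 \<le> (a - 2 * (b / c) * b + (b / c)\<^sup>2 * c) * c" using assms(1)[of "b / c"] c by simp
  also have "\<dots> = a * c - b\<^sup>2" using False by (simp add: power2_eq_square field_simps)
  finally show ?thesis by simp
qed

lemma hs_cauchy_schwarz: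
  assumes u: "sobolev s u" and v: "sobolev s v"
  shows "(hs_inner s u v)\<^sup>2 \<le> hs_inner s u u * hs_inner s v v"
proof (rule quadratic_bound)
  show "0 \<le> hs_inner s u u - 2 * t * hs_inner s u v + t\<^sup>2 * hs_inner s v v" for t
    unfolding hs_square_expand[OF u v, symmetric] by (intro hs_nonneg sobolev_diff u sobolev_cmult v)
qed (rule hs_nonneg[OF v])

lemma hs_tendsto:
  assumes g: "\<And>k. sobolev s (g k)" and h: "sobolev s h" and v: "sobolev s v"
    and lim: "(\<lambda>k. hs_inner s (\<lambda>x. g k x - h x) (\<lambda>x. g k x - h x)) \<longlonglongrightarrow> 0"
  shows "(\<lambda>k. hs_inner s (g k) v) \<longlonglongrightarrow> hs_inner s h v"
proof -
  have "(\<lambda>k. sqrt (hs_inner s (\<lambda>x. g k x - h x) (\<lambda>x. g k x - h x) * hs_inner s v v)) \<longlonglongrightarrow> sqrt (0 * hs_inner s v v)"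
    by (intro tendsto_intros lim)
  then have l: "(\<lambda>k. sqrt (hs_inner s (\<lambda>x. g k x - h x) (\<lambda>x. g k x - h x) * hs_inner s v v)) \<longlonglongrightarrow> 0" by simp
  have "(\<lambda>k. hs_inner s (g k) v - hs_inner s h v) \<longlonglongrightarrow> 0"
  proof (rule Lim_null_comparison[OF always_eventually l], rule allI)
    fix k
    show "norm (hs_inner s (g k) v - hs_inner s h v) \<le> sqrt (hs_inner s (\<lambda>x. g k x - h x) (\<lambda>x. g k x - h x) * hs_inner s v v)"
      unfolding real_norm_def hs_diff_left[OF g h v, symmetric]
      by (rule real_le_rsqrt) (use hs_cauchy_schwarz[OF sobolev_diff[OF g h] v] in simp)
  qed
  from tendsto_add[OF this tendsto_const[of "hs_inner s h v"]] show ?thesis by simp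
qed

lemma hs_cong_AE:
  assumes "u \<in> borel_measurable borel" "u' \<in> borel_measurable borel" "AE x in lborel. u x = u' x"
  shows "hs_inner s u v = hs_inner s u' v"
  unfolding hs_inner_def fourier_cong_AE[OF assms] ..

section \<open>Limits in L2 and in the energy space\<close>

text \<open>The rate 1/4 leaves room for a factor 2^k: the series of 2^k \<open>f k\<close> has
  finite integral, hence a finite sum almost everywhere, and this sum bounds each of its terms. So
  the whole sequence converges almost everywhere, without passing to a subsequence.\<close>

lemma AE_geometric_bound:
  fixes f :: "nat \<Rightarrow> 'b \<Rightarrow> real"
  assumes I: "\<And>k. integrable M (f k)" and nn: "\<And>k x. f k x \<ge> 0" and b: "\<And>k. (LINT x|M. f k x) \<le> C * (1/4) ^ k"
  shows "AE x in M. \<exists>B. \<forall>k. f k x \<le> B * (1/2) ^ k"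
proof -
  note [measurable] = borel_measurable_integrable[OF I]
  have "(\<integral>\<^sup>+ x. (\<Sum>k. ennreal (2 ^ k * f k x)) \<partial>M) = (\<Sum>k. \<integral>\<^sup>+ x. ennreal (2 ^ k * f k x) \<partial>M)"
    by (rule nn_integral_suminf) measurable
  also have "\<dots> \<le> (\<Sum>k. ennreal (\<bar>C\<bar> * (1/2) ^ k))"
  proof (intro suminf_le summableI)
    fix k
    have "(\<integral>\<^sup>+ x. ennreal (2 ^ k * f k x) \<partial>M) = ennreal (LINT x|M. 2 ^ k * f k x)"
      using I nn by (intro nn_integral_eq_integral) auto
    also have "(LINT x|M. 2 ^ k * f k x) \<le> 2 ^ k * (\<bar>C\<bar> * (1/4) ^ k)"
      using order_trans[OF b mult_right_mono[OF abs_ge_self]] by simp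
    also have "\<dots> = \<bar>C\<bar> * (2 * (1/4)) ^ k" unfolding power_mult_distrib by simp
    finally show "(\<integral>\<^sup>+ x. ennreal (2 ^ k * f k x) \<partial>M) \<le> ennreal (\<bar>C\<bar> * (1/2) ^ k)" by (simp add: ennreal_leI)
  qed
  also have "\<dots> = ennreal (\<Sum>k. \<bar>C\<bar> * (1/2) ^ k)"
    by (rule suminf_ennreal2) (auto intro!: summable_mult summable_geometric)
  also have "\<dots> < \<infinity>" by simp
  finally have "AE x in M. (\<Sum>k. ennreal (2 ^ k * f k x)) \<noteq> \<infinity>"
    by (intro nn_integral_noteq_infinite) auto
  then show ?thesis
  proof eventually_elim
    fix x assume "(\<Sum>k. ennreal (2 ^ k * f k x)) \<noteq> \<infinity>"
    then obtain B where B: "B \<ge> 0" "(\<Sum>k. ennreal (2 ^ k * f k x)) = ennreal B"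
      by (cases "\<Sum>k. ennreal (2 ^ k * f k x)") auto
    have "f k x \<le> B * (1/2) ^ k" for k
    proof -
      have "ennreal (2 ^ k * f k x) \<le> ennreal B"
        unfolding B(2)[symmetric] using sum_le_suminf[OF summableI, of "{k}" "\<lambda>k. ennreal (2 ^ k * f k x)"] by simp
      then have "2 ^ k * f k x \<le> B" using B(1) by simp
      then show ?thesis by (simp add: power_divide field_simps)
    qed
    then show "\<exists>B. \<forall>k. f k x \<le> B * (1/2) ^ k" by blast
  qed
qed

text \<open>Fatou's lemma, with the bound asked only from \<open>N\<close> on: in its applications
  the bound for the distance from the k-th to the l-th member of a sequence holds for l >=
  k.\<close>

lemma fatou_bound:
  fixes f :: "nat \<Rightarrow> 'b \<Rightarrow> real"
  assumes I: "\<And>k. integrable M (f k)" and nn: "\<And>k x. f k x \<ge> 0"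
    and b: "\<And>k. k \<ge> N \<Longrightarrow> (LINT x|M. f k x) \<le> B" and lim: "AE x in M. (\<lambda>k. f k x) \<longlonglongrightarrow> F x"
    and [measurable]: "F \<in> borel_measurable M"
  shows "integrable M F" "(LINT x|M. F x) \<le> B"
proof -
  note [measurable] = borel_measurable_integrable[OF I]
  have B: "B \<ge> 0" using order_trans[OF integral_nonneg_AE b[of N]] nn by auto
  have Fnn: "AE x in M. F x \<ge> 0"
    using lim by eventually_elim (use nn in \<open>auto intro: LIMSEQ_le_const\<close>)
  have "(\<integral>\<^sup>+ x. ennreal (F x) \<partial>M) = (\<integral>\<^sup>+ x. liminf (\<lambda>k. ennreal (f (k + N) x)) \<partial>M)"
  proof (rule nn_integral_cong_AE)
    show "AE x in M. ennreal (F x) = liminf (\<lambda>k. ennreal (f (k + N) x))"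
      using lim
    proof eventually_elim
      fix x assume "(\<lambda>k. f k x) \<longlonglongrightarrow> F x"
      then have "(\<lambda>k. ennreal (f (k + N) x)) \<longlonglongrightarrow> ennreal (F x)"
        by (intro tendsto_ennrealI LIMSEQ_ignore_initial_segment)
      then show "ennreal (F x) = liminf (\<lambda>k. ennreal (f (k + N) x))" by (simp add: lim_imp_Liminf)
    qed
  qed
  also have "\<dots> \<le> liminf (\<lambda>k. \<integral>\<^sup>+ x. ennreal (f (k + N) x) \<partial>M)" by (rule nn_integral_liminf) measurable
  also have "\<dots> \<le> ennreal B"
  proof (rule Liminf_le)
    show "\<forall>\<^sub>F k in sequentially. (\<integral>\<^sup>+ x. ennreal (f (k + N) x) \<partial>M) \<le> ennreal B"
    proof (rule always_eventually, rule allI)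
      fix k
      have "(\<integral>\<^sup>+ x. ennreal (f (k + N) x) \<partial>M) = ennreal (LINT x|M. f (k + N) x)"
        using I nn by (intro nn_integral_eq_integral) auto
      then show "(\<integral>\<^sup>+ x. ennreal (f (k + N) x) \<partial>M) \<le> ennreal B" using b[of "k + N"] by (simp add: ennreal_leI)
    qed
  qed simp
  finally have le: "(\<integral>\<^sup>+ x. ennreal (F x) \<partial>M) \<le> ennreal B" .
  show "integrable M F" using Fnn le by (intro integrableI_nonneg) (auto simp: le_less_trans[OF le])
  then show "(LINT x|M. F x) \<le> B" using le Fnn B by (simp add: nn_integral_eq_integral)
qed

text \<open>The increments are almost everywhere dominated by a geometric series, so the sequence
  converges by telescoping; Fatou in the second index gives the distance to the limit. Membership of
  the limit in L1 does not follow from L2 bounds and is recovered elsewhere from the boundedness of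
  U.\<close>

lemma L2_complete:
  fixes g :: "nat \<Rightarrow> 'a::euclidean_space \<Rightarrow> real"
  assumes g: "\<And>k. L12 (g k)"
    and b: "\<And>k l. (LINT x|lborel. (g k x - g l x)\<^sup>2) \<le> C * ((1/4) ^ k + (1/4) ^ l)"
  shows "\<exists>h\<in>borel_measurable borel. (AE x in lborel. (\<lambda>k. g k x) \<longlonglongrightarrow> h x) \<and>
     (\<forall>k. integrable lborel (\<lambda>x. (g k x - h x)\<^sup>2) \<and> (LINT x|lborel. (g k x - h x)\<^sup>2) \<le> 2 * C * (1/4) ^ k)"
proof -
  have [measurable]: "g k \<in> borel_measurable borel" for k using g by (rule L12D)
  have I: "integrable lborel (\<lambda>x. (g k x - g l x)\<^sup>2)" for k l using L12D(2)[OF L12_diff[OF g g]] .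
  have "0 \<le> (LINT x|lborel. (g 0 x - g 0 x)\<^sup>2)" by simp
  also have "\<dots> \<le> 2 * C" using b[of 0 0] by simp
  finally have C: "C \<ge> 0" by simp
  define h where "h x = lim (\<lambda>k. g k x)" for x
  have [measurable]: "h \<in> borel_measurable borel" unfolding h_def by measurable
  have "AE x in lborel. \<exists>B. \<forall>k. (g (Suc k) x - g k x)\<^sup>2 \<le> B * (1/2) ^ k"
  \<comment> \<open>5 / 4 = 1 + 1 / 4 adds the rates at \<open>k\<close> and
    \<open>Suc k\<close>.\<close>
  proof (rule AE_geometric_bound[where C="5 / 4 * C"])
    show "(LINT x|lborel. (g (Suc k) x - g k x)\<^sup>2) \<le> (5 / 4 * C) * (1/4) ^ k" for k
      using b[of "Suc k" k] by (simp add: algebra_simps)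
  qed (use I in auto)
  then have lim: "AE x in lborel. (\<lambda>k. g k x) \<longlonglongrightarrow> h x"
  proof eventually_elim
    fix x assume "\<exists>B. \<forall>k. (g (Suc k) x - g k x)\<^sup>2 \<le> B * (1/2) ^ k"
    then obtain B where B: "\<And>k. (g (Suc k) x - g k x)\<^sup>2 \<le> B * (1/2) ^ k" by blast
    have "norm (g (Suc k) x - g k x) \<le> sqrt B * (sqrt (1/2)) ^ k" for k
    proof -
      have "\<bar>g (Suc k) x - g k x\<bar> \<le> sqrt (B * (1/2) ^ k)" by (rule real_le_rsqrt) (use B[of k] in simp)
      then show ?thesis by (simp add: real_sqrt_mult real_sqrt_power)
    qed
    moreover have "summable (\<lambda>k. sqrt B * (sqrt (1/2)) ^ k)"
      by (intro summable_mult summable_geometric) (simp add: real_sqrt_lt_1_iff)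
    ultimately have "summable (\<lambda>k. g (Suc k) x - g k x)" by (rule summable_comparison_test'[rotated])
    then have "convergent (\<lambda>n. \<Sum>k<n. g (Suc k) x - g k x)" by (simp add: summable_iff_convergent)
    then have "convergent (\<lambda>n. g n x - g 0 x)" using sum_lessThan_telescope[of "\<lambda>k. g k x"] by simp
    then have "convergent (\<lambda>n. (g n x - g 0 x) + g 0 x)" by (intro convergent_add convergent_const)
    then show "(\<lambda>k. g k x) \<longlonglongrightarrow> h x" by (simp add: h_def convergent_LIMSEQ_iff)
  qed
  have "integrable lborel (\<lambda>x. (g k x - h x)\<^sup>2)" "(LINT x|lborel. (g k x - h x)\<^sup>2) \<le> 2 * C * (1/4) ^ k" for k
  proof -
    have l: "AE x in lborel. (\<lambda>l. (g k x - g l x)\<^sup>2) \<longlonglongrightarrow> (g k x - h x)\<^sup>2"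
      using lim by eventually_elim (intro tendsto_intros)
    have bd: "(LINT x|lborel. (g k x - g l x)\<^sup>2) \<le> 2 * C * (1/4) ^ k" if "l \<ge> k" for l
    proof -
      have "(1/4::real) ^ l \<le> (1/4) ^ k" using that by (intro power_decreasing) auto
      then have "C * ((1/4) ^ k + (1/4) ^ l) \<le> C * ((1/4) ^ k + (1/4) ^ k)" using C by (intro mult_left_mono) auto
      then show ?thesis using b[of k l] by simp
    qed
    show "integrable lborel (\<lambda>x. (g k x - h x)\<^sup>2)" "(LINT x|lborel. (g k x - h x)\<^sup>2) \<le> 2 * C * (1/4) ^ k"
      by (rule fatou_bound[OF I _ bd l]; simp)+
  qed
  then show ?thesis using lim by (intro bexI[of _ h]) auto
qed

text \<open>Plancherel turns the geometric L2 rate into almost everywhere convergence of the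
  transforms. Fatou with the weight of the energy then transfers the Cauchy bound to the
  limit.\<close>

lemma sobolev_limit:
  fixes g :: "nat \<Rightarrow> 'a::euclidean_space \<Rightarrow> real"
  assumes g: "\<And>k. sobolev s (g k)" and h: "L12 h"
    and b: "\<And>k. (LINT x|lborel. (g k x - h x)\<^sup>2) \<le> C * (1/4) ^ k"
    and c: "\<And>k l. hs_inner s (\<lambda>x. g k x - g l x) (\<lambda>x. g k x - g l x) \<le> D * ((1/4) ^ k + (1/4) ^ l)"
  shows "sobolev s h" "(\<lambda>k. hs_inner s (\<lambda>x. g k x - h x) (\<lambda>x. g k x - h x)) \<longlonglongrightarrow> 0"
proof -
  note G = sobolev_L12[OF g]
  have [measurable]: "fourier (g k) \<in> borel_measurable borel" "fourier h \<in> borel_measurable borel" for k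
    using G h by (auto intro: fourier_measurable dest: L12D)
  have "0 \<le> hs_inner s (\<lambda>x. g 0 x - g 0 x) (\<lambda>x. g 0 x - g 0 x)" by (intro hs_nonneg sobolev_diff g)
  also have "\<dots> \<le> 2 * D" using c[of 0 0] by simp
  finally have D: "D \<ge> 0" by simp
  have "AE \<xi> in lborel. \<exists>B. \<forall>k. (cmod (fourier (g k) \<xi> - fourier h \<xi>))\<^sup>2 \<le> B * (1/2) ^ k"
  proof (rule AE_geometric_bound[where C="(2 * pi) ^ DIM('a) * C"])
    note p = plancherel_norm[OF L12_diff[OF G h], unfolded fourier_diff[OF L12D(1)[OF G] L12D(1)[OF h]]]
    show "integrable lborel (\<lambda>\<xi>. (cmod (fourier (g k) \<xi> - fourier h \<xi>))\<^sup>2)" for k by (rule p)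
    show "(LINT \<xi>|lborel. (cmod (fourier (g k) \<xi> - fourier h \<xi>))\<^sup>2) \<le> (2 * pi) ^ DIM('a) * C * (1/4) ^ k" for k
      unfolding p using mult_left_mono[OF b, of "(2 * pi) ^ DIM('a)" k] by (simp add: mult.assoc)
  qed simp
  then have lim: "AE \<xi> in lborel. (\<lambda>k. fourier (g k) \<xi>) \<longlonglongrightarrow> fourier h \<xi>"
  proof eventually_elim
    fix \<xi> assume "\<exists>B. \<forall>k. (cmod (fourier (g k) \<xi> - fourier h \<xi>))\<^sup>2 \<le> B * (1/2) ^ k"
    then obtain B where B: "\<And>k. (cmod (fourier (g k) \<xi> - fourier h \<xi>))\<^sup>2 \<le> B * (1/2) ^ k" by blast
    have "(\<lambda>k. sqrt (B * (1/2) ^ k)) \<longlonglongrightarrow> sqrt (B * 0)"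
      by (intro tendsto_intros LIMSEQ_power_zero) simp
    then have z: "(\<lambda>k. sqrt (B * (1/2) ^ k)) \<longlonglongrightarrow> 0" by simp
    have "(\<lambda>k. fourier (g k) \<xi> - fourier h \<xi>) \<longlonglongrightarrow> 0"
      by (rule Lim_null_comparison[OF always_eventually z]) (auto intro: real_le_rsqrt B)
    then show "(\<lambda>k. fourier (g k) \<xi>) \<longlonglongrightarrow> fourier h \<xi>" by (rule LIM_zero_cancel)
  qed
  define f where "f k l \<xi> = (1 + norm \<xi> powr (2 * s)) * (cmod (fourier (g k) \<xi> - fourier (g l) \<xi>))\<^sup>2" for k l \<xi>
  define F where "F k \<xi> = (1 + norm \<xi> powr (2 * s)) * (cmod (fourier (g k) \<xi> - fourier h \<xi>))\<^sup>2" for k \<xi>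
  have [measurable]: "F k \<in> borel_measurable borel" for k unfolding F_def by measurable
  have fi: "integrable lborel (f k l)" and fl: "(LINT \<xi>|lborel. f k l \<xi>) = (2 * pi) ^ DIM('a) * hs_inner s (\<lambda>x. g k x - g l x) (\<lambda>x. g k x - g l x)" for k l
  proof -
    have e: "f k l \<xi> = (1 + norm \<xi> powr (2 * s)) * Re (fourier (\<lambda>x. g k x - g l x) \<xi> * cnj (fourier (\<lambda>x. g k x - g l x) \<xi>))" for \<xi>
      unfolding Re_mult_cnj fourier_diff[OF L12D(1)[OF G] L12D(1)[OF G]] f_def ..
    show "integrable lborel (f k l)" unfolding e[abs_def] by (intro hs_integrable sobolev_diff g)
    show "(LINT \<xi>|lborel. f k l \<xi>) = (2 * pi) ^ DIM('a) * hs_inner s (\<lambda>x. g k x - g l x) (\<lambda>x. g k x - g l x)"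
      unfolding e hs_inner_def by simp
  qed
  have Fi: "integrable lborel (F k)" and Fl: "(LINT \<xi>|lborel. F k \<xi>) \<le> (2 * pi) ^ DIM('a) * (2 * D * (1/4) ^ k)" for k
  proof -
    have l: "AE \<xi> in lborel. (\<lambda>l. f k l \<xi>) \<longlonglongrightarrow> F k \<xi>"
      using lim by eventually_elim (auto simp: f_def F_def intro!: tendsto_intros)
    have bd: "(LINT \<xi>|lborel. f k l \<xi>) \<le> (2 * pi) ^ DIM('a) * (2 * D * (1/4) ^ k)" if "l \<ge> k" for l
    proof -
      have "(1/4::real) ^ l \<le> (1/4) ^ k" using that by (intro power_decreasing) auto
      then have "D * ((1/4) ^ k + (1/4) ^ l) \<le> D * ((1/4) ^ k + (1/4) ^ k)" using D by (intro mult_left_mono) auto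
      then show ?thesis unfolding fl using c[of k l] by (intro mult_left_mono) auto
    qed
    show "integrable lborel (F k)" "(LINT \<xi>|lborel. F k \<xi>) \<le> (2 * pi) ^ DIM('a) * (2 * D * (1/4) ^ k)"
      by (rule fatou_bound[OF fi _ bd l]; simp add: f_def)+
  qed
  have d: "sobolev s (\<lambda>x. g k x - h x)" for k
    unfolding sobolev_weighted[OF L12_diff[OF G h]] fourier_diff[OF L12D(1)[OF G] L12D(1)[OF h]]
    using Fi[of k] unfolding F_def[abs_def] .
  show "sobolev s h" using sobolev_diff[OF g[of 0] d[of 0]] by simp
  have F2: "hs_inner s (\<lambda>x. g k x - h x) (\<lambda>x. g k x - h x) = (LINT \<xi>|lborel. F k \<xi>) / (2 * pi) ^ DIM('a)" for k
    unfolding hs_inner_def Re_mult_cnj fourier_diff[OF L12D(1)[OF G] L12D(1)[OF h]] F_def ..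
  have b2: "hs_inner s (\<lambda>x. g k x - h x) (\<lambda>x. g k x - h x) \<le> 2 * D * (1/4) ^ k" for k
    unfolding F2 using Fl[of k] by (simp add: field_simps)
  have "(\<lambda>k. 2 * D * (1/4) ^ k) \<longlonglongrightarrow> 2 * D * 0" by (intro tendsto_intros LIMSEQ_power_zero) simp
  then have z: "(\<lambda>k. 2 * D * (1/4) ^ k) \<longlonglongrightarrow> 0" by simp
  show "(\<lambda>k. hs_inner s (\<lambda>x. g k x - h x) (\<lambda>x. g k x - h x)) \<longlonglongrightarrow> 0"
    by (rule Lim_null_comparison[OF always_eventually z]) (use b2 hs_nonneg[OF d] in auto)
qed

subsection \<open>Projection on potentials\<close>

text \<open>The projection without a closed subspace: members of \<open>V\<close> are chosen whose
  squared distance to \<open>v\<close> exceeds the infimum by less than (1/4)^k. The midpoint of two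
  of them is again in \<open>V\<close>, so the parallelogram law gives the Cauchy bound.\<close>

lemma hs_minimizing_sequence:
  fixes V :: "('a::euclidean_space \<Rightarrow> real) set"
  assumes V: "\<And>f. f \<in> V \<Longrightarrow> sobolev s f" and z: "(\<lambda>x. 0) \<in> V"
    and lin: "\<And>f g a b. f \<in> V \<Longrightarrow> g \<in> V \<Longrightarrow> (\<lambda>x. a * f x + b * g x) \<in> V"
    and v: "sobolev s v"
  obtains g where "\<And>k::nat. g k \<in> V"
    and "\<And>k l. hs_inner s (\<lambda>x. g k x - g l x) (\<lambda>x. g k x - g l x) \<le> 2 * ((1/4) ^ k + (1/4) ^ l)"
    and "\<And>f. f \<in> V \<Longrightarrow> (\<lambda>k. hs_inner s (\<lambda>x. v x - g k x) f) \<longlonglongrightarrow> 0"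
proof -
  define Q where "Q f = hs_inner s (\<lambda>x. v x - f x) (\<lambda>x. v x - f x)" for f
  have Q0: "Q f \<ge> 0" if "f \<in> V" for f unfolding Q_def by (intro hs_nonneg sobolev_diff v V that)
  define J where "J = Inf (Q ` V)"
  have bdd: "bdd_below (Q ` V)" using Q0 by (auto intro!: bdd_belowI)
  have J: "J \<le> Q f" if "f \<in> V" for f unfolding J_def using that by (intro cInf_lower bdd) auto
  have "\<exists>f\<in>V. Q f < J + (1/4) ^ k" for k :: nat
    using cInf_lessD[of "Q ` V" "J + (1/4) ^ k"] z unfolding J_def by auto
  then obtain g where g: "\<And>k. g k \<in> V" "\<And>k. Q (g k) < J + (1/4) ^ k" by metis
  have par: "hs_inner s (\<lambda>x. g k x - g l x) (\<lambda>x. g k x - g l x) \<le> 2 * ((1/4) ^ k + (1/4) ^ l)" for k l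
  proof -
    define a where "a = (\<lambda>x. v x - g k x)"
    define b where "b = (\<lambda>x. v x - g l x)"
    have a: "sobolev s a" and b: "sobolev s b" unfolding a_def b_def by (intro sobolev_diff v V g)+
    have Qa: "Q (g k) = hs_inner s a a" and Qb: "Q (g l) = hs_inner s b b" by (simp_all add: Q_def a_def b_def)
    have "(\<lambda>x. (1/2) * g k x + (1/2) * g l x) \<in> V" by (intro lin g)
    then have "J \<le> Q (\<lambda>x. (1/2) * g k x + (1/2) * g l x)" by (rule J)
    also have "(\<lambda>x. v x - ((1/2) * g k x + (1/2) * g l x)) = (\<lambda>x. (1/2) * a x - (- 1/2) * b x)"
      by (auto simp: a_def b_def field_simps)
    then have "Q (\<lambda>x. (1/2) * g k x + (1/2) * g l x) = hs_inner s (\<lambda>x. (1/2) * a x - (- 1/2) * b x) (\<lambda>x. (1/2) * a x - (- 1/2) * b x)"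
      by (simp add: Q_def)
    also have "\<dots> = (hs_inner s a a + 2 * hs_inner s a b + hs_inner s b b) / 4"
      unfolding hs_square_expand[OF sobolev_cmult[OF a] b] hs_cmult_left hs_commute[of s a "\<lambda>x. (1/2) * a x"]
      by (simp add: power2_eq_square)
    finally have 1: "4 * J \<le> hs_inner s a a + 2 * hs_inner s a b + hs_inner s b b" by simp
    have "(\<lambda>x. g k x - g l x) = (\<lambda>x. b x - 1 * a x)" by (auto simp: a_def b_def)
    then have "hs_inner s (\<lambda>x. g k x - g l x) (\<lambda>x. g k x - g l x) = hs_inner s b b - 2 * hs_inner s b a + hs_inner s a a"
      using hs_square_expand[OF b a, of 1] by simp
    then show ?thesis using 1 g(2)[of k] g(2)[of l] unfolding Qa Qb hs_commute[of s b a] by simp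
  qed
  have lim: "(\<lambda>k. hs_inner s (\<lambda>x. v x - g k x) f) \<longlonglongrightarrow> 0" if f: "f \<in> V" for f
  proof -
    have sf: "sobolev s f" and sr: "sobolev s (\<lambda>x. v x - g k x)" for k by (intro sobolev_diff v V g f)+
    \<comment> \<open>Moving from \<open>g k\<close> in the direction \<open>f\<close> by any amount
      \<open>t\<close> can lower the squared distance by at most (1/4)^k, so the discriminant of
      this quadratic in \<open>t\<close> is controlled.\<close>
    have le: "(hs_inner s (\<lambda>x. v x - g k x) f)\<^sup>2 \<le> (1/4) ^ k * hs_inner s f f" for k
    proof (rule quadratic_bound[OF _ hs_nonneg[OF sf]])
      fix t :: real
      have "(\<lambda>x. 1 * g k x + t * f x) \<in> V" by (intro lin g f)
      then have "J \<le> Q (\<lambda>x. 1 * g k x + t * f x)" by (rule J)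
      also have "Q (\<lambda>x. 1 * g k x + t * f x) = hs_inner s (\<lambda>x. (v x - g k x) - t * f x) (\<lambda>x. (v x - g k x) - t * f x)"
        by (simp add: Q_def algebra_simps)
      also have "\<dots> = Q (g k) - 2 * t * hs_inner s (\<lambda>x. v x - g k x) f + t\<^sup>2 * hs_inner s f f"
        unfolding Q_def by (rule hs_square_expand[OF sr sf])
      finally show "0 \<le> (1/4) ^ k - 2 * t * hs_inner s (\<lambda>x. v x - g k x) f + t\<^sup>2 * hs_inner s f f"
        using g(2)[of k] by simp
    qed
    have "(\<lambda>k. sqrt ((1/4) ^ k * hs_inner s f f)) \<longlonglongrightarrow> sqrt (0 * hs_inner s f f)"
      by (intro tendsto_intros LIMSEQ_power_zero) simp
    then have zz: "(\<lambda>k. sqrt ((1/4) ^ k * hs_inner s f f)) \<longlonglongrightarrow> 0" by simp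
    show ?thesis
      by (rule Lim_null_comparison[OF always_eventually zz]) (auto intro!: real_le_rsqrt le)
  qed
  show ?thesis using that g(1) par lim by blast
qed

lemma L2_tendsto_integral:
  fixes g :: "nat \<Rightarrow> 'a::euclidean_space \<Rightarrow> real"
  assumes [measurable]: "\<And>k. g k \<in> borel_measurable borel" "h \<in> borel_measurable borel" "\<mu> \<in> borel_measurable borel"
    and g2: "\<And>k. integrable lborel (\<lambda>x. (g k x)\<^sup>2)" and h2: "integrable lborel (\<lambda>x. (h x)\<^sup>2)" and m2: "integrable lborel (\<lambda>x. (\<mu> x)\<^sup>2)"
    and d: "\<And>k. integrable lborel (\<lambda>x. (g k x - h x)\<^sup>2)" "(\<lambda>k. LINT x|lborel. (g k x - h x)\<^sup>2) \<longlonglongrightarrow> 0"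
  shows "(\<lambda>k. LINT x|lborel. \<mu> x * g k x) \<longlonglongrightarrow> (LINT x|lborel. \<mu> x * h x)"
proof -
  have cs: "(LINT x|lborel. \<mu> x * (g k x - h x))\<^sup>2 \<le> (LINT x|lborel. (\<mu> x)\<^sup>2) * (LINT x|lborel. (g k x - h x)\<^sup>2)" for k
  proof (rule quadratic_bound)
    fix t :: real
    have i: "integrable lborel (\<lambda>x. \<mu> x * (g k x - h x))" using m2 d(1) by (intro integrable_L2_mult) auto
    have "0 \<le> (LINT x|lborel. (\<mu> x - t * (g k x - h x))\<^sup>2)" by (intro integral_nonneg_AE) auto
    also have "(\<lambda>x. (\<mu> x - t * (g k x - h x))\<^sup>2) = (\<lambda>x. (\<mu> x)\<^sup>2 - 2 * t * (\<mu> x * (g k x - h x)) + t\<^sup>2 * (g k x - h x)\<^sup>2)"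
      by (auto simp: power2_eq_square algebra_simps)
    also have "(LINT x|lborel. (\<mu> x)\<^sup>2 - 2 * t * (\<mu> x * (g k x - h x)) + t\<^sup>2 * (g k x - h x)\<^sup>2)
      = (LINT x|lborel. (\<mu> x)\<^sup>2) - 2 * t * (LINT x|lborel. \<mu> x * (g k x - h x)) + t\<^sup>2 * (LINT x|lborel. (g k x - h x)\<^sup>2)"
      using m2 d(1) i by simp
    finally show "0 \<le> (LINT x|lborel. (\<mu> x)\<^sup>2) - 2 * t * (LINT x|lborel. \<mu> x * (g k x - h x)) + t\<^sup>2 * (LINT x|lborel. (g k x - h x)\<^sup>2)" .
  qed (auto intro: integral_nonneg_AE)
  have "(\<lambda>k. sqrt ((LINT x|lborel. (\<mu> x)\<^sup>2) * (LINT x|lborel. (g k x - h x)\<^sup>2))) \<longlonglongrightarrow> sqrt ((LINT x|lborel. (\<mu> x)\<^sup>2) * 0)"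
    by (intro tendsto_real_sqrt tendsto_mult tendsto_const d(2))
  then have zz: "(\<lambda>k. sqrt ((LINT x|lborel. (\<mu> x)\<^sup>2) * (LINT x|lborel. (g k x - h x)\<^sup>2))) \<longlonglongrightarrow> 0" by simp
  have "(\<lambda>k. LINT x|lborel. \<mu> x * (g k x - h x)) \<longlonglongrightarrow> 0"
    by (rule Lim_null_comparison[OF always_eventually zz]) (auto intro!: real_le_rsqrt cs)
  moreover have "(LINT x|lborel. \<mu> x * (g k x - h x)) = (LINT x|lborel. \<mu> x * g k x) - (LINT x|lborel. \<mu> x * h x)" for k
    using integrable_L2_mult[OF _ _ m2 g2, of k] integrable_L2_mult[OF _ _ m2 h2] by (simp add: right_diff_distrib)
  ultimately have "(\<lambda>k. (LINT x|lborel. \<mu> x * g k x) - (LINT x|lborel. \<mu> x * h x)) \<longlonglongrightarrow> 0" by simp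
  then show ?thesis by (rule LIM_zero_cancel)
qed

text \<open>On the bounded set \<open>U\<close> the inequality |a| <= 1 + a^2 gives integrability,
  off \<open>U\<close> the function \<open>g\<close> does. This brings the regular parts, known only
  to be square integrable, into \<open>L12\<close>.\<close>

lemma L12_of_L2:
  fixes h :: "'a::euclidean_space \<Rightarrow> real"
  assumes [measurable]: "h \<in> borel_measurable borel" and h2: "integrable lborel (\<lambda>x. (h x)\<^sup>2)"
    and U: "bounded U" and g: "integrable lborel g" and hg: "\<And>x. x \<notin> U \<Longrightarrow> h x = g x"
  shows "L12 h"
  unfolding L12_def
proof (intro conjI h2)
  obtain R where R: "\<And>x. x \<in> U \<Longrightarrow> norm x \<le> R" using U by (auto simp: bounded_iff)
  show "integrable lborel h"
  proof (rule Bochner_Integration.integrable_bound)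
    show "integrable lborel (\<lambda>x. (1 * indicator (cball 0 R) x + (h x)\<^sup>2) + \<bar>g x\<bar>)"
      using h2 integrable_indicator_cball[of 1 R] g by (intro Bochner_Integration.integrable_add) auto
    have a: "\<bar>a\<bar> \<le> 1 + a\<^sup>2" for a :: real
      using sum_squares_bound[of 1 "\<bar>a\<bar>"] by (simp add: abs_if split: if_splits)
    have "\<bar>h x\<bar> \<le> (1 * indicator (cball 0 R) x + (h x)\<^sup>2) + \<bar>g x\<bar>" for x
    proof (cases "x \<in> U")
      case True then show ?thesis using R[OF True] a[of "h x"] by (auto simp: indicator_def)
    qed (auto simp: hg)
    then show "AE x in lborel. norm (h x) \<le> norm ((1 * indicator (cball 0 R) x + (h x)\<^sup>2) + \<bar>g x\<bar>)"
      by (auto intro: order_trans[OF _ abs_ge_self])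
  qed measurable
qed

text \<open>Abstractly, \<open>P f \<mu>\<close> says that \<open>f\<close> is the potential \<open>\<Gamma> * \<mu>\<close> of the density \<open>\<mu>\<close>, which vanishes on \<open>U\<close>.\<close>

lemma harmonic_extension:
  fixes U :: "'a::euclidean_space set" and v :: "'a \<Rightarrow> real" and P :: "('a \<Rightarrow> real) \<Rightarrow> ('a \<Rightarrow> real) \<Rightarrow> bool"
  assumes U[measurable]: "U \<in> sets borel" and bU: "bounded U" and v: "sobolev s v"
    and P1: "\<And>f \<mu>. P f \<mu> \<Longrightarrow> sobolev s f \<and> L12 \<mu> \<and> (\<forall>x\<in>U. \<mu> x = 0)"
    and P2: "\<And>f \<mu> \<phi>. P f \<mu> \<Longrightarrow> sobolev s \<phi> \<Longrightarrow> hs_inner s f \<phi> = (LINT x|lborel. \<mu> x * \<phi> x)"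
    and P3: "\<And>\<mu>. L12 \<mu> \<Longrightarrow> \<forall>x\<in>U. \<mu> x = 0 \<Longrightarrow> \<exists>f. P f \<mu>"
    and P4: "\<And>f \<mu> g \<nu> a b. P f \<mu> \<Longrightarrow> P g \<nu> \<Longrightarrow> P (\<lambda>x. a * f x + b * g x) (\<lambda>x. a * \<mu> x + b * \<nu> x)"
  shows "\<exists>g \<mu> h. (\<forall>k::nat. P (g k) (\<mu> k)) \<and> sobolev s h \<and> (\<forall>x. x \<notin> U \<longrightarrow> h x = v x) \<and>
    (AE x in lborel. (\<lambda>k. g k x) \<longlonglongrightarrow> h x) \<and>
    (\<forall>\<phi>. sobolev s \<phi> \<longrightarrow> (\<lambda>k. LINT x|lborel. \<mu> k x * \<phi> x) \<longlonglongrightarrow> hs_inner s h \<phi>) \<and>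
    hs_inner s h h \<le> hs_inner s v v"
proof -
  define V where "V = {f. \<exists>\<mu>. P f \<mu>}"
  have V: "sobolev s f" if "f \<in> V" for f using that P1 by (auto simp: V_def)
  have "L12 (\<lambda>x::'a. 0)" by (simp add: L12_def)
  then obtain f0 where f0: "P f0 (\<lambda>x. 0)" using P3[of "\<lambda>x. 0"] by auto
  have z: "(\<lambda>x. 0) \<in> V" using P4[OF f0 f0, of 0 0] by (auto simp: V_def)
  have lin: "(\<lambda>x. a * f x + b * g x) \<in> V" if "f \<in> V" "g \<in> V" for f g a b
    using that P4 unfolding V_def by blast
  obtain g where gV: "\<And>k::nat. g k \<in> V"
    and gc: "\<And>k l. hs_inner s (\<lambda>x. g k x - g l x) (\<lambda>x. g k x - g l x) \<le> 2 * ((1/4) ^ k + (1/4) ^ l)"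
    and gl: "\<And>f. f \<in> V \<Longrightarrow> (\<lambda>k. hs_inner s (\<lambda>x. v x - g k x) f) \<longlonglongrightarrow> 0"
    using hs_minimizing_sequence[OF V z lin v] by blast
  have "\<forall>k. \<exists>\<mu>. P (g k) \<mu>" using gV by (simp add: V_def)
  then have "\<exists>\<mu>. \<forall>k. P (g k) (\<mu> k)" by (rule choice)
  then obtain \<mu> where g\<mu>: "\<And>k. P (g k) (\<mu> k)" by blast
  have gs: "sobolev s (g k)" for k by (rule V[OF gV])
  note G = sobolev_L12[OF gs] and v12 = sobolev_L12[OF v]
  have "(LINT x|lborel. (g k x - g l x)\<^sup>2) \<le> 2 * ((1/4) ^ k + (1/4) ^ l)" for k l
    using order_trans[OF hs_ge_L2[OF sobolev_diff[OF gs gs]] gc] .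
  from L2_complete[OF G this] obtain h0 where [measurable]: "h0 \<in> borel_measurable borel"
    and lim: "AE x in lborel. (\<lambda>k. g k x) \<longlonglongrightarrow> h0 x"
    and d: "\<And>k. integrable lborel (\<lambda>x. (g k x - h0 x)\<^sup>2)" "\<And>k. (LINT x|lborel. (g k x - h0 x)\<^sup>2) \<le> 2 * 2 * (1/4) ^ k"
    by auto
  have [measurable]: "g k \<in> borel_measurable borel" "v \<in> borel_measurable borel" for k
    using G v12 by (auto dest: L12D)
  have h02: "integrable lborel (\<lambda>x. (h0 x)\<^sup>2)"
  proof (rule Bochner_Integration.integrable_bound)
    show "integrable lborel (\<lambda>x. 2 * (g 0 x)\<^sup>2 + 2 * (g 0 x - h0 x)\<^sup>2)"
      using d(1)[of 0] L12D(2)[OF G] by auto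
    have "(h0 x)\<^sup>2 \<le> 2 * (g 0 x)\<^sup>2 + 2 * (g 0 x - h0 x)\<^sup>2" for x
      using zero_le_power2[of "2 * g 0 x - h0 x"] by (simp add: power2_eq_square algebra_simps)
    then show "AE x in lborel. norm ((h0 x)\<^sup>2) \<le> norm (2 * (g 0 x)\<^sup>2 + 2 * (g 0 x - h0 x)\<^sup>2)" by simp
  qed measurable
  have d0: "(\<lambda>k. LINT x|lborel. (g k x - h0 x)\<^sup>2) \<longlonglongrightarrow> 0"
  proof -
    have "(\<lambda>k. 2 * 2 * (1/4) ^ k) \<longlonglongrightarrow> 2 * 2 * (0::real)" by (intro tendsto_intros LIMSEQ_power_zero) simp
    then have zz: "(\<lambda>k. 2 * 2 * (1/4::real) ^ k) \<longlonglongrightarrow> 0" by simp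
    show ?thesis
      by (rule Lim_null_comparison[OF always_eventually zz]) (use d(2) in \<open>auto simp: integral_nonneg_AE abs_of_nonneg\<close>)
  qed
  \<comment> \<open>The energy product with a potential is the L2 product with its density.
    Orthogonality of the residual to all potentials therefore becomes L2 orthogonality of
    \<open>v - h0\<close> to all densities vanishing on \<open>U\<close>.\<close>
  have orth: "(LINT x|lborel. \<nu> x * (v x - h0 x)) = 0" if \<nu>: "L12 \<nu>" "\<forall>x\<in>U. \<nu> x = 0" for \<nu>
  proof -
    note N = L12D[OF \<nu>(1)]
    obtain f where f: "P f \<nu>" using P3[OF \<nu>] by blast
    have "(\<lambda>k. hs_inner s (\<lambda>x. v x - g k x) f) \<longlonglongrightarrow> 0" by (rule gl) (use f in \<open>auto simp: V_def\<close>)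
    moreover have "hs_inner s (\<lambda>x. v x - g k x) f = (LINT x|lborel. \<nu> x * v x) - (LINT x|lborel. \<nu> x * g k x)" for k
      unfolding hs_commute[of s _ f] P2[OF f sobolev_diff[OF v gs]]
      using L12_mult[OF \<nu>(1) v12] L12_mult[OF \<nu>(1) G[of k]] by (simp add: right_diff_distrib)
    moreover have "(\<lambda>k. LINT x|lborel. \<nu> x * g k x) \<longlonglongrightarrow> (LINT x|lborel. \<nu> x * h0 x)"
      using L12D(2)[OF G] N h02 d(1) d0 by (intro L2_tendsto_integral) auto
    ultimately have "(\<lambda>k. (LINT x|lborel. \<nu> x * v x) - (LINT x|lborel. \<nu> x * g k x)) \<longlonglongrightarrow> 0"
      "(\<lambda>k. (LINT x|lborel. \<nu> x * v x) - (LINT x|lborel. \<nu> x * g k x)) \<longlonglongrightarrow> (LINT x|lborel. \<nu> x * v x) - (LINT x|lborel. \<nu> x * h0 x)"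
      by (simp, intro tendsto_diff tendsto_const)
    then have "(LINT x|lborel. \<nu> x * v x) - (LINT x|lborel. \<nu> x * h0 x) = 0"
      by (rule LIMSEQ_unique[symmetric])
    then show ?thesis
      using L12_mult[OF \<nu>(1) v12] integrable_L2_mult[OF _ _ N(2) h02] N(3) by (simp add: right_diff_distrib)
  qed
  have off: "AE x in lborel. x \<notin> U \<longrightarrow> h0 x = v x"
  proof -
    have "AE x in lborel. indicator (cball 0 (real n) - U) x * (v x - h0 x)\<^sup>2 = 0" for n
    proof -
      \<comment> \<open>The residual off \<open>U\<close> is tested against itself. The truncation
        to a ball makes it integrable and hence an admissible density.\<close>
      define \<nu> where "\<nu> x = indicator (cball 0 (real n) - U) x * (v x - h0 x)" for x
      have cb[measurable]: "cball (0::'a) (real n) \<in> sets borel" by simp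
      have [measurable]: "\<nu> \<in> borel_measurable borel" unfolding \<nu>_def by measurable
      have vh: "integrable lborel (\<lambda>x. (v x - h0 x)\<^sup>2)"
      proof (rule Bochner_Integration.integrable_bound)
        show "integrable lborel (\<lambda>x. 2 * (v x)\<^sup>2 + 2 * (h0 x)\<^sup>2)" using L12D(2)[OF v12] h02 by simp
        have "(v x - h0 x)\<^sup>2 \<le> 2 * (v x)\<^sup>2 + 2 * (h0 x)\<^sup>2" for x
          using zero_le_power2[of "v x + h0 x"] by (simp add: power2_eq_square algebra_simps)
        then show "AE x in lborel. norm ((v x - h0 x)\<^sup>2) \<le> norm (2 * (v x)\<^sup>2 + 2 * (h0 x)\<^sup>2)" by simp
      qed measurable
      have n2: "integrable lborel (\<lambda>x. (\<nu> x)\<^sup>2)"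
        by (rule Bochner_Integration.integrable_bound[OF vh]) (auto simp: \<nu>_def indicator_def)
      have n1: "integrable lborel \<nu>"
      proof (rule Bochner_Integration.integrable_bound)
        show "integrable lborel (\<lambda>x::'a. 1 * indicator (cball 0 (real n)) x + (\<nu> x)\<^sup>2)"
          using n2 integrable_indicator_cball[of 1 "real n"] by (intro Bochner_Integration.integrable_add)
        have a: "\<bar>a\<bar> \<le> 1 + a\<^sup>2" for a :: real
          using sum_squares_bound[of 1 "\<bar>a\<bar>"] by (simp add: abs_if split: if_splits)
        then show "AE x in lborel. norm (\<nu> x) \<le> norm (1 * indicator (cball 0 (real n)) x + (\<nu> x)\<^sup>2)"
          using a[of "\<nu> _"] by (auto simp: \<nu>_def indicator_def)
      qed measurable
      have "(LINT x|lborel. \<nu> x * (v x - h0 x)) = 0"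
        by (rule orth) (use n1 n2 in \<open>auto simp: L12_def, auto simp: \<nu>_def\<close>)
      moreover have "\<nu> x * (v x - h0 x) = indicator (cball 0 (real n) - U) x * (v x - h0 x)\<^sup>2" for x
        by (simp add: \<nu>_def power2_eq_square)
      moreover have "integrable lborel (\<lambda>x. indicator (cball 0 (real n) - U) x * (v x - h0 x)\<^sup>2)"
        by (rule Bochner_Integration.integrable_bound[OF vh]) (auto simp: indicator_def)
      ultimately show ?thesis by (simp add: integral_nonneg_eq_0_iff_AE)
    qed
    then have "AE x in lborel. \<forall>n. indicator (cball 0 (real n) - U) x * (v x - h0 x)\<^sup>2 = 0" unfolding AE_all_countable by blast
    then show ?thesis
    proof eventually_elim
      fix x assume a: "\<forall>n. indicator (cball 0 (real n) - U) x * (v x - h0 x)\<^sup>2 = 0"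
      obtain n where "norm x \<le> real n" using real_arch_simple by blast
      then show "x \<notin> U \<longrightarrow> h0 x = v x" using a[rule_format, of n] by (auto simp: indicator_def)
    qed
  qed
  \<comment> \<open>The limit equals \<open>v\<close> off \<open>U\<close> only almost everywhere.
    The modification makes this hold at every point, as the test functions of
    \<open>weak_solution\<close> have to vanish everywhere outside \<open>U\<close>.\<close>
  define h where "h x = (if x \<in> U then h0 x else v x)" for x
  have [measurable]: "h \<in> borel_measurable borel" unfolding h_def by measurable
  have hh0: "AE x in lborel. h x = h0 x" using off by eventually_elim (auto simp: h_def)
  have h2: "integrable lborel (\<lambda>x. (h x)\<^sup>2)"
    by (rule integrable_cong_AE_imp[OF h02]) (use hh0 in \<open>auto elim: eventually_mono\<close>)
  have hv: "\<forall>x. x \<notin> U \<longrightarrow> h x = v x" by (simp add: h_def)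
  have h12: "L12 h"
    by (rule L12_of_L2[OF _ h2 bU L12D(1)[OF v12]]) (auto simp: h_def)
  have dh: "(LINT x|lborel. (g k x - h x)\<^sup>2) \<le> 4 * (1/4) ^ k" for k
  proof -
    have "(LINT x|lborel. (g k x - h x)\<^sup>2) = (LINT x|lborel. (g k x - h0 x)\<^sup>2)"
      by (rule integral_cong_AE) (use hh0 in \<open>auto elim: eventually_mono\<close>)
    then show ?thesis using d(2)[of k] by simp
  qed
  note hs = sobolev_limit[OF gs h12 dh gc]
  have conv: "(\<lambda>k. LINT x|lborel. \<mu> k x * \<phi> x) \<longlonglongrightarrow> hs_inner s h \<phi>" if "sobolev s \<phi>" for \<phi>
    using hs_tendsto[OF gs hs(1) that hs(2)] unfolding P2[OF g\<mu> that] .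
  have "hs_inner s h h \<le> hs_inner s v v"
  proof -
    \<comment> \<open>The densities \<open>\<mu> k\<close> vanish on \<open>U\<close> and
      \<open>v - h\<close> vanishes off \<open>U\<close>, so \<open>h\<close> is orthogonal to
      \<open>v - h\<close>; Pythagoras then gives the energy comparison.\<close>
    have "hs_inner s h (\<lambda>x. v x - h x) = 0"
    proof (rule LIMSEQ_unique[OF conv[OF sobolev_diff[OF v hs(1)]]])
      have m0: "\<mu> k x * (v x - h x) = 0" for k x using P1[OF g\<mu>[of k]] by (cases "x \<in> U") (auto simp: h_def)
      show "(\<lambda>k. LINT x|lborel. \<mu> k x * (v x - h x)) \<longlonglongrightarrow> 0" unfolding m0 by simp
    qed
    then have "hs_inner s v h = hs_inner s h h"
      unfolding hs_diff_right[OF v hs(1) hs(1)] by (simp add: hs_commute)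
    then have "0 \<le> hs_inner s v v - hs_inner s h h"
      using hs_nonneg[OF sobolev_diff[OF v hs(1)]] hs_square_expand[OF v hs(1), of 1] by simp
    then show ?thesis by simp
  qed
  moreover have "AE x in lborel. (\<lambda>k. g k x) \<longlonglongrightarrow> h x"
    using lim hh0 by eventually_elim simp
  ultimately have "(\<forall>k. P (g k) (\<mu> k)) \<and> sobolev s h \<and> (\<forall>x. x \<notin> U \<longrightarrow> h x = v x) \<and>
    (AE x in lborel. (\<lambda>k. g k x) \<longlonglongrightarrow> h x) \<and>
    (\<forall>\<phi>. sobolev s \<phi> \<longrightarrow> (\<lambda>k. LINT x|lborel. \<mu> k x * \<phi> x) \<longlonglongrightarrow> hs_inner s h \<phi>) \<and>
    hs_inner s h h \<le> hs_inner s v v"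
    using g\<mu> hs(1) conv hv by blast
  then show ?thesis by blast
qed

subsection \<open>The Fourier transform of the fundamental solution\<close>

lemma real_polynomial_function_derivative:
  fixes P :: "'a::euclidean_space \<Rightarrow> real"
  assumes "real_polynomial_function P"
  shows "\<exists>D. (\<forall>x. (P has_derivative D x) (at x)) \<and> (\<forall>v. real_polynomial_function (\<lambda>x. D x v))"
  using assms
proof (induction rule: real_polynomial_function.induct)
  case (linear f)
  then show ?case by (intro exI[of _ "\<lambda>x. f"]) (auto simp: bounded_linear_imp_has_derivative real_polynomial_function.intros)
next
  case (const c)
  show ?case by (intro exI[of _ "\<lambda>x v. 0"]) (auto intro: real_polynomial_function.intros)
next
  case (add f g)
  then obtain D E where "\<forall>x. (f has_derivative D x) (at x)" "\<forall>v. real_polynomial_function (\<lambda>x. D x v)"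
    "\<forall>x. (g has_derivative E x) (at x)" "\<forall>v. real_polynomial_function (\<lambda>x. E x v)" by blast
  then show ?case
    by (intro exI[of _ "\<lambda>x v. D x v + E x v"]) (auto intro: has_derivative_add real_polynomial_function.intros)
next
  case (mult f g)
  then obtain D E where "\<forall>x. (f has_derivative D x) (at x)" "\<forall>v. real_polynomial_function (\<lambda>x. D x v)"
    "\<forall>x. (g has_derivative E x) (at x)" "\<forall>v. real_polynomial_function (\<lambda>x. E x v)" by blast
  with mult.hyps show ?case
    by (intro exI[of _ "\<lambda>x v. f x * E x v + D x v * g x"] conjI allI has_derivative_mult real_polynomial_function.intros(3,4)) auto
qed

lemma real_polynomial_function_growth:
  fixes P :: "'a::euclidean_space \<Rightarrow> real"
  assumes "real_polynomial_function P"
  shows "\<exists>C m. \<forall>x. \<bar>P x\<bar> \<le> C * (1 + norm x) ^ m"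
  using assms
proof (induction rule: real_polynomial_function.induct)
  case (linear f)
  then obtain K where K: "K > 0" "\<And>x. norm (f x) \<le> norm x * K" using bounded_linear.pos_bounded by blast
  have "\<bar>f x\<bar> \<le> K * (1 + norm x) ^ 1" for x
    using K(2)[of x] K(1) by (simp add: algebra_simps)
  then show ?case by blast
next
  case (const c)
  show ?case by (intro exI[of _ "\<bar>c\<bar>"] exI[of _ 0]) auto
next
  case (add f g)
  then obtain C m D k where b: "\<And>x. \<bar>f x\<bar> \<le> C * (1 + norm x) ^ m" "\<And>x. \<bar>g x\<bar> \<le> D * (1 + norm x) ^ k" by blast
  have "\<bar>f x + g x\<bar> \<le> (\<bar>C\<bar> + \<bar>D\<bar>) * (1 + norm x) ^ (m + k)" for x
  proof -
    have "C * (1 + norm x) ^ m \<le> \<bar>C\<bar> * (1 + norm x) ^ (m + k)" "D * (1 + norm x) ^ k \<le> \<bar>D\<bar> * (1 + norm x) ^ (m + k)"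
      by (intro mult_mono power_increasing; simp)+
    then show ?thesis using b[of x] by (simp add: distrib_right)
  qed
  then show ?case by blast
next
  case (mult f g)
  then obtain C m D k where b: "\<And>x. \<bar>f x\<bar> \<le> C * (1 + norm x) ^ m" "\<And>x. \<bar>g x\<bar> \<le> D * (1 + norm x) ^ k" by blast
  have "\<bar>f x * g x\<bar> \<le> (C * D) * (1 + norm x) ^ (m + k)" for x
    using mult_mono[OF b(1)[of x] b(2)[of x]] order_trans[OF abs_ge_zero b(1)[of x]] by (simp add: abs_mult power_add mult_ac)
  then show ?case by blast
qed

lemma power_gaussian_bounded: "\<exists>B. \<forall>r\<ge>0. (1 + r) ^ m * exp (- r\<^sup>2 / 4) \<le> (B::real)"
proof -
  have "(1 + r) ^ m * exp (- r\<^sup>2 / 4) \<le> fact m * exp 2" if r: "r \<ge> 0" for r :: real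
  proof -
    \<comment> \<open>The power is bounded by one term of the exponential series. The exponent 1 + r
      - r^2 / 4 left afterwards is largest at r = 2, with value 2.\<close>
    have "(\<Sum>n\<in>{m}. (1 + r) ^ n /\<^sub>R fact n) \<le> exp (1 + r)"
      unfolding exp_def by (rule sum_le_suminf[OF summable_exp_generic]) (use r in auto)
    then have "fact m * ((1 + r) ^ m / fact m) \<le> fact m * exp (1 + r)"
      by (intro mult_left_mono) (auto simp: divide_inverse mult.commute)
    then have "(1 + r) ^ m \<le> fact m * exp (1 + r)" by simp
    then have "(1 + r) ^ m * exp (- r\<^sup>2 / 4) \<le> fact m * exp (1 + r) * exp (- r\<^sup>2 / 4)" by (intro mult_right_mono) auto
    also have "\<dots> = fact m * exp (1 + r - r\<^sup>2 / 4)" by (simp flip: exp_add)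
    also have "\<dots> \<le> fact m * exp 2"
      using zero_le_power2[of "r / 2 - 1"] by (intro mult_left_mono) (auto simp: power2_eq_square field_simps)
    finally show ?thesis .
  qed
  then show ?thesis by blast
qed

text \<open>By induction every iterated derivative is a polynomial times the same Gaussian, and a
  polynomial grows at most like a power of 1 + |x|.\<close>

lemma schwartz_gaussian: "schwartz (\<lambda>x::'a::euclidean_space. exp (- (norm (x - a))\<^sup>2 / 2))" (is "schwartz ?\<phi>")
proof -
  have d\<phi>: "(?\<phi> has_derivative (\<lambda>v. - ((x - a) \<bullet> v) * ?\<phi> x)) (at x)" for x
  proof -
    have "((\<lambda>x. exp (- ((x - a) \<bullet> (x - a)) / 2)) has_derivative (\<lambda>v. exp (- ((x - a) \<bullet> (x - a)) / 2) * (- ((x - a) \<bullet> v + v \<bullet> (x - a)) / 2))) (at x)"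
      by (auto intro!: derivative_eq_intros simp: fun_eq_iff field_simps)
    then show ?thesis
      unfolding power2_norm_eq_inner by (simp add: inner_commute mult.commute[of "exp _"])
  qed
  have it: "\<exists>P. real_polynomial_function P \<and> iter_deriv vs ?\<phi> = (\<lambda>x. P x * ?\<phi> x)" for vs
  proof (induction vs)
    case Nil
    show ?case by (intro exI[of _ "\<lambda>x. 1"]) (auto intro: real_polynomial_function.intros)
  next
    case (Cons v vs)
    then obtain P where P: "real_polynomial_function P" "iter_deriv vs ?\<phi> = (\<lambda>x. P x * ?\<phi> x)" by blast
    obtain D where D: "\<And>x. (P has_derivative D x) (at x)" "\<And>v. real_polynomial_function (\<lambda>x. D x v)"
      using real_polynomial_function_derivative[OF P(1)] by blast
    have d: "((\<lambda>x. P x * ?\<phi> x) has_derivative (\<lambda>v. P x * (- ((x - a) \<bullet> v) * ?\<phi> x) + D x v * ?\<phi> x)) (at x)" for x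
      by (rule has_derivative_mult[OF D(1) d\<phi>])
    have "iter_deriv (v # vs) ?\<phi> = (\<lambda>x. (P x * (- (x \<bullet> v) + a \<bullet> v) + D x v) * ?\<phi> x)"
      unfolding iter_deriv.simps P(2) frechet_derivative_at[OF d, symmetric]
      by (auto simp: fun_eq_iff inner_diff_left algebra_simps)
    moreover have "real_polynomial_function (\<lambda>x. P x * (- (x \<bullet> v) + a \<bullet> v) + D x v)"
      by (intro real_polynomial_function.intros P(1) D(2) bounded_linear_minus bounded_linear_inner_left)
    ultimately show ?case by blast
  qed
  show ?thesis
    unfolding schwartz_def smooth_on_def
  proof (intro conjI allI ballI)
    fix vs and x :: 'a
    obtain P where P: "real_polynomial_function P" "iter_deriv vs ?\<phi> = (\<lambda>x. P x * ?\<phi> x)" using it by blast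
    obtain D where D: "\<And>x. (P has_derivative D x) (at x)"
      using real_polynomial_function_derivative[OF P(1)] by blast
    show "iter_deriv vs ?\<phi> differentiable at x"
      unfolding P(2) differentiable_def using has_derivative_mult[OF D d\<phi>] by blast
  next
    fix k :: nat and vs
    obtain P where P: "real_polynomial_function P" "iter_deriv vs ?\<phi> = (\<lambda>x. P x * ?\<phi> x)" using it by blast
    obtain C m where C: "\<And>x. \<bar>P x\<bar> \<le> C * (1 + norm x) ^ m" using real_polynomial_function_growth[OF P(1)] by blast
    obtain B where B: "\<forall>r\<ge>0. (1 + r) ^ (k + m) * exp (- r\<^sup>2 / 4) \<le> (B::real)" using power_gaussian_bounded[of "k + m"] ..
    have "C \<ge> 0" using order_trans[OF abs_ge_zero C[of 0]] by simp
    have "norm (norm x ^ k * iter_deriv vs ?\<phi> x) \<le> C * exp ((norm a)\<^sup>2 / 2) * B" for x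
    proof -
      \<comment> \<open>Recentring the Gaussian at the origin costs half of its exponent and the
        constant factor exp (|a|^2 / 2).\<close>
      have n: "(norm x)\<^sup>2 / 4 - (norm a)\<^sup>2 / 2 \<le> (norm (x - a))\<^sup>2 / 2"
      proof -
        have "norm x \<le> norm (x - a) + norm a" using norm_triangle_ineq[of "x - a" a] by simp
        then have "(norm x)\<^sup>2 \<le> (norm (x - a) + norm a)\<^sup>2" by (intro power_mono) auto
        also have "\<dots> \<le> 2 * (norm (x - a))\<^sup>2 + 2 * (norm a)\<^sup>2"
          using sum_squares_bound[of "norm (x - a)" "norm a"] by (simp add: power2_sum)
        finally show ?thesis by simp
      qed
      have "norm (norm x ^ k * iter_deriv vs ?\<phi> x) = norm x ^ k * \<bar>P x\<bar> * ?\<phi> x"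
        unfolding P(2) by (simp add: abs_mult)
      also have "\<dots> \<le> (1 + norm x) ^ k * (C * (1 + norm x) ^ m) * exp ((norm a)\<^sup>2 / 2 - (norm x)\<^sup>2 / 4)"
        using n \<open>C \<ge> 0\<close> by (intro mult_mono power_mono C) auto
      also have "\<dots> = C * exp ((norm a)\<^sup>2 / 2) * ((1 + norm x) ^ (k + m) * exp (- (norm x)\<^sup>2 / 4))"
      proof -
        have "exp ((norm a)\<^sup>2 / 2 - (norm x)\<^sup>2 / 4) = exp ((norm a)\<^sup>2 / 2) * exp (- (norm x)\<^sup>2 / 4)"
          by (simp flip: exp_add)
        then show ?thesis by (simp only: power_add mult_ac)
      qed
      also have "\<dots> \<le> C * exp ((norm a)\<^sup>2 / 2) * B" using \<open>C \<ge> 0\<close> by (intro mult_left_mono B[rule_format]) auto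
      finally show ?thesis .
    qed
    then show "bounded (range (\<lambda>x. norm x ^ k * iter_deriv vs ?\<phi> x))" by (intro boundedI) auto
  qed
qed

text \<open>At time 1/2 the kernel is the standard normal density, which is its own Fourier
  transform up to a constant. This is why the test Gaussians have this width.\<close>

lemma gaussian_half:
  "heat_kernel (1/2) (z::'a::euclidean_space) = (2 * pi) powr (- real DIM('a) / 2) * exp (- (norm z)\<^sup>2 / 2)"
  by (simp add: heat_kernel_def)

lemma fourier_gaussian_shift:
  fixes a :: "'a::euclidean_space"
  shows "fourier (\<lambda>x. exp (- (norm (x - a))\<^sup>2 / 2)) \<xi> = cis (- (a \<bullet> \<xi>)) * of_real ((2 * pi) ^ DIM('a) * heat_kernel (1/2) \<xi>)"
proof -
  have "fourier (\<lambda>x. exp (- (norm (x - a))\<^sup>2 / 2)) \<xi> = (LINT x|lborel. of_real (exp (- (norm (a + x - a))\<^sup>2 / 2)) * cis (- ((a + x) \<bullet> \<xi>)))"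
    unfolding fourier_def by (rule lborel_translate(1)[symmetric]) measurable
  also have "\<dots> = (LINT x|lborel. cis (- (a \<bullet> \<xi>)) * (of_real (exp (- (1/2) * (norm x)\<^sup>2)) * cis (x \<bullet> (- \<xi>))))"
  proof -
    have "cis (- ((a + x) \<bullet> \<xi>)) = cis (- (a \<bullet> \<xi>)) * cis (x \<bullet> (- \<xi>))" for x
      by (simp add: inner_add_left cis_mult)
    then show ?thesis by (simp only: mult_ac) simp
  qed
  also have "\<dots> = cis (- (a \<bullet> \<xi>)) * of_real ((2 * pi) ^ DIM('a) * heat_kernel (1/2) \<xi>)"
    unfolding integral_mult_right_zero by (subst gauss_fourier(2)) auto
  finally show ?thesis .
qed

lemma gaussian_inversion:
  fixes z :: "'a::euclidean_space"
  shows "(LINT \<xi>|lborel. heat_kernel (1/2) \<xi> * cos (\<xi> \<bullet> z)) = exp (- (norm z)\<^sup>2 / 2)"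
proof -
  let ?c = "(2 * pi) powr (- real DIM('a) / 2)"
  have "(LINT \<xi>|lborel. heat_kernel (1/2) \<xi> * cos (\<xi> \<bullet> z)) = ?c * (LINT \<xi>|lborel. Re (of_real (exp (- (norm \<xi>)\<^sup>2 / 2)) * cis (\<xi> \<bullet> z)))"
    unfolding gaussian_half by (simp add: mult.assoc)
  also have "(LINT \<xi>|lborel. Re (of_real (exp (- (norm \<xi>)\<^sup>2 / 2)) * cis (\<xi> \<bullet> z))) = (2 * pi) ^ DIM('a) * heat_kernel (1/2) z"
    by (subst integral_Re) (use gauss_fourier[of "1/2" z] in auto)
  also have "?c * ((2 * pi) ^ DIM('a) * heat_kernel (1/2) z) = (?c * ?c * (2 * pi) ^ DIM('a)) * exp (- (norm z)\<^sup>2 / 2)"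
    unfolding gaussian_half by simp
  also have "?c * ?c * (2 * pi) ^ DIM('a) = 1"
  proof -
    have "?c * ?c = (2 * pi) powr (- real DIM('a))" by (simp flip: powr_add)
    also have "\<dots> = inverse ((2 * pi) ^ DIM('a))" by (subst powr_minus) (subst powr_realpow; simp)
    finally show ?thesis by (simp only:) (rule left_inverse, simp)
  qed
  finally show ?thesis by simp
qed

lemma symbol_le_square: "norm \<xi> powr (2 * s) \<le> 1 + (norm \<xi>)\<^sup>2" if "0 < s" "s < 1"
proof (cases "norm \<xi> \<le> 1")
  case True
  have "norm \<xi> powr (2 * s) \<le> 1 powr (2 * s)" using True that by (intro powr_mono2) auto
  then have "norm \<xi> powr (2 * s) \<le> 1" by simp
  then show ?thesis using zero_le_power2[of "norm \<xi>"] by linarith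
next
  case False
  then have "norm \<xi> powr (2 * s) \<le> norm \<xi> powr 2" using that by (intro powr_mono) auto
  then show ?thesis using False by (simp add: powr_numeral)
qed

text \<open>The weight is at most 2 + |\<xi>|^2, and x exp (- x) <= 1 with x = |\<xi>|^2 / 2 bounds
  the quadratic part by twice the maximum of the kernel; the constant 4 is 2 + 2.\<close>

lemma symbol_gaussian:
  assumes s: "0 < s" "s < 1"
  shows "integrable lborel (\<lambda>\<xi>::'a::euclidean_space. (1 + norm \<xi> powr (2 * s)) * heat_kernel (1/2) \<xi>)"
    and "(1 + norm (\<xi>::'a) powr (2 * s)) * heat_kernel (1/2) \<xi> \<le> 4 * heat_kernel (1/2) (0::'a)"
proof -
  obtain M where M: "\<And>t. t > 0 \<Longrightarrow> integrable lborel (\<lambda>z::'a. (norm z)\<^sup>2 * heat_kernel t z)"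
    using heat_kernel_second_moment by metis
  have le: "(1 + norm \<xi> powr (2 * s)) * heat_kernel (1/2) \<xi> \<le> 2 * heat_kernel (1/2) \<xi> + (norm \<xi>)\<^sup>2 * heat_kernel (1/2) \<xi>" for \<xi> :: 'a
    using mult_right_mono[OF symbol_le_square[OF s, of \<xi>] heat_kernel_nonneg[of "1/2" \<xi>]] by (simp add: algebra_simps)
  show "integrable lborel (\<lambda>\<xi>::'a. (1 + norm \<xi> powr (2 * s)) * heat_kernel (1/2) \<xi>)"
  proof (rule Bochner_Integration.integrable_bound)
    show "integrable lborel (\<lambda>\<xi>::'a. 2 * heat_kernel (1/2) \<xi> + (norm \<xi>)\<^sup>2 * heat_kernel (1/2) \<xi>)"
      using M[of "1/2"] heat_kernel_integral(1)[of "1/2", where 'a='a] by (intro Bochner_Integration.integrable_add) auto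
    show "AE \<xi> in lborel. norm ((1 + norm \<xi> powr (2 * s)) * heat_kernel (1/2) (\<xi>::'a)) \<le> norm (2 * heat_kernel (1/2) \<xi> + (norm \<xi>)\<^sup>2 * heat_kernel (1/2) \<xi>)"
      using le by (auto simp: heat_kernel_nonneg abs_mult intro: order_trans[OF _ abs_ge_self])
  qed measurable
  let ?c = "(2 * pi) powr (- real DIM('a) / 2)"
  have "(norm \<xi>)\<^sup>2 / 2 \<le> exp ((norm \<xi>)\<^sup>2 / 2)" using exp_ge_add_one_self[of "(norm \<xi>)\<^sup>2 / 2"] by linarith
  then have "(norm \<xi>)\<^sup>2 / 2 * exp (- (norm \<xi>)\<^sup>2 / 2) \<le> exp ((norm \<xi>)\<^sup>2 / 2) * exp (- (norm \<xi>)\<^sup>2 / 2)" by (intro mult_right_mono) auto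
  also have "\<dots> = 1" by (simp flip: exp_add)
  finally have "(norm \<xi>)\<^sup>2 * exp (- (norm \<xi>)\<^sup>2 / 2) \<le> 2" by simp
  from mult_left_mono[OF this, of ?c] have "(norm \<xi>)\<^sup>2 * heat_kernel (1/2) \<xi> \<le> 2 * heat_kernel (1/2) (0::'a)"
    unfolding gaussian_half by (simp add: mult_ac)
  then show "(1 + norm (\<xi>::'a) powr (2 * s)) * heat_kernel (1/2) \<xi> \<le> 4 * heat_kernel (1/2) (0::'a)"
    using le[of \<xi>] heat_kernel_le[of "1/2" \<xi>] by simp
qed

lemma frac_laplacian_gaussian:
  fixes a x :: "'a::euclidean_space"
  assumes s: "0 < s" "s < 1"
  shows "frac_laplacian s (\<lambda>x. exp (- (norm (x - a))\<^sup>2 / 2)) x + exp (- (norm (x - a))\<^sup>2 / 2)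
     = (LINT \<xi>|lborel. (1 + norm \<xi> powr (2 * s)) * heat_kernel (1/2) \<xi> * cos (\<xi> \<bullet> (x - a)))"
proof -
  let ?G = "heat_kernel (1/2) :: 'a \<Rightarrow> real"
  have i1: "integrable lborel (\<lambda>\<xi>. (1 + norm \<xi> powr (2 * s)) * ?G \<xi> * cos (\<xi> \<bullet> (x - a)))"
    by (rule Bochner_Integration.integrable_bound[OF symbol_gaussian(1)[OF s]]) (auto simp: abs_mult heat_kernel_nonneg intro!: mult_left_le)
  have i0: "integrable lborel (\<lambda>\<xi>. ?G \<xi> * cos (\<xi> \<bullet> (x - a)))"
    by (rule Bochner_Integration.integrable_bound[OF heat_kernel_integral(1)[of "1/2"]]) (auto simp: abs_mult heat_kernel_nonneg intro!: mult_left_le)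
  have ic: "integrable lborel (\<lambda>\<xi>. complex_of_real (norm \<xi> powr (2 * s) * ?G \<xi>) * cis (\<xi> \<bullet> (x - a)))"
    by (rule Bochner_Integration.integrable_bound[OF symbol_gaussian(1)[OF s]]) (auto simp: norm_mult abs_mult heat_kernel_nonneg intro!: mult_right_mono)
  have e: "of_real (norm \<xi> powr (2 * s)) * fourier (\<lambda>x. exp (- (norm (x - a))\<^sup>2 / 2)) \<xi> * cis (x \<bullet> \<xi>)
      = of_real ((2 * pi) ^ DIM('a)) * (complex_of_real (norm \<xi> powr (2 * s) * ?G \<xi>) * cis (\<xi> \<bullet> (x - a)))" for \<xi>
    unfolding fourier_gaussian_shift by (simp add: inner_diff_right inner_commute cis_mult mult_ac flip: cis_mult)
       (simp add: cis_mult)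
  have "frac_laplacian s (\<lambda>x. exp (- (norm (x - a))\<^sup>2 / 2)) x = Re (LINT \<xi>|lborel. complex_of_real (norm \<xi> powr (2 * s) * ?G \<xi>) * cis (\<xi> \<bullet> (x - a)))"
    unfolding frac_laplacian_def e integral_mult_right_zero by (simp del: of_real_power of_real_mult)
  also have "\<dots> = (LINT \<xi>|lborel. norm \<xi> powr (2 * s) * ?G \<xi> * cos (\<xi> \<bullet> (x - a)))"
    by (subst integral_Re[OF ic, symmetric]) simp
  also have "\<dots> = (LINT \<xi>|lborel. (1 + norm \<xi> powr (2 * s)) * ?G \<xi> * cos (\<xi> \<bullet> (x - a)) - ?G \<xi> * cos (\<xi> \<bullet> (x - a)))"
    by (simp add: algebra_simps)
  also have "\<dots> = (LINT \<xi>|lborel. (1 + norm \<xi> powr (2 * s)) * ?G \<xi> * cos (\<xi> \<bullet> (x - a))) - exp (- (norm (x - a))\<^sup>2 / 2)"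
    by (simp only: Bochner_Integration.integral_diff[OF i1 i0] gaussian_inversion)
  finally show ?thesis by simp
qed

section \<open>The equation of the fundamental solution on the Fourier side\<close>

text \<open>Reflecting the variable of integration identifies the transform with its
  conjugate.\<close>

lemma even_fourier_real:
  fixes g :: "'a::euclidean_space \<Rightarrow> real"
  assumes g: "integrable lborel g" and even: "\<And>x. g (- x) = g x"
  shows "fourier g \<xi> = of_real (Re (fourier g \<xi>))" "fourier g (- \<xi>) = fourier g \<xi>"
    "Re (fourier g \<xi>) = (LINT x|lborel. g x * cos (x \<bullet> \<xi>))"
proof -
  have [measurable]: "g \<in> borel_measurable borel" using g by auto
  have "(LINT x|lborel. of_real (g (0 - x)) * cis (- ((0 - x) \<bullet> \<xi>))) = fourier g \<xi>"
    unfolding fourier_def by (rule lborel_reflect(1)) measurable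
  then have c: "fourier g \<xi> = cnj (fourier g \<xi>)" unfolding cnj_fourier by (simp add: even)
  then have "Im (fourier g \<xi>) = 0" by (metis cnj.simps(2) equal_neg_zero)
  then show "fourier g \<xi> = of_real (Re (fourier g \<xi>))" by (simp add: complex_eq_iff)
  have "fourier g (- \<xi>) = cnj (fourier g \<xi>)" unfolding cnj_fourier by (simp add: fourier_def)
  then show "fourier g (- \<xi>) = fourier g \<xi>" using c by simp
  show "Re (fourier g \<xi>) = (LINT x|lborel. g x * cos (x \<bullet> \<xi>))"
    unfolding fourier_def by (subst integral_Re[OF fourier_integrand[OF g], symmetric]) simp
qed

text \<open>Tested against all translates of a Gaussian \<open>G\<close>, the equation says that
  \<open>G ((1 + \<bar>\<xi>\<bar>\<^sup>2\<^sup>s) \<Gamma>\<^sup>^ - 1)\<close> has vanishing Fourier transform.\<close>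

lemma fourier_fundamental_solution:
  fixes \<Gamma> :: "'a::euclidean_space \<Rightarrow> real"
  assumes s: "0 < s" "s < 1" and fs: "decaying_fundamental_solution s \<Gamma>" and even: "\<And>x. \<Gamma> (- x) = \<Gamma> x"
  shows "AE \<xi> in lborel. (1 + norm \<xi> powr (2 * s)) * Re (fourier \<Gamma> \<xi>) = 1"
proof -
  have I: "integrable lborel \<Gamma>" using fs by (simp add: decaying_fundamental_solution_def)
  have [measurable]: "\<Gamma> \<in> borel_measurable borel" using I by auto
  have [measurable]: "fourier \<Gamma> \<in> borel_measurable borel" using I by (rule fourier_measurable)
  let ?G = "heat_kernel (1/2) :: 'a \<Rightarrow> real"
  let ?W = "\<lambda>\<xi>::'a. (1 + norm \<xi> powr (2 * s)) * ?G \<xi>"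
  define F where "F \<xi> = Re (fourier \<Gamma> \<xi>)" for \<xi>
  note er = even_fourier_real[OF I even]
  have [measurable]: "F \<in> borel_measurable borel" unfolding F_def by measurable
  define N where "N = (LINT x|lborel. \<bar>\<Gamma> x\<bar>)"
  have FN: "\<bar>F \<xi>\<bar> \<le> N" for \<xi> unfolding F_def N_def by (rule order_trans[OF abs_Re_le_cmod fourier_bound[OF I]])
  have N0: "N \<ge> 0" using FN[of 0] by linarith
  \<comment> \<open>The defect of the equation, damped by the Gaussian. It is integrable and
    bounded, hence in \<open>L12\<close>, so Plancherel forces it to vanish once its transform
    does.\<close>
  define q where "q \<xi> = ?W \<xi> * F \<xi> - ?G \<xi>" for \<xi>
  have [measurable]: "q \<in> borel_measurable borel" unfolding q_def by measurable
  note W = symbol_gaussian[OF s, where 'a='a]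
  have W0: "?W \<xi> \<ge> 0" for \<xi> by (simp add: heat_kernel_nonneg)
  have WF: "integrable lborel (\<lambda>\<xi>. ?W \<xi> * F \<xi>)"
  proof (rule Bochner_Integration.integrable_bound[OF integrable_mult_left[OF W(1), of N]])
    show "AE \<xi> in lborel. norm (?W \<xi> * F \<xi>) \<le> norm (?W \<xi> * N)"
    proof -
      have "\<bar>?W \<xi> * F \<xi>\<bar> \<le> ?W \<xi> * N" for \<xi>
        unfolding abs_mult[of "?W \<xi>"] abs_of_nonneg[OF W0] by (intro mult_left_mono FN W0)
      then show ?thesis unfolding real_norm_def by (intro AE_I2 order_trans[OF _ abs_ge_self])
    qed
  qed measurable
  have G1: "integrable lborel ?G" by (rule heat_kernel_integral) simp
  have q1: "integrable lborel q" unfolding q_def using WF G1 by simp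
  have qb: "\<bar>q \<xi>\<bar> \<le> 4 * ?G 0 * N + ?G 0" for \<xi>
  proof -
    have "\<bar>?W \<xi> * F \<xi>\<bar> \<le> (4 * ?G 0) * N"
      unfolding abs_mult[of "?W \<xi>"] abs_of_nonneg[OF W0] by (intro mult_mono W FN) (auto simp: heat_kernel_nonneg)
    moreover have "\<bar>?G \<xi>\<bar> \<le> ?G 0" using heat_kernel_le[of "1/2" \<xi>] heat_kernel_nonneg[of "1/2" \<xi>] by simp
    ultimately show ?thesis unfolding q_def by linarith
  qed
  have qL: "L12 q"
    unfolding L12_def
  proof (intro conjI q1)
    show "integrable lborel (\<lambda>x. (q x)\<^sup>2)"
    proof (rule Bochner_Integration.integrable_bound[OF integrable_mult_right[OF q1, of "4 * ?G 0 * N + ?G 0"]])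
      show "AE x in lborel. norm ((q x)\<^sup>2) \<le> norm ((4 * ?G 0 * N + ?G 0) * q x)"
        unfolding power2_eq_square real_norm_def abs_mult
        by (intro AE_I2 mult_right_mono order_trans[OF qb abs_ge_self] abs_ge_zero)
    qed measurable
  qed
  have qeven: "q (- \<xi>) = q \<xi>" for \<xi> by (simp add: q_def F_def er(2) heat_kernel_minus)
  have "fourier q a = 0" for a
  proof -
    let ?\<phi> = "\<lambda>x. exp (- (norm (x - a))\<^sup>2 / 2)"
    have k: "(LINT x|lborel. \<Gamma> x * cos (\<xi> \<bullet> (x - a))) = cos (\<xi> \<bullet> a) * F \<xi>" for \<xi>
    proof -
      have ic: "integrable lborel (\<lambda>x. cis (\<xi> \<bullet> a) * (of_real (\<Gamma> x) * cis (- (x \<bullet> \<xi>))))"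
        by (intro integrable_mult_right fourier_integrand I)
      have "\<Gamma> x * cos (\<xi> \<bullet> (x - a)) = Re (cis (\<xi> \<bullet> a) * (of_real (\<Gamma> x) * cis (- (x \<bullet> \<xi>))))" for x
        by (simp add: inner_diff_right cos_diff inner_commute algebra_simps)
      then have "(LINT x|lborel. \<Gamma> x * cos (\<xi> \<bullet> (x - a))) = Re (cis (\<xi> \<bullet> a) * fourier \<Gamma> \<xi>)"
        unfolding fourier_def integral_mult_right_zero[symmetric] by (simp only: integral_Re[OF ic])
      also have "fourier \<Gamma> \<xi> = of_real (F \<xi>)" unfolding F_def by (rule er(1))
      also have "Re (cis (\<xi> \<bullet> a) * of_real (F \<xi>)) = cos (\<xi> \<bullet> a) * F \<xi>" by simp
      finally show ?thesis .
    qed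
    \<comment> \<open>The value at 0 of the Gaussian centred at \<open>a\<close> is computed twice,
      from the equation of \<Gamma> and from Fourier inversion. The difference of the results is the
      transform of \<open>q\<close> at \<open>a\<close>.\<close>
    have "?\<phi> 0 = (LINT x|lborel. \<Gamma> x * (frac_laplacian s ?\<phi> x + ?\<phi> x))"
      using fs schwartz_gaussian[of a] unfolding decaying_fundamental_solution_def by simp
    also have "\<dots> = (LINT x|lborel. \<Gamma> x * (LINT \<xi>|lborel. ?W \<xi> * cos (\<xi> \<bullet> (x - a))))"
      unfolding frac_laplacian_gaussian[OF s] ..
    also have "\<dots> = (LINT \<xi>|lborel. ?W \<xi> * (LINT x|lborel. \<Gamma> x * cos (\<xi> \<bullet> (x - a))))"
      by (rule fubini_prod_bounded[OF I W(1), where C=1]) auto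
    also have "\<dots> = (LINT \<xi>|lborel. ?W \<xi> * F \<xi> * cos (\<xi> \<bullet> a))" unfolding k by (simp add: mult_ac)
    finally have 1: "?\<phi> 0 = (LINT \<xi>|lborel. ?W \<xi> * F \<xi> * cos (\<xi> \<bullet> a))" .
    have 2: "?\<phi> 0 = (LINT \<xi>|lborel. ?G \<xi> * cos (\<xi> \<bullet> a))" unfolding gaussian_inversion by simp
    have i1: "integrable lborel (\<lambda>\<xi>. ?W \<xi> * F \<xi> * cos (\<xi> \<bullet> a))"
      by (rule Bochner_Integration.integrable_bound[OF WF]) (auto simp: abs_mult intro!: mult_left_le)
    have i2: "integrable lborel (\<lambda>\<xi>. ?G \<xi> * cos (\<xi> \<bullet> a))"
      by (rule Bochner_Integration.integrable_bound[OF G1]) (auto simp: abs_mult intro!: mult_left_le)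
    have "(LINT \<xi>|lborel. q \<xi> * cos (\<xi> \<bullet> a)) = 0"
      unfolding q_def left_diff_distrib using 1 2 by (simp only: Bochner_Integration.integral_diff[OF i1 i2])
    then show ?thesis using even_fourier_real[OF q1 qeven, of a] by simp
  qed
  then have "(LINT x|lborel. (q x)\<^sup>2) = 0" using plancherel_norm(2)[OF qL] by simp
  then have "AE x in lborel. (q x)\<^sup>2 = 0" using L12D(2)[OF qL] by (subst (asm) integral_nonneg_eq_0_iff_AE) auto
  then show ?thesis
  proof eventually_elim
    fix \<xi> assume "(q \<xi>)\<^sup>2 = 0"
    then have "?G \<xi> * ((1 + norm \<xi> powr (2 * s)) * F \<xi>) = ?G \<xi> * 1" by (simp add: q_def mult_ac)
    then show "(1 + norm \<xi> powr (2 * s)) * Re (fourier \<Gamma> \<xi>) = 1"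
      unfolding F_def using heat_kernel_pos[of "1/2" \<xi>] by (metis half_gt_zero less_irrefl mult_left_cancel zero_less_one)
  qed
qed

subsection \<open>Potentials of the fundamental solution\<close>

text \<open>The argument is \<open>x - y\<close>, with \<open>x\<close> the integration variable, so
  that the value at \<open>y\<close> is directly the integral of \<open>\<mu>\<close> against the
  exterior datum of the regular part at \<open>y\<close>.\<close>

definition potential :: "('a::euclidean_space \<Rightarrow> real) \<Rightarrow> ('a \<Rightarrow> real) \<Rightarrow> 'a \<Rightarrow> real" where
  "potential \<Gamma> \<mu> y = (LINT x|lborel. \<mu> x * \<Gamma> (x - y))"

lemma potential_measurable [measurable (raw)]:
  assumes [measurable]: "\<Gamma> \<in> borel_measurable borel" "\<mu> \<in> borel_measurable borel"
  shows "potential \<Gamma> \<mu> \<in> borel_measurable borel"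
  unfolding potential_def[abs_def] by measurable

text \<open>The translates of \<Gamma> are probability densities, so by Cauchy-Schwarz the square of
  an average of \<open>\<mu>\<close> is at most the average of its square, and the latter is
  integrable in \<open>y\<close> by Fubini.\<close>

lemma potential_L12:
  fixes \<Gamma> :: "'a::euclidean_space \<Rightarrow> real"
  assumes G: "integrable lborel \<Gamma>" and pos: "\<And>x. x \<noteq> 0 \<Longrightarrow> \<Gamma> x \<ge> 0" and G1: "(LINT x|lborel. \<Gamma> x) = 1" and \<mu>: "L12 \<mu>"
  shows "AE y in lborel. integrable lborel (\<lambda>x. \<mu> x * \<Gamma> (x - y))" and "L12 (potential \<Gamma> \<mu>)"
proof -
  note M = L12D[OF \<mu>]
  have [measurable]: "\<Gamma> \<in> borel_measurable borel" "\<mu> \<in> borel_measurable borel" using G M by auto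
  note c1 = convolution_integrable(1)[OF M(1) G] and c2 = convolution_integrable(1)[OF M(2) G]
  note a1 = lborel_pair.AE_integrable_snd[OF c1] and a2 = lborel_pair.AE_integrable_snd[OF c2]
  show "AE y in lborel. integrable lborel (\<lambda>x. \<mu> x * \<Gamma> (x - y))" by (rule a1)
  have "integrable lborel (potential \<Gamma> \<mu>)" unfolding potential_def[abs_def] by (rule lborel_pair.integrable_snd[OF c1])
  moreover have "integrable lborel (\<lambda>y. (potential \<Gamma> \<mu> y)\<^sup>2)"
  proof (rule Bochner_Integration.integrable_bound[OF lborel_pair.integrable_snd[OF c2]])
    show "AE y in lborel. norm ((potential \<Gamma> \<mu> y)\<^sup>2) \<le> norm (LINT x|lborel. (\<mu> x)\<^sup>2 * \<Gamma> (x - y))"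
      using a1 a2
    proof eventually_elim
      fix y
      assume i1: "integrable lborel (\<lambda>x. \<mu> x * \<Gamma> (x - y))" and i2: "integrable lborel (\<lambda>x. (\<mu> x)\<^sup>2 * \<Gamma> (x - y))"
      have i0: "integrable lborel (\<lambda>x. \<Gamma> (x - y))" and e0: "(LINT x|lborel. \<Gamma> (x - y)) = 1"
        using lborel_translate[of \<Gamma> "- y"] G G1 by simp_all
      have "(potential \<Gamma> \<mu> y)\<^sup>2 \<le> (LINT x|lborel. (\<mu> x)\<^sup>2 * \<Gamma> (x - y)) * 1"
        unfolding potential_def
      proof (rule quadratic_bound)
        fix t :: real
        \<comment> \<open>Nothing is known about the sign of \<open>\<Gamma> 0\<close>; the
          exceptional point x = y is a null set.\<close>
        have "AE x in lborel. (\<mu> x - t)\<^sup>2 * \<Gamma> (x - y) \<ge> 0"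
          using AE_lborel_singleton[of y] by eventually_elim (simp add: pos)
        then have "0 \<le> (LINT x|lborel. (\<mu> x - t)\<^sup>2 * \<Gamma> (x - y))" by (rule integral_nonneg_AE)
        also have "(\<lambda>x. (\<mu> x - t)\<^sup>2 * \<Gamma> (x - y)) = (\<lambda>x. (\<mu> x)\<^sup>2 * \<Gamma> (x - y) - 2 * t * (\<mu> x * \<Gamma> (x - y)) + t\<^sup>2 * \<Gamma> (x - y))"
          by (auto simp: power2_eq_square algebra_simps)
        also have "(LINT x|lborel. (\<mu> x)\<^sup>2 * \<Gamma> (x - y) - 2 * t * (\<mu> x * \<Gamma> (x - y)) + t\<^sup>2 * \<Gamma> (x - y))
          = (LINT x|lborel. (\<mu> x)\<^sup>2 * \<Gamma> (x - y)) - 2 * t * (LINT x|lborel. \<mu> x * \<Gamma> (x - y)) + t\<^sup>2 * 1"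
          using i0 i1 i2 e0 by simp
        finally show "0 \<le> (LINT x|lborel. (\<mu> x)\<^sup>2 * \<Gamma> (x - y)) - 2 * t * (LINT x|lborel. \<mu> x * \<Gamma> (x - y)) + t\<^sup>2 * 1" .
      qed simp
      then show "norm ((potential \<Gamma> \<mu> y)\<^sup>2) \<le> norm (LINT x|lborel. (\<mu> x)\<^sup>2 * \<Gamma> (x - y))" by simp
    qed
  qed measurable
  ultimately show "L12 (potential \<Gamma> \<mu>)" by (simp add: L12_def)
qed

text \<open>The convolution theorem. The conjugate appears because \<open>potential\<close>
  integrates against the reflected kernel.\<close>

lemma fourier_potential:
  fixes \<Gamma> :: "'a::euclidean_space \<Rightarrow> real"
  assumes G: "integrable lborel \<Gamma>" and \<mu>: "integrable lborel \<mu>"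
  shows "fourier (potential \<Gamma> \<mu>) \<xi> = fourier \<mu> \<xi> * cnj (fourier \<Gamma> \<xi>)"
proof -
  have [measurable]: "\<Gamma> \<in> borel_measurable borel" "\<mu> \<in> borel_measurable borel" using G \<mu> by auto
  note c1 = convolution_integrable(1)[OF \<mu> G]
  have ic: "integrable (lborel \<Otimes>\<^sub>M lborel) (\<lambda>(x,y). complex_of_real (\<mu> x * \<Gamma> (x - y)) * cis (- (y \<bullet> \<xi>)))"
    by (rule Bochner_Integration.integrable_bound[OF c1]) (auto simp: norm_mult)
  have "fourier (potential \<Gamma> \<mu>) \<xi> = (LINT y|lborel. LINT x|lborel. complex_of_real (\<mu> x * \<Gamma> (x - y)) * cis (- (y \<bullet> \<xi>)))"
    unfolding fourier_def potential_def by (simp flip: integral_complex_of_real)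
  also have "\<dots> = (LINT x|lborel. LINT y|lborel. complex_of_real (\<mu> x * \<Gamma> (x - y)) * cis (- (y \<bullet> \<xi>)))"
    by (rule lborel_pair.Fubini_integral[OF ic])
  also have "\<dots> = (LINT x|lborel. of_real (\<mu> x) * cis (- (x \<bullet> \<xi>)) * (LINT y|lborel. of_real (\<Gamma> (x - y)) * cis ((x - y) \<bullet> \<xi>)))"
  proof -
    have "complex_of_real (\<mu> x * \<Gamma> (x - y)) * cis (- (y \<bullet> \<xi>)) = of_real (\<mu> x) * cis (- (x \<bullet> \<xi>)) * (of_real (\<Gamma> (x - y)) * cis ((x - y) \<bullet> \<xi>))" for x y
    proof -
      have "cis (- (y \<bullet> \<xi>)) = cis (- (x \<bullet> \<xi>)) * cis ((x - y) \<bullet> \<xi>)" by (simp add: cis_mult inner_diff_left)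
      then show ?thesis by (simp only: of_real_mult mult_ac)
    qed
    then show ?thesis by (simp only: integral_mult_right_zero)
  qed
  also have "\<dots> = (LINT x|lborel. of_real (\<mu> x) * cis (- (x \<bullet> \<xi>)) * cnj (fourier \<Gamma> \<xi>))"
    unfolding cnj_fourier by (subst lborel_reflect(1)) auto
  finally show ?thesis by (simp add: fourier_def)
qed

text \<open>The weight of the energy times the transform of the potential is the transform of
  \<open>\<mu>\<close>. One factor of the weight thus cancels: the energy is controlled by the L2
  norm of \<open>\<mu>\<close>, and the energy product becomes an L2 product by Plancherel.\<close>

lemma potential_sobolev:
  fixes \<Gamma> :: "'a::euclidean_space \<Rightarrow> real"
  assumes s: "0 < s" "s < 1" and fs: "decaying_fundamental_solution s \<Gamma>" and even: "\<And>x. \<Gamma> (- x) = \<Gamma> x"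
    and pos: "\<And>x. x \<noteq> 0 \<Longrightarrow> \<Gamma> x \<ge> 0" and G1: "(LINT x|lborel. \<Gamma> x) = 1" and \<mu>: "L12 \<mu>"
  shows "sobolev s (potential \<Gamma> \<mu>)"
    and "sobolev s \<phi> \<Longrightarrow> hs_inner s (potential \<Gamma> \<mu>) \<phi> = (LINT x|lborel. \<mu> x * \<phi> x)"
proof -
  have I: "integrable lborel \<Gamma>" using fs by (simp add: decaying_fundamental_solution_def)
  note M = L12D[OF \<mu>]
  have PL: "L12 (potential \<Gamma> \<mu>)" by (rule potential_L12(2)[OF I _ G1 \<mu>]) (rule pos)
  have [measurable]: "fourier \<Gamma> \<in> borel_measurable borel" "fourier \<mu> \<in> borel_measurable borel" "fourier (potential \<Gamma> \<mu>) \<in> borel_measurable borel"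
    using I M L12D[OF PL] by (auto intro: fourier_measurable)
  have fp: "AE \<xi> in lborel. (1 + norm \<xi> powr (2 * s)) * fourier (potential \<Gamma> \<mu>) \<xi> = fourier \<mu> \<xi>"
    using fourier_fundamental_solution[OF s fs even]
  proof eventually_elim
    fix \<xi> :: 'a assume "(1 + norm \<xi> powr (2 * s)) * Re (fourier \<Gamma> \<xi>) = 1"
    then have "complex_of_real ((1 + norm \<xi> powr (2 * s)) * Re (fourier \<Gamma> \<xi>)) = 1" by simp
    then have "complex_of_real (1 + norm \<xi> powr (2 * s)) * fourier \<Gamma> \<xi> = 1"
      using even_fourier_real(1)[OF I even, of \<xi>] by (metis of_real_mult)
    moreover have "cnj (fourier \<Gamma> \<xi>) = fourier \<Gamma> \<xi>" by (subst (1 2) even_fourier_real(1)[OF I even]) simp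
    ultimately show "(1 + norm \<xi> powr (2 * s)) * fourier (potential \<Gamma> \<mu>) \<xi> = fourier \<mu> \<xi>"
      unfolding fourier_potential[OF I M(1)] by (metis mult.commute mult.left_commute mult_1)
  qed
  show S: "sobolev s (potential \<Gamma> \<mu>)"
    unfolding sobolev_weighted[OF PL]
  proof (rule Bochner_Integration.integrable_bound[OF plancherel_norm(1)[OF \<mu>]])
    show "AE \<xi> in lborel. norm ((1 + norm \<xi> powr (2 * s)) * (cmod (fourier (potential \<Gamma> \<mu>) \<xi>))\<^sup>2) \<le> norm ((cmod (fourier \<mu> \<xi>))\<^sup>2)"
      using fp
    proof eventually_elim
      fix \<xi> :: 'a assume e: "(1 + norm \<xi> powr (2 * s)) * fourier (potential \<Gamma> \<mu>) \<xi> = fourier \<mu> \<xi>"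
      let ?a = "1 + norm \<xi> powr (2 * s)"
      have a: "?a \<ge> 1" by simp
      then have "?a \<le> ?a\<^sup>2" by (rule self_le_power) simp
      then have "?a * (cmod (fourier (potential \<Gamma> \<mu>) \<xi>))\<^sup>2 \<le> ?a\<^sup>2 * (cmod (fourier (potential \<Gamma> \<mu>) \<xi>))\<^sup>2" by (intro mult_right_mono) auto
      also have "\<dots> = (cmod (of_real ?a * fourier (potential \<Gamma> \<mu>) \<xi>))\<^sup>2"
        unfolding norm_mult norm_of_real power_mult_distrib power2_abs ..
      also have "\<dots> = (cmod (fourier \<mu> \<xi>))\<^sup>2" unfolding e[symmetric] by simp
      finally show "norm (?a * (cmod (fourier (potential \<Gamma> \<mu>) \<xi>))\<^sup>2) \<le> norm ((cmod (fourier \<mu> \<xi>))\<^sup>2)" using a by (simp add: abs_mult)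
    qed
  qed measurable
  assume \<phi>: "sobolev s \<phi>"
  note \<phi>12 = sobolev_L12[OF \<phi>]
  have [measurable]: "fourier \<phi> \<in> borel_measurable borel" using L12D[OF \<phi>12] by (auto intro: fourier_measurable)
  have "(LINT \<xi>|lborel. (1 + norm \<xi> powr (2 * s)) * Re (fourier (potential \<Gamma> \<mu>) \<xi> * cnj (fourier \<phi> \<xi>))) = (LINT \<xi>|lborel. Re (fourier \<mu> \<xi> * cnj (fourier \<phi> \<xi>)))"
  proof (rule integral_cong_AE)
    show "AE \<xi> in lborel. (1 + norm \<xi> powr (2 * s)) * Re (fourier (potential \<Gamma> \<mu>) \<xi> * cnj (fourier \<phi> \<xi>)) = Re (fourier \<mu> \<xi> * cnj (fourier \<phi> \<xi>))"
      using fp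
    proof eventually_elim
      fix \<xi> :: 'a assume e: "(1 + norm \<xi> powr (2 * s)) * fourier (potential \<Gamma> \<mu>) \<xi> = fourier \<mu> \<xi>"
      have "(1 + norm \<xi> powr (2 * s)) * Re (fourier (potential \<Gamma> \<mu>) \<xi> * cnj (fourier \<phi> \<xi>)) = Re (of_real (1 + norm \<xi> powr (2 * s)) * (fourier (potential \<Gamma> \<mu>) \<xi> * cnj (fourier \<phi> \<xi>)))"
        by (simp only: Re_complex_of_real Im_complex_of_real times_complex.simps)
      also have "\<dots> = Re (((1 + norm \<xi> powr (2 * s)) * fourier (potential \<Gamma> \<mu>) \<xi>) * cnj (fourier \<phi> \<xi>))"
        by (simp only: of_real_add of_real_1 mult.assoc)
      finally show "(1 + norm \<xi> powr (2 * s)) * Re (fourier (potential \<Gamma> \<mu>) \<xi> * cnj (fourier \<phi> \<xi>)) = Re (fourier \<mu> \<xi> * cnj (fourier \<phi> \<xi>))"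
        unfolding e .
    qed
  qed measurable
  then show "hs_inner s (potential \<Gamma> \<mu>) \<phi> = (LINT x|lborel. \<mu> x * \<phi> x)"
    unfolding hs_inner_def plancherel(2)[OF \<mu> \<phi>12] by simp
qed

subsection \<open>Cutting off a solution\<close>

lemma heat_kernel_joint_measurable [measurable]:
  "(\<lambda>(t, z::'a::euclidean_space). heat_kernel t z) \<in> borel_measurable (borel \<Otimes>\<^sub>M borel)"
  unfolding heat_kernel_def by measurable

lemma heat_energy_measurable:
  fixes u v :: "'a::euclidean_space \<Rightarrow> real"
  assumes [measurable]: "u \<in> borel_measurable borel" "v \<in> borel_measurable borel"
  shows "(\<lambda>t. heat_energy t u v) \<in> borel_measurable borel"
proof -
  have "(\<lambda>t. LINT p|(lborel \<Otimes>\<^sub>M lborel). u (fst p) * v (snd p) * (\<lambda>(t, z). heat_kernel t z) (t, fst p - snd p)) \<in> borel_measurable borel"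
    by measurable
  then show ?thesis unfolding heat_energy_def heat_form_def by (simp add: split_beta')
qed

definition lipschitz_cutoff :: "real \<Rightarrow> ('a::euclidean_space \<Rightarrow> real) \<Rightarrow> bool" where
  "lipschitz_cutoff L \<eta> \<longleftrightarrow> L > 0 \<and> \<eta> \<in> borel_measurable borel \<and> (\<forall>x. 0 \<le> \<eta> x \<and> \<eta> x \<le> 1) \<and>
     (\<forall>x y. \<bar>\<eta> x - \<eta> y\<bar> \<le> L * norm (x - y))"

text \<open>The bound 1 for the squared difference uses the mass of the kernel, the Lipschitz bound
  uses its second moment. The constant is one more than that of the second moment, so as to be
  strictly positive.\<close>

lemma lipschitz_heat_bound:
  "\<exists>M>0. \<forall>(\<eta> :: 'a::euclidean_space \<Rightarrow> real) L t x. lipschitz_cutoff L \<eta> \<longrightarrow> t > 0 \<longrightarrow>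
     (LINT y|lborel. (\<eta> x - \<eta> y)\<^sup>2 * heat_kernel t (x - y)) \<le> min 1 (L\<^sup>2 * M * t)"
proof -
  obtain M where M: "\<And>t. t > 0 \<Longrightarrow> integrable lborel (\<lambda>z::'a. (norm z)\<^sup>2 * heat_kernel t z)"
    "\<And>t. t > 0 \<Longrightarrow> (LINT z|lborel. (norm (z::'a))\<^sup>2 * heat_kernel t z) = M * t"
    using heat_kernel_second_moment by metis
  have "0 \<le> (LINT z|lborel. (norm (z::'a))\<^sup>2 * heat_kernel 1 z)" by (intro integral_nonneg_AE) (simp add: heat_kernel_nonneg)
  then have M0: "M \<ge> 0" using M(2)[of 1] by simp
  have "(LINT y|lborel. (\<eta> x - \<eta> y)\<^sup>2 * heat_kernel t (x - y)) \<le> min 1 (L\<^sup>2 * (M + 1) * t)"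
    if [measurable]: "\<eta> \<in> borel_measurable borel" and b: "\<And>x. 0 \<le> \<eta> x \<and> \<eta> x \<le> 1" and l: "\<And>x y. \<bar>\<eta> x - \<eta> y\<bar> \<le> L * norm (x - y)" and t: "t > 0"
    for \<eta> :: "'a \<Rightarrow> real" and L t x
  proof -
    have h: "integrable lborel (\<lambda>y. heat_kernel t (x - y))" "(LINT y|lborel. heat_kernel t (x - y)) = 1"
      using lborel_reflect[of "heat_kernel t" x] heat_kernel_integral[OF t, where 'a='a] by auto
    have h2: "integrable lborel (\<lambda>y. (norm (x - y))\<^sup>2 * heat_kernel t (x - y))" "(LINT y|lborel. (norm (x - y))\<^sup>2 * heat_kernel t (x - y)) = M * t"
      using lborel_reflect[of "\<lambda>z. (norm z)\<^sup>2 * heat_kernel t z" x] M[OF t] by auto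
    have c1: "(\<eta> x - \<eta> y)\<^sup>2 \<le> 1" for y using b[of x] b[of y] by (simp add: abs_square_le_1 abs_le_iff)
    have c2: "(\<eta> x - \<eta> y)\<^sup>2 \<le> L\<^sup>2 * (norm (x - y))\<^sup>2" for y
      using power_mono[OF l[of x y], of 2] by (simp add: power_mult_distrib)
    have le1: "(\<eta> x - \<eta> y)\<^sup>2 * heat_kernel t (x - y) \<le> heat_kernel t (x - y)" for y
      using mult_right_mono[OF c1 heat_kernel_nonneg[of t "x - y"]] by simp
    have le2: "(\<eta> x - \<eta> y)\<^sup>2 * heat_kernel t (x - y) \<le> L\<^sup>2 * ((norm (x - y))\<^sup>2 * heat_kernel t (x - y))" for y
      using mult_right_mono[OF c2 heat_kernel_nonneg[of t "x - y"]] by (simp add: mult.assoc)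
    have i: "integrable lborel (\<lambda>y. (\<eta> x - \<eta> y)\<^sup>2 * heat_kernel t (x - y))"
      by (rule Bochner_Integration.integrable_bound[OF h(1)]) (use le1 in \<open>auto simp: heat_kernel_nonneg abs_mult\<close>)
    have "(LINT y|lborel. (\<eta> x - \<eta> y)\<^sup>2 * heat_kernel t (x - y)) \<le> 1"
      using integral_mono[OF i h(1) le1] h(2) by simp
    moreover have "(LINT y|lborel. (\<eta> x - \<eta> y)\<^sup>2 * heat_kernel t (x - y)) \<le> L\<^sup>2 * (M * t)"
      using integral_mono[OF i integrable_mult_right[OF h2(1)] le2] h2(2) by simp
    moreover have "L\<^sup>2 * (M * t) \<le> L\<^sup>2 * (M + 1) * t" using t by (simp add: algebra_simps)
    ultimately show "(LINT y|lborel. (\<eta> x - \<eta> y)\<^sup>2 * heat_kernel t (x - y)) \<le> min 1 (L\<^sup>2 * (M + 1) * t)" by simp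
  qed
  then show ?thesis using M0 unfolding lipschitz_cutoff_def by (intro exI[of _ "M + 1"] conjI allI impI) (simp, blast)
qed

text \<open>With c proportional to L^2 the factor c^s is the price L^(2s) of a cutoff.\<close>

lemma frac_weight_min:
  assumes s: "0 < s" "s < 1" and c: "c > 0"
  shows "integrable lborel (\<lambda>t. frac_weight s t * min 1 (c * t))"
    and "(LINT t|lborel. frac_weight s t * min 1 (c * t)) = c powr s * (LINT t|lborel. frac_weight s t * min 1 t)"
proof -
  have D: "1 / c > 0" using c by simp
  have "(1 / c) powr (- s) = c powr s" using c by (simp add: powr_divide powr_minus)
  then show "integrable lborel (\<lambda>t. frac_weight s t * min 1 (c * t))"
    and "(LINT t|lborel. frac_weight s t * min 1 (c * t)) = c powr s * (LINT t|lborel. frac_weight s t * min 1 t)"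
    using frac_weight_scale[OF D, of s "\<lambda>t. min 1 t"] frac_weight_integrable[OF s] by (simp_all add: mult.commute)
qed

lemma integrable_prod_cutoff:
  fixes f \<eta> :: "'a::euclidean_space \<Rightarrow> real"
  assumes t: "t > 0" and f: "integrable lborel f" and [measurable]: "\<eta> \<in> borel_measurable borel" and b: "\<And>x. 0 \<le> \<eta> x \<and> \<eta> x \<le> 1"
    and f0: "\<And>x. f x \<ge> 0" and q: "\<And>x. (LINT y|lborel. (\<eta> x - \<eta> y)\<^sup>2 * heat_kernel t (x - y)) \<le> m"
  shows "integrable (lborel \<Otimes>\<^sub>M lborel) (\<lambda>(x,y). f x * ((\<eta> x - \<eta> y)\<^sup>2 * heat_kernel t (x - y)))"
    "(LINT (x,y)|(lborel \<Otimes>\<^sub>M lborel). f x * ((\<eta> x - \<eta> y)\<^sup>2 * heat_kernel t (x - y))) \<le> (LINT x|lborel. f x) * m"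
    "integrable (lborel \<Otimes>\<^sub>M lborel) (\<lambda>(x,y). f y * ((\<eta> x - \<eta> y)\<^sup>2 * heat_kernel t (x - y)))"
    "(LINT (x,y)|(lborel \<Otimes>\<^sub>M lborel). f y * ((\<eta> x - \<eta> y)\<^sup>2 * heat_kernel t (x - y))) \<le> (LINT x|lborel. f x) * m"
proof -
  have [measurable]: "f \<in> borel_measurable borel" using f by auto
  have c: "(\<eta> x - \<eta> y)\<^sup>2 \<le> 1" for x y using b[of x] b[of y] by (simp add: abs_square_le_1 abs_le_iff)
  show 1: "integrable (lborel \<Otimes>\<^sub>M lborel) (\<lambda>(x,y). f x * ((\<eta> x - \<eta> y)\<^sup>2 * heat_kernel t (x - y)))"
  proof (rule Bochner_Integration.integrable_bound[OF heat_kernel_marginals(1)[OF t f]])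
    show "AE p in lborel \<Otimes>\<^sub>M lborel. norm (case p of (x, y) \<Rightarrow> f x * ((\<eta> x - \<eta> y)\<^sup>2 * heat_kernel t (x - y))) \<le> norm (case p of (x, y) \<Rightarrow> f x * heat_kernel t (x - y))"
      using c f0 by (intro AE_I2) (auto simp: split_beta' abs_mult heat_kernel_nonneg intro!: mult_left_mono mult_left_le_one_le)
  qed measurable
  have "(LINT (x,y)|(lborel \<Otimes>\<^sub>M lborel). f x * ((\<eta> x - \<eta> y)\<^sup>2 * heat_kernel t (x - y))) = (LINT x|lborel. f x * (LINT y|lborel. (\<eta> x - \<eta> y)\<^sup>2 * heat_kernel t (x - y)))"
    using lborel_pair.integral_fst[OF 1] by simp
  also have "\<dots> \<le> (LINT x|lborel. f x * m)"
    using lborel_pair.integrable_fst[OF 1] f f0 q by (intro integral_mono mult_left_mono) auto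
  finally show 2: "(LINT (x,y)|(lborel \<Otimes>\<^sub>M lborel). f x * ((\<eta> x - \<eta> y)\<^sup>2 * heat_kernel t (x - y))) \<le> (LINT x|lborel. f x) * m" by simp
  show "integrable (lborel \<Otimes>\<^sub>M lborel) (\<lambda>(x,y). f y * ((\<eta> x - \<eta> y)\<^sup>2 * heat_kernel t (x - y)))"
    using lborel_pair.integrable_product_swap[OF 1] by (simp add: heat_kernel_commute power2_commute split_beta')
  show "(LINT (x,y)|(lborel \<Otimes>\<^sub>M lborel). f y * ((\<eta> x - \<eta> y)\<^sup>2 * heat_kernel t (x - y))) \<le> (LINT x|lborel. f x) * m"
    using lborel_pair.integral_product_swap[OF borel_measurable_integrable[OF 1]] 2
    by (simp add: heat_kernel_commute power2_commute split_beta')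
qed

text \<open>The discrete product rule splits the difference of \<open>\<eta> x * w x\<close> into
  \<open>\<eta> x * (w x - w y)\<close>, controlled by the heat energy of \<open>w\<close>, and
  \<open>w y * (\<eta> x - \<eta> y)\<close>, controlled by \<open>lipschitz_heat_bound\<close>.
  Both bounds are integrable against the weight in time.\<close>

lemma sobolev_lipschitz_mult:
  fixes w \<eta> :: "'a::euclidean_space \<Rightarrow> real"
  assumes s: "0 < s" "s < 1" and w: "sobolev s w" and cut: "lipschitz_cutoff L \<eta>"
  shows "sobolev s (\<lambda>x. \<eta> x * w x)"
proof -
  have \<eta>m[measurable]: "\<eta> \<in> borel_measurable borel" and L: "L > 0" and b: "\<And>x. 0 \<le> \<eta> x \<and> \<eta> x \<le> 1"
    using cut by (auto simp: lipschitz_cutoff_def)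
  note w12 = sobolev_L12[OF w]
  have [measurable]: "w \<in> borel_measurable borel" using w12 by (rule L12D)
  have v12: "L12 (\<lambda>x. \<eta> x * w x)" by (rule L12_bounded_mult[OF w12, where B=1]) (use b in auto)
  obtain M where M: "M > 0" and MM: "\<forall>(\<eta> :: 'a \<Rightarrow> real) L t x. lipschitz_cutoff L \<eta> \<longrightarrow> t > 0 \<longrightarrow>
     (LINT y|lborel. (\<eta> x - \<eta> y)\<^sup>2 * heat_kernel t (x - y)) \<le> min 1 (L\<^sup>2 * M * t)"
    using lipschitz_heat_bound[where 'a='a] by blast
  have q: "(LINT y|lborel. (\<eta> x - \<eta> y)\<^sup>2 * heat_kernel t (x - y)) \<le> min 1 (L\<^sup>2 * M * t)" if "t > 0" for t x
    using MM cut that by blast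
  have c: "L\<^sup>2 * M > 0" using L M by simp
  define A where "A = (LINT x|lborel. (w x)\<^sup>2)"
  have le: "heat_energy t (\<lambda>x. \<eta> x * w x) (\<lambda>x. \<eta> x * w x) \<le> 2 * heat_energy t w w + A * min 1 (L\<^sup>2 * M * t)" if t: "t > 0" for t
  proof -
    note E1 = heat_energy_eq[OF t v12 v12] and E2 = heat_energy_eq[OF t w12 w12]
    note Q = integrable_prod_cutoff[OF t L12D(2)[OF w12] \<eta>m b _ q[OF t], simplified]
    let ?h = "\<lambda>x y. heat_kernel t (x - y :: 'a)"
    have "2 * heat_energy t (\<lambda>x. \<eta> x * w x) (\<lambda>x. \<eta> x * w x) \<le> (LINT p|(lborel \<Otimes>\<^sub>M lborel). 2 * (case p of (x,y) \<Rightarrow> (w x - w y) * (w x - w y) * ?h x y) + 2 * (case p of (x,y) \<Rightarrow> (w y)\<^sup>2 * ((\<eta> x - \<eta> y)\<^sup>2 * ?h x y)))"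
      unfolding E1(2)
    proof (rule integral_mono[OF E1(1)])
      show "integrable (lborel \<Otimes>\<^sub>M lborel) (\<lambda>p. 2 * (case p of (x,y) \<Rightarrow> (w x - w y) * (w x - w y) * ?h x y) + 2 * (case p of (x,y) \<Rightarrow> (w y)\<^sup>2 * ((\<eta> x - \<eta> y)\<^sup>2 * ?h x y)))"
        by (intro Bochner_Integration.integrable_add integrable_mult_right E2(1) Q(3))
      fix p :: "'a \<times> 'a" obtain x y where p: "p = (x, y)" by force
      have "(\<eta> x * w x - \<eta> y * w y)\<^sup>2 \<le> 2 * (w x - w y)\<^sup>2 + 2 * ((w y)\<^sup>2 * (\<eta> x - \<eta> y)\<^sup>2)"
      proof -
        have "\<eta> x * w x - \<eta> y * w y = \<eta> x * (w x - w y) + w y * (\<eta> x - \<eta> y)" by (simp add: algebra_simps)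
        then have "(\<eta> x * w x - \<eta> y * w y)\<^sup>2 \<le> 2 * (\<eta> x * (w x - w y))\<^sup>2 + 2 * (w y * (\<eta> x - \<eta> y))\<^sup>2"
          using sum_squares_bound[of "\<eta> x * (w x - w y)" "w y * (\<eta> x - \<eta> y)"] by (simp only: power2_sum)
        moreover have "(\<eta> x)\<^sup>2 * (w x - w y)\<^sup>2 \<le> 1 * (w x - w y)\<^sup>2"
          using b[of x] by (intro mult_right_mono) (auto simp: power_le_one)
        ultimately show ?thesis by (simp add: power_mult_distrib)
      qed
      from mult_right_mono[OF this heat_kernel_nonneg[of t "x - y"]]
      show "(case p of (x, y) \<Rightarrow> (\<eta> x * w x - \<eta> y * w y) * (\<eta> x * w x - \<eta> y * w y) * ?h x y)
          \<le> 2 * (case p of (x,y) \<Rightarrow> (w x - w y) * (w x - w y) * ?h x y) + 2 * (case p of (x,y) \<Rightarrow> (w y)\<^sup>2 * ((\<eta> x - \<eta> y)\<^sup>2 * ?h x y))"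
        unfolding p prod.case by (simp add: power2_eq_square algebra_simps)
    qed
    also have "\<dots> = 2 * (2 * heat_energy t w w) + 2 * (LINT (x,y)|(lborel \<Otimes>\<^sub>M lborel). (w y)\<^sup>2 * ((\<eta> x - \<eta> y)\<^sup>2 * ?h x y))"
      unfolding E2(2)
      by (simp only: Bochner_Integration.integral_add[OF integrable_mult_right[OF E2(1)] integrable_mult_right[OF Q(3)]] integral_mult_right_zero)
    finally show ?thesis using Q(4) by (simp add: A_def)
  qed
  have "integrable lborel (\<lambda>t. frac_weight s t * heat_energy t (\<lambda>x. \<eta> x * w x) (\<lambda>x. \<eta> x * w x))"
  proof (rule Bochner_Integration.integrable_bound)
    show "integrable lborel (\<lambda>t. 2 * (frac_weight s t * heat_energy t w w) + A * (frac_weight s t * min 1 (L\<^sup>2 * M * t)))"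
      using frac_form_heat(1)[OF s w w] frac_weight_min(1)[OF s c] by (intro Bochner_Integration.integrable_add integrable_mult_right) auto
    have [measurable]: "(\<lambda>t. heat_energy t (\<lambda>x. \<eta> x * w x) (\<lambda>x. \<eta> x * w x)) \<in> borel_measurable borel"
      by (intro heat_energy_measurable) measurable
    show "(\<lambda>t. frac_weight s t * heat_energy t (\<lambda>x. \<eta> x * w x) (\<lambda>x. \<eta> x * w x)) \<in> borel_measurable lborel" by measurable
    show "AE t in lborel. norm (frac_weight s t * heat_energy t (\<lambda>x. \<eta> x * w x) (\<lambda>x. \<eta> x * w x))
       \<le> norm (2 * (frac_weight s t * heat_energy t w w) + A * (frac_weight s t * min 1 (L\<^sup>2 * M * t)))"
    proof (rule AE_I2)
      fix t :: real
      show "norm (frac_weight s t * heat_energy t (\<lambda>x. \<eta> x * w x) (\<lambda>x. \<eta> x * w x)) \<le> norm (2 * (frac_weight s t * heat_energy t w w) + A * (frac_weight s t * min 1 (L\<^sup>2 * M * t)))"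
      proof (cases "t > 0")
        case True
        have "0 \<le> frac_weight s t * heat_energy t (\<lambda>x. \<eta> x * w x) (\<lambda>x. \<eta> x * w x)"
          by (intro mult_nonneg_nonneg frac_weight_nonneg heat_energy_nonneg True v12)
        moreover have "frac_weight s t * heat_energy t (\<lambda>x. \<eta> x * w x) (\<lambda>x. \<eta> x * w x) \<le> frac_weight s t * (2 * heat_energy t w w + A * min 1 (L\<^sup>2 * M * t))"
          by (intro mult_left_mono le True frac_weight_nonneg)
        ultimately show ?thesis by (simp add: algebra_simps)
      qed (simp add: frac_weight_def)
    qed
  qed
  then show ?thesis by (rule sobolevI_heat_energy[OF s v12])
qed

text \<open>Caccioppoli's inequality: testing the equation of \<open>w\<close> with \<open>\<eta>\<^sup>2 w\<close> replaces the energy of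
  \<open>\<eta> w\<close> by a commutator that only sees the tail of \<open>w\<close>.\<close>

lemma caccioppoli:
  assumes s: "0 < s" "s < 1"
  shows "\<exists>K\<ge>0. \<forall>(w :: 'a::euclidean_space \<Rightarrow> real) \<eta> L B. sobolev s w \<longrightarrow> (\<forall>x. w x \<ge> 0) \<longrightarrow> lipschitz_cutoff L \<eta> \<longrightarrow>
     (\<forall>x. \<eta> x \<noteq> 0 \<longrightarrow> w x \<le> B) \<longrightarrow> B \<ge> 0 \<longrightarrow>
     sobolev s (\<lambda>x. (\<eta> x)\<^sup>2 * w x) \<and>
     hs_inner s (\<lambda>x. \<eta> x * w x) (\<lambda>x. \<eta> x * w x) \<le> hs_inner s w (\<lambda>x. (\<eta> x)\<^sup>2 * w x) + K * B * (LINT x|lborel. w x) * L powr (2 * s)"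
proof -
  obtain M where M: "M > 0" and MM: "\<forall>(\<eta> :: 'a \<Rightarrow> real) L t x. lipschitz_cutoff L \<eta> \<longrightarrow> t > 0 \<longrightarrow>
     (LINT y|lborel. (\<eta> x - \<eta> y)\<^sup>2 * heat_kernel t (x - y)) \<le> min 1 (L\<^sup>2 * M * t)"
    using lipschitz_heat_bound[where 'a='a] by blast
  define c1 where "c1 = (LINT t|lborel. frac_weight s t * min 1 t)"
  have c1: "c1 \<ge> 0"
    unfolding c1_def by (intro integral_nonneg_AE AE_I2) (auto simp: frac_weight_def)
  define K where "K = M powr s * c1 / frac_const s"
  have \<kappa>: "frac_const s > 0" by (rule frac_const_pos[OF s])
  have *: "sobolev s (\<lambda>x. (\<eta> x)\<^sup>2 * w x) \<and> hs_inner s (\<lambda>x. \<eta> x * w x) (\<lambda>x. \<eta> x * w x) \<le> hs_inner s w (\<lambda>x. (\<eta> x)\<^sup>2 * w x) + K * B * (LINT x|lborel. w x) * L powr (2 * s)"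
    if w: "sobolev s w" and w0: "\<And>x. w x \<ge> 0" and cut: "lipschitz_cutoff L \<eta>"
      and B: "\<And>x. \<eta> x \<noteq> 0 \<Longrightarrow> w x \<le> B" and B0: "B \<ge> 0"
    for w \<eta> :: "'a \<Rightarrow> real" and L B
  proof -
    have \<eta>m[measurable]: "\<eta> \<in> borel_measurable borel" and L: "L > 0" and b: "\<And>x. 0 \<le> \<eta> x \<and> \<eta> x \<le> 1"
      and l: "\<And>x y. \<bar>\<eta> x - \<eta> y\<bar> \<le> L * norm (x - y)"
      using cut by (auto simp: lipschitz_cutoff_def)
    note w12 = sobolev_L12[OF w]
    define u where "u x = \<eta> x * w x" for x
    define v where "v x = (\<eta> x)\<^sup>2 * w x" for x
    have su: "sobolev s u" unfolding u_def by (rule sobolev_lipschitz_mult[OF s w cut])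
    have b2: "0 \<le> (\<eta> x)\<^sup>2 \<and> (\<eta> x)\<^sup>2 \<le> 1" for x using b[of x] by (simp add: power_le_one)
    \<comment> \<open>The factor 2 bounds \<open>\<eta> x + \<eta> y\<close>; so the square of the
      cutoff is again a cutoff.\<close>
    have l2: "\<bar>(\<eta> x)\<^sup>2 - (\<eta> y)\<^sup>2\<bar> \<le> (2 * L) * norm (x - y)" for x y
    proof -
      have "\<bar>(\<eta> x)\<^sup>2 - (\<eta> y)\<^sup>2\<bar> = \<bar>\<eta> x - \<eta> y\<bar> * \<bar>\<eta> x + \<eta> y\<bar>"
        by (simp add: power2_eq_square algebra_simps flip: abs_mult)
      also have "\<dots> \<le> (L * norm (x - y)) * 2" using b[of x] b[of y] L by (intro mult_mono l) auto
      finally show ?thesis by simp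
    qed
    have "lipschitz_cutoff (2 * L) (\<lambda>x. (\<eta> x)\<^sup>2)" using b2 l2 L by (auto simp: lipschitz_cutoff_def)
    then have sv: "sobolev s v" unfolding v_def by (rule sobolev_lipschitz_mult[OF s w])
    note u12 = sobolev_L12[OF su] and v12 = sobolev_L12[OF sv]
    have q: "(LINT y|lborel. (\<eta> x - \<eta> y)\<^sup>2 * heat_kernel t (x - y)) \<le> min 1 (L\<^sup>2 * M * t)" if "t > 0" for t x
      using MM cut that by blast
    have c: "L\<^sup>2 * M > 0" using L M by simp
    define A where "A = (LINT x|lborel. w x)"
    have le: "heat_energy t u u - heat_energy t w v \<le> B * A * min 1 (L\<^sup>2 * M * t)" if t: "t > 0" for t
    proof -
      note E1 = heat_energy_eq[OF t u12 u12] and E2 = heat_energy_eq[OF t w12 v12]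
      have Q: "integrable (lborel \<Otimes>\<^sub>M lborel) (\<lambda>(x,y). w x * ((\<eta> x - \<eta> y)\<^sup>2 * heat_kernel t (x - y)))"
        "(LINT (x,y)|(lborel \<Otimes>\<^sub>M lborel). w x * ((\<eta> x - \<eta> y)\<^sup>2 * heat_kernel t (x - y))) \<le> A * min 1 (L\<^sup>2 * M * t)"
        "integrable (lborel \<Otimes>\<^sub>M lborel) (\<lambda>(x,y). w y * ((\<eta> x - \<eta> y)\<^sup>2 * heat_kernel t (x - y)))"
        "(LINT (x,y)|(lborel \<Otimes>\<^sub>M lborel). w y * ((\<eta> x - \<eta> y)\<^sup>2 * heat_kernel t (x - y))) \<le> A * min 1 (L\<^sup>2 * M * t)"
        unfolding A_def by (rule integrable_prod_cutoff[OF t L12D(1)[OF w12] _ b w0 q[OF t]]; measurable)+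
      have "2 * heat_energy t u u - 2 * heat_energy t w v = (LINT p|(lborel \<Otimes>\<^sub>M lborel). (case p of (x,y) \<Rightarrow> (u x - u y) * (u x - u y) * heat_kernel t (x - y)) - (case p of (x,y) \<Rightarrow> (w x - w y) * (v x - v y) * heat_kernel t (x - y)))"
        unfolding E1(2) E2(2) by (rule Bochner_Integration.integral_diff[OF E1(1) E2(1), symmetric])
      also have "\<dots> \<le> (LINT p|(lborel \<Otimes>\<^sub>M lborel). B * (case p of (x,y) \<Rightarrow> w x * ((\<eta> x - \<eta> y)\<^sup>2 * heat_kernel t (x - y))) + B * (case p of (x,y) \<Rightarrow> w y * ((\<eta> x - \<eta> y)\<^sup>2 * heat_kernel t (x - y))))"
      proof (rule integral_mono)
        fix p :: "'a \<times> 'a" obtain x y where p: "p = (x, y)" by force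
        \<comment> \<open>An exact identity: the diagonal terms cancel, and the remainder contains
          no difference of \<open>w\<close>, only of the cutoff.\<close>
        have 1: "(u x - u y) * (u x - u y) - (w x - w y) * (v x - v y) = w x * w y * (\<eta> x - \<eta> y)\<^sup>2"
          by (simp add: u_def v_def power2_eq_square algebra_simps)
        \<comment> \<open>Where the cutoff differs at \<open>x\<close> and \<open>y\<close> it is
          nonzero at one of them, so one of the two values of \<open>w\<close> is at most
          \<open>B\<close>. The other value stays under the integral and produces the integral of
          \<open>w\<close>.\<close>
        have 2: "w x * w y * (\<eta> x - \<eta> y)\<^sup>2 \<le> (B * (w x + w y)) * (\<eta> x - \<eta> y)\<^sup>2"
        proof (cases "\<eta> x = \<eta> y")
          case False
          then have "\<eta> x \<noteq> 0 \<or> \<eta> y \<noteq> 0" by auto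
          then have "w x \<le> B \<or> w y \<le> B" using B by blast
          then have "w x * w y \<le> B * (w x + w y)"
          proof
            assume "w x \<le> B"
            then have "w x * w y \<le> B * w y" using w0 by (intro mult_right_mono)
            also have "\<dots> \<le> B * (w x + w y)" using w0[of x] B0 by (intro mult_left_mono) auto
            finally show ?thesis .
          next
            assume "w y \<le> B"
            then have "w x * w y \<le> w x * B" using w0 by (intro mult_left_mono)
            also have "\<dots> \<le> B * (w x + w y)" using w0[of y] B0 by (subst mult.commute) (intro mult_left_mono, auto)
            finally show ?thesis .
          qed
          then show ?thesis by (intro mult_right_mono) auto
        qed simp
        have "((u x - u y) * (u x - u y) - (w x - w y) * (v x - v y)) * heat_kernel t (x - y) \<le> ((B * (w x + w y)) * (\<eta> x - \<eta> y)\<^sup>2) * heat_kernel t (x - y)"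
          unfolding 1 by (intro mult_right_mono 2 heat_kernel_nonneg)
        then show "(case p of (x,y) \<Rightarrow> (u x - u y) * (u x - u y) * heat_kernel t (x - y)) - (case p of (x,y) \<Rightarrow> (w x - w y) * (v x - v y) * heat_kernel t (x - y))
           \<le> B * (case p of (x,y) \<Rightarrow> w x * ((\<eta> x - \<eta> y)\<^sup>2 * heat_kernel t (x - y))) + B * (case p of (x,y) \<Rightarrow> w y * ((\<eta> x - \<eta> y)\<^sup>2 * heat_kernel t (x - y)))"
          unfolding p prod.case by (simp only: left_diff_distrib distrib_left distrib_right mult.assoc)
      qed (intro Bochner_Integration.integrable_add Bochner_Integration.integrable_diff integrable_mult_right E1(1) E2(1) Q)+
      also have "\<dots> = B * (LINT (x,y)|(lborel \<Otimes>\<^sub>M lborel). w x * ((\<eta> x - \<eta> y)\<^sup>2 * heat_kernel t (x - y))) + B * (LINT (x,y)|(lborel \<Otimes>\<^sub>M lborel). w y * ((\<eta> x - \<eta> y)\<^sup>2 * heat_kernel t (x - y)))"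
        by (simp only: Bochner_Integration.integral_add[OF integrable_mult_right[OF Q(1)] integrable_mult_right[OF Q(3)]] integral_mult_right_zero)
      also have "\<dots> \<le> B * (A * min 1 (L\<^sup>2 * M * t)) + B * (A * min 1 (L\<^sup>2 * M * t))"
        by (intro add_mono mult_left_mono Q B0)
      finally show ?thesis unfolding mult.assoc by linarith
    qed
    note F1 = frac_form_heat[OF s su su] and F2 = frac_form_heat[OF s w sv]
    have "frac_const s * (frac_form s u u - frac_form s w v) = (LINT t|lborel. frac_weight s t * heat_energy t u u - frac_weight s t * heat_energy t w v)"
      unfolding frac_form_eq[OF u12 u12] frac_form_eq[OF w12 v12] Bochner_Integration.integral_diff[OF F1(1) F2(1)] F1(2) F2(2)
      by (simp add: right_diff_distrib)
    also have "\<dots> \<le> (LINT t|lborel. (B * A) * (frac_weight s t * min 1 (L\<^sup>2 * M * t)))"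
    proof (rule integral_mono)
      fix t :: real
      show "frac_weight s t * heat_energy t u u - frac_weight s t * heat_energy t w v \<le> (B * A) * (frac_weight s t * min 1 (L\<^sup>2 * M * t))"
      proof (cases "t > 0")
        case True
        then show ?thesis using mult_left_mono[OF le[OF True] frac_weight_nonneg[of s t]] by (simp only: right_diff_distrib mult_ac)
      qed (simp add: frac_weight_def)
    qed (intro Bochner_Integration.integrable_diff integrable_mult_right F1(1) F2(1) frac_weight_min(1)[OF s c])+
    also have "\<dots> = B * A * ((L\<^sup>2 * M) powr s * c1)"
      unfolding integral_mult_right_zero frac_weight_min(2)[OF s c] c1_def ..
    also have "(L\<^sup>2 * M) powr s = L powr (2 * s) * M powr s"
      using L M by (simp add: powr_mult powr_powr flip: powr_numeral)
    finally have "frac_form s u u - frac_form s w v \<le> K * B * A * L powr (2 * s)"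
      using \<kappa> by (simp add: K_def field_simps)
    moreover have "(LINT x|lborel. u x * u x) = (LINT x|lborel. w x * v x)"
      by (simp add: u_def v_def power2_eq_square mult_ac)
    ultimately have "hs_inner s u u \<le> hs_inner s w v + K * B * A * L powr (2 * s)"
      unfolding hs_inner_eq_frac_form[OF su su] hs_inner_eq_frac_form[OF w sv] by simp
    then show ?thesis using sv unfolding u_def v_def A_def by blast
  qed
  have "K \<ge> 0" unfolding K_def using c1 \<kappa> by simp
  then show ?thesis using * by (intro exI[of _ K] conjI allI impI) (assumption, blast+)
qed

subsection \<open>The interaction\<close>

lemma interaction_le_energy:
  fixes \<Gamma> W f v :: "'a::euclidean_space \<Rightarrow> real" and H :: "'a \<Rightarrow> 'a \<Rightarrow> real"
  assumes s: "0 < s" "s < 1" and fs: "decaying_fundamental_solution s \<Gamma>" and even: "\<And>x. \<Gamma> (- x) = \<Gamma> x"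
    and pos: "\<And>x. x \<noteq> 0 \<Longrightarrow> \<Gamma> x \<ge> 0" and G1: "(LINT x|lborel. \<Gamma> x) = 1"
    and U: "open U" "bounded U"
    and W: "sobolev s W" "\<And>x. W x \<ge> 0"
    and f: "f \<in> borel_measurable borel" "integrable lborel (\<lambda>x. (f x)\<^sup>2)" "\<And>x. f x \<ge> 0"
    and eq: "\<And>\<phi>. sobolev s \<phi> \<Longrightarrow> hs_inner s W \<phi> = (LINT x|lborel. f x * \<phi> x)"
    and v: "sobolev s v" "\<And>x. x \<notin> U \<Longrightarrow> v x = W x"
    and H: "\<And>y. y \<in> U \<Longrightarrow> regular_part s \<Gamma> U y (\<lambda>x. H x y)"
  shows "(LINT y:U|lborel. (LINT x:U|lborel. H x y * f x * f y)) \<le> hs_inner s v v"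
proof -
  have [measurable]: "U \<in> sets borel" using U(1) by simp
  have I: "integrable lborel \<Gamma>" using fs by (simp add: decaying_fundamental_solution_def)
  note [measurable] = f(1)
  have pL: "L12 (potential \<Gamma> \<mu>)" "AE y in lborel. integrable lborel (\<lambda>x. \<mu> x * \<Gamma> (x - y))" if "L12 \<mu>" for \<mu>
    using potential_L12[OF I _ G1 that] pos by blast+
  have pS: "sobolev s (potential \<Gamma> \<mu>)" if "L12 \<mu>" for \<mu>
    using potential_sobolev(1)[OF s fs even _ G1 that] pos by blast
  have pH: "hs_inner s (potential \<Gamma> \<mu>) \<phi> = (LINT x|lborel. \<mu> x * \<phi> x)" if "L12 \<mu>" "sobolev s \<phi>" for \<mu> \<phi>
    using potential_sobolev(2)[OF s fs even _ G1 that] pos by blast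
  \<comment> \<open>Equality holds only almost everywhere because a combination of potentials is the
    potential of the combined density only where both defining integrals converge.\<close>
  define P where "P g \<mu> \<longleftrightarrow> L12 \<mu> \<and> (\<forall>x\<in>U. \<mu> x = 0) \<and> sobolev s g \<and> (AE y in lborel. g y = potential \<Gamma> \<mu> y)" for g \<mu>
  have P1: "sobolev s g \<and> L12 \<mu> \<and> (\<forall>x\<in>U. \<mu> x = 0)" if "P g \<mu>" for g \<mu> using that by (simp add: P_def)
  have P2: "hs_inner s g \<phi> = (LINT x|lborel. \<mu> x * \<phi> x)" if "P g \<mu>" "sobolev s \<phi>" for g \<mu> \<phi>
  proof -
    have "hs_inner s g \<phi> = hs_inner s (potential \<Gamma> \<mu>) \<phi>"
      using that pL(1)[of \<mu>] by (intro hs_cong_AE) (auto simp: P_def dest: sobolev_L12 L12D)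
    then show ?thesis using pH[of \<mu> \<phi>] that by (simp add: P_def)
  qed
  have P3: "\<exists>g. P g \<mu>" if "L12 \<mu>" "\<forall>x\<in>U. \<mu> x = 0" for \<mu>
    using that pS[of \<mu>] by (intro exI[of _ "potential \<Gamma> \<mu>"]) (simp add: P_def)
  have P4: "P (\<lambda>x. a * g x + b * k x) (\<lambda>x. a * \<mu> x + b * \<nu> x)" if g: "P g \<mu>" and k: "P k \<nu>" for g \<mu> k \<nu> a b
    unfolding P_def
  proof (intro conjI)
    show "L12 (\<lambda>x. a * \<mu> x + b * \<nu> x)" using g k by (intro L12_add L12_cmult) (auto simp: P_def)
    show "sobolev s (\<lambda>x. a * g x + b * k x)" using g k by (intro sobolev_add sobolev_cmult) (auto simp: P_def)
    show "\<forall>x\<in>U. a * \<mu> x + b * \<nu> x = 0" using g k by (simp add: P_def)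
    have m: "L12 \<mu>" and n: "L12 \<nu>" and ae: "AE y in lborel. g y = potential \<Gamma> \<mu> y" "AE y in lborel. k y = potential \<Gamma> \<nu> y"
      using g k by (auto simp: P_def)
    show "AE y in lborel. a * g y + b * k y = potential \<Gamma> (\<lambda>x. a * \<mu> x + b * \<nu> x) y"
      using ae pL(2)[OF m] pL(2)[OF n]
    proof eventually_elim
      fix y assume "g y = potential \<Gamma> \<mu> y" "k y = potential \<Gamma> \<nu> y"
        and i: "integrable lborel (\<lambda>x. \<mu> x * \<Gamma> (x - y))" "integrable lborel (\<lambda>x. \<nu> x * \<Gamma> (x - y))"
      moreover have "potential \<Gamma> (\<lambda>x. a * \<mu> x + b * \<nu> x) y = (LINT x|lborel. a * (\<mu> x * \<Gamma> (x - y)) + b * (\<nu> x * \<Gamma> (x - y)))"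
        unfolding potential_def by (simp add: algebra_simps)
      ultimately show "a * g y + b * k y = potential \<Gamma> (\<lambda>x. a * \<mu> x + b * \<nu> x) y"
        using i by (simp add: potential_def)
    qed
  qed
  obtain g \<mu> h where gP: "\<And>k::nat. P (g k) (\<mu> k)" and h: "sobolev s h" and hv: "\<And>x. x \<notin> U \<Longrightarrow> h x = v x"
    and lim: "AE x in lborel. (\<lambda>k. g k x) \<longlonglongrightarrow> h x"
    and conv: "\<And>\<phi>. sobolev s \<phi> \<Longrightarrow> (\<lambda>k. LINT x|lborel. \<mu> k x * \<phi> x) \<longlonglongrightarrow> hs_inner s h \<phi>"
    and hle: "hs_inner s h h \<le> hs_inner s v v"
  proof -
    have "\<exists>g \<mu> h. (\<forall>k::nat. P (g k) (\<mu> k)) \<and> sobolev s h \<and> (\<forall>x. x \<notin> U \<longrightarrow> h x = v x) \<and>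
      (AE x in lborel. (\<lambda>k. g k x) \<longlonglongrightarrow> h x) \<and>
      (\<forall>\<phi>. sobolev s \<phi> \<longrightarrow> (\<lambda>k. LINT x|lborel. \<mu> k x * \<phi> x) \<longlonglongrightarrow> hs_inner s h \<phi>) \<and>
      hs_inner s h h \<le> hs_inner s v v"
      by (intro harmonic_extension[where P=P] P1 P2 P3 P4 U(2) v(1) \<open>U \<in> sets borel\<close>)
    then show ?thesis using that by blast
  qed
  have \<mu>0: "\<mu> k x = 0" if "x \<in> U" for k x using P1[OF gP] that by blast
  \<comment> \<open>In each approximating pairing the density vanishes on \<open>U\<close> and the
    test function off \<open>U\<close>.\<close>
  have orth: "hs_inner s h \<phi> = 0" if \<phi>: "sobolev s \<phi>" "\<And>x. x \<notin> U \<Longrightarrow> \<phi> x = 0" for \<phi>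
  proof (rule LIMSEQ_unique[OF conv[OF \<phi>(1)]])
    have z: "\<mu> k x * \<phi> x = 0" for k x using \<mu>0 \<phi>(2) by (cases "x \<in> U") auto
    show "(\<lambda>k. LINT x|lborel. \<mu> k x * \<phi> x) \<longlonglongrightarrow> 0" unfolding z by simp
  qed
  note h12 = sobolev_L12[OF h] and W12 = sobolev_L12[OF W(1)]
  have [measurable]: "h \<in> borel_measurable borel" using h12 by (rule L12D)
  have fh: "integrable lborel (\<lambda>x. f x * h x)" using L12D[OF h12] f by (intro integrable_L2_mult) auto
  have split: "(LINT x|lborel. f x * u x) \<ge> (LINT x|lborel. indicator U x * (f x * u x))"
    if "integrable lborel (\<lambda>x. f x * u x)" "\<And>x. x \<notin> U \<Longrightarrow> u x \<ge> 0" for u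
  proof (rule integral_mono)
    show "integrable lborel (\<lambda>x. indicator U x * (f x * u x))"
      by (rule Bochner_Integration.integrable_bound[OF that(1)]) (use that(1) in \<open>auto simp: indicator_def\<close>)
    show "indicator U x * (f x * u x) \<le> f x * u x" for x using that(2)[of x] f(3)[of x] by (auto simp: indicator_def)
  qed (rule that)
  have Ufh: "(LINT x|lborel. indicator U x * (f x * h x)) \<le> hs_inner s v v"
  proof -
    have "(LINT x|lborel. indicator U x * (f x * h x)) \<le> (LINT x|lborel. f x * h x)"
      using hv v(2) W(2) by (intro split fh) auto
    also have "\<dots> = hs_inner s h W" unfolding eq[OF h, symmetric] by (rule hs_commute)
    also have "\<dots> = hs_inner s h h"
      using orth[OF sobolev_diff[OF W(1) h]] hv v(2) unfolding hs_diff_right[OF W(1) h h] by simp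
    finally show ?thesis using hle by simp
  qed
  \<comment> \<open>One null set serves all \<open>k\<close>, so that at a fixed \<open>y\<close>
    the whole sequence of potentials can be passed to the limit.\<close>
  have gAE: "AE y in lborel. \<forall>k. g k y = potential \<Gamma> (\<mu> k) y"
    unfolding AE_all_countable using gP by (auto simp: P_def)
  have inner: "AE y in lborel. y \<in> U \<longrightarrow> (LINT x|lborel. indicator U x * (f x * H x y)) \<le> h y"
    using gAE lim
  proof eventually_elim
    fix y assume gy: "\<forall>k. g k y = potential \<Gamma> (\<mu> k) y" and ly: "(\<lambda>k. g k y) \<longlonglongrightarrow> h y"
    show "y \<in> U \<longrightarrow> (LINT x|lborel. indicator U x * (f x * H x y)) \<le> h y"
    proof
      assume y: "y \<in> U"
      let ?H = "\<lambda>x. H x y"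
      have ws: "weak_solution s U (\<lambda>x. 0) ?H" and off: "\<And>x. x \<notin> U \<Longrightarrow> ?H x = \<Gamma> (x - y)"
        using H[OF y] by (auto simp: regular_part_def)
      have hs: "in_Hs s ?H" using ws by (simp add: weak_solution_def)
      have "integrable lborel (\<lambda>x. \<Gamma> (x - y))" using lborel_translate(2)[of \<Gamma> "- y"] I by simp
      then have H12: "L12 ?H" by (rule L12_of_L2[OF in_Hs_L2[OF hs] U(2)]) (rule off)
      have sH: "sobolev s ?H" using hs in_Hs_iff_sobolev[OF H12] by simp
      have ortH: "hs_inner s ?H \<phi> = 0" if \<phi>: "sobolev s \<phi>" "\<And>x. x \<notin> U \<Longrightarrow> \<phi> x = 0" for \<phi>
        using ws \<phi> in_Hs_iff_sobolev[OF sobolev_L12[OF \<phi>(1)], of s] unfolding hs_inner_eq_frac_form[OF sH \<phi>(1)] weak_solution_def by auto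
      \<comment> \<open>\<open>W\<close> and \<open>h\<close> agree off \<open>U\<close>, so their
        difference is an admissible test function for the equation of the regular part. This
        exchange replaces \<open>W\<close>, which is tied to \<open>f\<close>, by a limit of
        potentials.\<close>
      have "hs_inner s ?H W = hs_inner s ?H h"
        using ortH[OF sobolev_diff[OF W(1) h]] hv v(2) unfolding hs_diff_right[OF W(1) h sH] by simp
      also have "\<dots> = h y"
      proof -
        have "(LINT x|lborel. \<mu> k x * ?H x) = g k y" for k
        proof -
          have e: "\<mu> k x * ?H x = \<mu> k x * \<Gamma> (x - y)" for x using \<mu>0 off by (cases "x \<in> U") auto
          show ?thesis unfolding e using gy by (simp add: potential_def)
        qed
        then have "(\<lambda>k. g k y) \<longlonglongrightarrow> hs_inner s h ?H" using conv[OF sH] by simp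
        then show ?thesis using LIMSEQ_unique[OF ly] hs_commute by metis
      qed
      finally have "(LINT x|lborel. f x * ?H x) = h y" unfolding eq[OF sH, symmetric] by (simp add: hs_commute)
      moreover have "integrable lborel (\<lambda>x. f x * ?H x)" using L12D[OF H12] f by (intro integrable_L2_mult) auto
      then have "(LINT x|lborel. indicator U x * (f x * ?H x)) \<le> (LINT x|lborel. f x * ?H x)"
      proof (intro split)
        show "?H x \<ge> 0" if "x \<notin> U" for x using off[OF that] pos[of "x - y"] that y by auto
      qed
      ultimately show "(LINT x|lborel. indicator U x * (f x * ?H x)) \<le> h y" by simp
    qed
  qed
  define A where "A y = (LINT x|lborel. indicator U x * (f x * H x y))" for y
  have e: "(LINT y:U|lborel. (LINT x:U|lborel. H x y * f x * f y)) = (LINT y|lborel. indicator U y * (f y * A y))"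
    unfolding set_lebesgue_integral_def A_def
    by (simp add: mult_ac flip: integral_mult_right_zero)
  show ?thesis
  proof (cases "integrable lborel (\<lambda>y. indicator U y * (f y * A y))")
    case True
    have "(LINT y|lborel. indicator U y * (f y * A y)) \<le> (LINT y|lborel. indicator U y * (f y * h y))"
    proof (rule integral_mono_AE[OF True])
      show "integrable lborel (\<lambda>y. indicator U y * (f y * h y))"
        by (rule Bochner_Integration.integrable_bound[OF fh]) (auto simp: indicator_def)
      show "AE y in lborel. indicator U y * (f y * A y) \<le> indicator U y * (f y * h y)"
        using inner by eventually_elim (auto simp: A_def indicator_def f(3) intro!: mult_left_mono)
    qed
    then show ?thesis unfolding e using Ufh by simp
  next
    \<comment> \<open>An outer integrand that fails to be integrable has integral 0 by convention,
      and the energy of \<open>v\<close> is nonnegative.\<close>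
    case False
    then show ?thesis unfolding e using hs_nonneg[OF v(1)] by (simp add: not_integrable_integral_eq)
  qed
qed

section \<open>Translations, tails and the final estimate\<close>

lemma fourier_translate:
  assumes "u \<in> borel_measurable borel"
  shows "fourier (\<lambda>x. u (x - a)) \<xi> = cis (- (a \<bullet> \<xi>)) * fourier u \<xi>"
proof -
  note [measurable] = assms
  have "fourier (\<lambda>x. u (x - a)) \<xi> = (LINT x|lborel. of_real (u (a + x - a)) * cis (- ((a + x) \<bullet> \<xi>)))"
    unfolding fourier_def by (rule lborel_translate(1)[symmetric]) measurable
  also have "\<dots> = (LINT x|lborel. cis (- (a \<bullet> \<xi>)) * (of_real (u x) * cis (- (x \<bullet> \<xi>))))"
  proof -
    have "cis (- ((a + x) \<bullet> \<xi>)) = cis (- (a \<bullet> \<xi>)) * cis (- (x \<bullet> \<xi>))" for x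
      by (simp add: inner_add_left cis_mult)
    then have "of_real (u (a + x - a)) * cis (- ((a + x) \<bullet> \<xi>)) = cis (- (a \<bullet> \<xi>)) * (of_real (u x) * cis (- (x \<bullet> \<xi>)))" for x
      by simp
    then show ?thesis by (simp only:)
  qed
  finally show ?thesis by (simp add: fourier_def)
qed

lemma L12_translate:
  assumes "L12 u" shows "L12 (\<lambda>x. u (x - a))"
proof -
  note [measurable] = L12D(3)[OF assms]
  show ?thesis using lborel_translate(2)[of u "- a"] lborel_translate(2)[of "\<lambda>x. (u x)\<^sup>2" "- a"] L12D[OF assms]
    by (simp add: L12_def)
qed

lemma sobolev_translate: "sobolev s u \<Longrightarrow> sobolev s (\<lambda>x. u (x - a))"
  by (auto simp: sobolev_def L12_translate fourier_translate L12D norm_mult)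

text \<open>A translation is a unimodular factor on the Fourier side, so it moves to the other
  argument. This carries the equation of \<open>w\<close> over to its translates.\<close>

lemma hs_translate:
  assumes u: "sobolev s u" and v: "sobolev s v"
  shows "hs_inner s (\<lambda>x. u (x - a)) v = hs_inner s u (\<lambda>x. v (x + a))"
proof -
  have "fourier (\<lambda>x. u (x - a)) \<xi> * cnj (fourier v \<xi>) = fourier u \<xi> * cnj (fourier (\<lambda>x. v (x + a)) \<xi>)" for \<xi>
    using fourier_translate[of u a \<xi>] fourier_translate[of v "- a" \<xi>] L12D(3)[OF sobolev_L12[OF u]] L12D(3)[OF sobolev_L12[OF v]]
    by (simp add: cis_cnj)
  then show ?thesis by (simp add: hs_inner_def)
qed

text \<open>A ball is connected, so if it meets \<open>U\<close> without being contained in it, it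
  meets the frontier of \<open>U\<close>.\<close>

lemma ball_subset_of_infdist_frontier:
  fixes U :: "'a::euclidean_space set"
  assumes x: "x \<in> U" and d: "d \<le> infdist x (frontier U)"
  shows "ball x d \<subseteq> U"
proof (rule ccontr)
  assume n: "\<not> ball x d \<subseteq> U"
  then have "d > 0" by (metis ball_empty empty_subsetI not_le)
  then have "x \<in> ball x d \<inter> U" using x by simp
  then have "ball x d \<inter> U \<noteq> {}" by blast
  then have "ball x d \<inter> frontier U \<noteq> {}"
    using n by (intro connected_Int_frontier) auto
  then obtain z where "z \<in> frontier U" "dist x z < d" by auto
  then show False using infdist_le[of z "frontier U" x] d by simp
qed

text \<open>Dilation by \<open>R\<close>. For the decay exponent m = n + 2s the factor is
  R^(-2s).\<close>

lemma tail_integral: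
  fixes m :: real
  assumes R: "R > 0" and I: "integrable lborel (\<lambda>x::'a::euclidean_space. indicator {x. norm x \<ge> 1} x * norm x powr (- m))"
  shows "integrable lborel (\<lambda>x::'a. indicator {x. norm x \<ge> R} x * norm x powr (- m))"
    and "(LINT x|lborel. indicator {x. norm (x::'a) \<ge> R} x * norm x powr (- m))
      = R powr (real DIM('a) - m) * (LINT x|lborel. indicator {x. norm (x::'a) \<ge> 1} x * norm x powr (- m))"
proof -
  have e: "indicator {x. norm x \<ge> R} (R *\<^sub>R x) * norm (R *\<^sub>R x) powr (- m) = R powr (- m) * (indicator {x. norm x \<ge> 1} x * norm x powr (- m))" for x :: 'a
    using R by (auto simp: indicator_def powr_mult)
  have ms: "(\<lambda>x::'a. indicator {x. norm x \<ge> R} x * norm x powr (- m)) \<in> borel_measurable borel" by measurable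
  show "integrable lborel (\<lambda>x::'a. indicator {x. norm x \<ge> R} x * norm x powr (- m))"
    unfolding lborel_scale(2)[OF R ms] e using I by simp
  have "R ^ DIM('a) * R powr (- m) = R powr (real DIM('a) - m)"
    using R by (simp add: powr_realpow[symmetric] flip: powr_add)
  then show "(LINT x|lborel. indicator {x. norm (x::'a) \<ge> R} x * norm x powr (- m))
      = R powr (real DIM('a) - m) * (LINT x|lborel. indicator {x. norm (x::'a) \<ge> 1} x * norm x powr (- m))"
    unfolding lborel_scale(1)[OF R ms] e integral_mult_right_zero by simp
qed

lemma smooth_on_UNIV_continuous: "smooth_on UNIV f \<Longrightarrow> continuous_on UNIV f"
  unfolding smooth_on_def
  by (metis UNIV_I continuous_at_imp_continuous_on differentiable_imp_continuous_within iter_deriv.simps(1))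

theorem corollary2p7:
  fixes s p :: real
    and \<Omega> :: "'a::euclidean_space set"
    and w \<Gamma> :: "'a \<Rightarrow> real"
    and H :: "real \<Rightarrow> 'a \<Rightarrow> 'a \<Rightarrow> real"
  assumes "0 < s" and "s < 1"
    and "real DIM('a) > 2 * s"
    and "1 < p" and "p < (real DIM('a) + 2 * s) / (real DIM('a) - 2 * s)"
    and "bounded_smooth_domain \<Omega>"
    and "radial_ground_state s p w"
    and "smooth_on UNIV w" and "two_sided_decay (real DIM('a) + 2 * s) w"
    and "decaying_fundamental_solution s \<Gamma>"
    and "radial \<Gamma>" and "\<forall>x. x \<noteq> 0 \<longrightarrow> \<Gamma> x > 0" and "(LINT x|lborel. \<Gamma> x) = 1"
    and "two_sided_decay (real DIM('a) + 2 * s) \<Gamma>"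
    and "\<forall>\<epsilon>>0. \<forall>y\<in>dilated \<Omega> \<epsilon>. regular_part s \<Gamma> (dilated \<Omega> \<epsilon>) y (\<lambda>x. H \<epsilon> x y)"
  shows "\<exists>\<epsilon>0>0. \<exists>C>0. \<forall>\<epsilon>. 0 < \<epsilon> \<and> \<epsilon> < \<epsilon>0 \<longrightarrow>
           (\<forall>\<xi>\<in>dilated \<Omega> \<epsilon>. infdist \<xi> (frontier (dilated \<Omega> \<epsilon>)) \<ge> 5 \<longrightarrow>
              interaction p w (dilated \<Omega> \<epsilon>) (H \<epsilon>) \<xi>
                \<le> C / infdist \<xi> (frontier (dilated \<Omega> \<epsilon>)) powr (real DIM('a) + 4 * s))"
proof -
  note s = assms(1,2)
  define n where "n = real DIM('a)"
  define m where "m = n + 2 * s"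
  have I: "integrable lborel \<Gamma>" using assms(10) by (simp add: decaying_fundamental_solution_def)
  have even: "\<Gamma> (- x) = \<Gamma> x" for x using assms(11) unfolding radial_def by (metis norm_minus_cancel)
  have pos: "\<Gamma> x \<ge> 0" if "x \<noteq> 0" for x using assms(12) that by (simp add: less_imp_le)
  obtain c1 where c1: "c1 > 0" and G1: "\<And>x. norm x \<ge> 1 \<Longrightarrow> c1 * norm x powr (- m) \<le> \<Gamma> x"
    using assms(14) unfolding two_sided_decay_def m_def n_def by blast
  obtain c2 where c2: "c2 > 0" and w2: "\<And>x. norm x \<ge> 1 \<Longrightarrow> w x \<le> c2 * norm x powr (- m)"
    using assms(9) unfolding two_sided_decay_def m_def n_def by blast
  have w0: "w x > 0" for x using assms(7) by (simp add: radial_ground_state_def)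
  have wc: "continuous_on UNIV w" by (rule smooth_on_UNIV_continuous[OF assms(8)])
  then have [measurable]: "w \<in> borel_measurable borel" by (rule borel_measurable_continuous_onI)
  have m0: "m > 0" using s by (simp add: m_def n_def add_nonneg_pos)
  obtain A where A: "\<And>x. w x \<le> A"
  proof -
    have "bounded (w ` cball 0 1)"
      by (intro compact_imp_bounded compact_continuous_image continuous_on_subset[OF wc]) auto
    then obtain B where "\<forall>x\<in>cball 0 1. \<bar>w x\<bar> \<le> B" by (auto simp: bounded_iff)
    then have B: "\<bar>w x\<bar> \<le> B" if "norm x \<le> 1" for x using that by simp
    have "w x \<le> max B c2" for x
    proof (cases "norm x \<le> 1")
      case True then show ?thesis using B[OF True] by simp
    next
      case False
      then have "x \<noteq> 0" by auto
      have "norm x powr (- m) \<le> norm x powr 0" using False m0 by (intro powr_mono) auto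
      then have "c2 * norm x powr (- m) \<le> c2 * 1" using c2 \<open>x \<noteq> 0\<close> by (intro mult_left_mono) auto
      then show ?thesis using w2[of x] False by simp
    qed
    then show ?thesis by (rule that)
  qed
  have A0: "A > 0" using A[of 0] w0[of 0] by linarith
  \<comment> \<open>Integrability of the power at infinity is borrowed from \<Gamma>, which is
    integrable and bounded below by a multiple of this power.\<close>
  have T1: "integrable lborel (\<lambda>x::'a. indicator {x. norm x \<ge> 1} x * norm x powr (- m))"
  proof (rule Bochner_Integration.integrable_bound[OF integrable_mult_right[OF I, of "1 / c1"]])
    show "AE x in lborel. norm (indicator {x. norm x \<ge> 1} x * norm x powr (- m)) \<le> norm (1 / c1 * \<Gamma> x)"
      using G1 c1 by (auto simp: indicator_def field_simps intro: order_trans[OF _ abs_ge_self])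
  qed measurable
  define T where "T = (LINT x|lborel. indicator {x. norm (x::'a) \<ge> 1} x * norm x powr (- m))"
  have T0: "T \<ge> 0" unfolding T_def by (intro integral_nonneg_AE) auto
  have w1: "integrable lborel w"
  proof (rule Bochner_Integration.integrable_bound)
    show "integrable lborel (\<lambda>x::'a. A * indicator (cball 0 1) x + c2 * (indicator {x. norm x \<ge> 1} x * norm x powr (- m)))"
      using T1 by (intro Bochner_Integration.integrable_add integrable_mult_right integrable_indicator_cball) auto
    have "w x \<le> A * indicator (cball 0 1) x + c2 * (indicator {x. norm x \<ge> 1} x * norm x powr (- m))" for x
      using A[of x] w2[of x] A0 c2 by (cases "norm x \<le> 1") (auto simp: indicator_def)
    then show "AE x in lborel. norm (w x) \<le> norm (A * indicator (cball 0 1) x + c2 * (indicator {x. norm x \<ge> 1} x * norm x powr (- m)))"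
      using w0 by (auto simp: less_imp_le intro: order_trans[OF _ abs_ge_self])
  qed measurable
  have w12: "L12 w"
    unfolding L12_def
  proof (intro conjI w1)
    show "integrable lborel (\<lambda>x. (w x)\<^sup>2)"
      by (rule Bochner_Integration.integrable_bound[OF integrable_mult_right[OF w1, of A]])
         (use A w0 A0 in \<open>auto simp: power2_eq_square less_imp_le intro!: mult_right_mono\<close>)
  qed
  have ws: "weak_solution s UNIV (\<lambda>x. w x powr p) w" using assms(7) by (simp add: radial_ground_state_def)
  then have sw: "sobolev s w" using in_Hs_iff_sobolev[OF w12] by (simp add: weak_solution_def)
  have eqw: "hs_inner s w \<phi> = (LINT x|lborel. w x powr p * \<phi> x)" if \<phi>: "sobolev s \<phi>" for \<phi>
    using ws \<phi> in_Hs_iff_sobolev[OF sobolev_L12[OF \<phi>], of s] unfolding hs_inner_eq_frac_form[OF sw \<phi>] weak_solution_def by auto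
  obtain K where K0: "K \<ge> 0" and K: "\<forall>(w :: 'a \<Rightarrow> real) \<eta> L B. sobolev s w \<longrightarrow> (\<forall>x. w x \<ge> 0) \<longrightarrow> lipschitz_cutoff L \<eta> \<longrightarrow>
     (\<forall>x. \<eta> x \<noteq> 0 \<longrightarrow> w x \<le> B) \<longrightarrow> B \<ge> 0 \<longrightarrow>
     sobolev s (\<lambda>x. (\<eta> x)\<^sup>2 * w x) \<and> hs_inner s (\<lambda>x. \<eta> x * w x) (\<lambda>x. \<eta> x * w x) \<le> hs_inner s w (\<lambda>x. (\<eta> x)\<^sup>2 * w x) + K * B * (LINT x|lborel. w x) * L powr (2 * s)"
    using caccioppoli[OF s, where 'a='a] by blast
  define N where "N = (LINT x|lborel. w x)"
  have N0: "N \<ge> 0" unfolding N_def using w0 by (intro integral_nonneg_AE) (auto simp: less_imp_le)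
  \<comment> \<open>The first summand comes from the tail of the equation tested with the cutoff
    solution, the second from the commutator. The power of 2 accounts for the radius d / 2 in place
    of d, and the final 1 makes the constant positive.\<close>
  define C where "C = (A powr (p - 1) * c2 * c2 * T + K * c2 * N) * 2 powr (n + 4 * s) + 1"
  have C0: "C > 0" unfolding C_def using c2 T0 K0 N0 by (intro add_nonneg_pos mult_nonneg_nonneg add_nonneg_nonneg) auto
  have main: "interaction p w U h \<xi> \<le> C / d powr (n + 4 * s)"
    if U: "open U" "bounded U" and \<xi>: "\<xi> \<in> U" and d: "d = infdist \<xi> (frontier U)" "d \<ge> 5"
      and h: "\<And>y. y \<in> U \<Longrightarrow> regular_part s \<Gamma> U y (\<lambda>x. h x y)" for U h \<xi> d
  proof -
    have d0: "d > 0" using d by simp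
    define W where "W x = w (x - \<xi>)" for x
    have [measurable]: "W \<in> borel_measurable borel" unfolding W_def by measurable
    have sW: "sobolev s W" unfolding W_def by (rule sobolev_translate[OF sw])
    have W0: "W x \<ge> 0" for x using w0[of "x - \<xi>"] by (simp add: W_def)
    have W1: "(LINT x|lborel. W x) = N"
      using lborel_translate(1)[of w "- \<xi>"] by (simp add: W_def N_def)
    define f where "f x = W x powr p" for x
    have fm[measurable]: "f \<in> borel_measurable borel" unfolding f_def by measurable
    have fW: "f x = W x powr (p - 1) * W x" for x
      using w0[of "x - \<xi>"] powr_add[of "W x" "p - 1" 1] by (simp add: f_def W_def)
    have WA: "W x powr (p - 1) \<le> A powr (p - 1)" for x
      using A W0 assms(4) unfolding W_def by (intro powr_mono2) auto
    \<comment> \<open>As \<open>W\<close> is bounded, W^p is at most a multiple of \<open>W\<close>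
      and inherits its decay.\<close>
    have fA: "f x \<le> A powr (p - 1) * W x" for x unfolding fW by (intro mult_right_mono WA W0)
    have f0: "f x \<ge> 0" for x by (simp add: f_def)
    have f2: "integrable lborel (\<lambda>x. (f x)\<^sup>2)"
      by (rule Bochner_Integration.integrable_bound[OF L12D(2)[OF L12_cmult[OF sobolev_L12[OF sW], of "A powr (p - 1)"]]])
         (use fA f0 in \<open>auto intro!: power_mono\<close>)
    have eqW: "hs_inner s W \<phi> = (LINT x|lborel. f x * \<phi> x)" if \<phi>: "sobolev s \<phi>" for \<phi>
    proof -
      have \<phi>': "sobolev s (\<lambda>x. \<phi> (x + \<xi>))" using sobolev_translate[OF \<phi>, of "- \<xi>"] by simp
      have [measurable]: "\<phi> \<in> borel_measurable borel" using sobolev_L12[OF \<phi>] by (rule L12D)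
      have "hs_inner s W \<phi> = (LINT x|lborel. w x powr p * \<phi> (x + \<xi>))"
        unfolding W_def hs_translate[OF sw \<phi>] by (rule eqw[OF \<phi>'])
      also have "\<dots> = (LINT x|lborel. f x * \<phi> x)"
        using lborel_translate(1)[of "\<lambda>x. f x * \<phi> x" \<xi>] by (simp add: f_def W_def add.commute)
      finally show ?thesis .
    qed
    define \<eta> where "\<eta> x = max 0 (min 1 (2 / d * norm (x - \<xi>) - 1))" for x
    have cut: "lipschitz_cutoff (2 / d) \<eta>"
      unfolding lipschitz_cutoff_def
    proof (intro conjI allI)
      show "\<eta> \<in> borel_measurable borel" unfolding \<eta>_def by measurable
      fix x y
      have "\<bar>max 0 (min 1 (a - 1)) - max 0 (min 1 (b - 1))\<bar> \<le> \<bar>a - b\<bar>" for a b :: real by linarith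
      then have "\<bar>\<eta> x - \<eta> y\<bar> \<le> \<bar>2 / d * norm (x - \<xi>) - 2 / d * norm (y - \<xi>)\<bar>" unfolding \<eta>_def .
      also have "\<dots> = 2 / d * \<bar>norm (x - \<xi>) - norm (y - \<xi>)\<bar>"
        using d0 unfolding right_diff_distrib[symmetric] abs_mult by simp
      also have "\<dots> \<le> 2 / d * norm (x - y)"
        using norm_triangle_ineq3[of "x - \<xi>" "y - \<xi>"] d0 by (intro mult_left_mono) auto
      finally show "\<bar>\<eta> x - \<eta> y\<bar> \<le> 2 / d * norm (x - y)" .
    qed (use d0 in \<open>auto simp: \<eta>_def\<close>)
    have \<eta>01: "0 \<le> \<eta> x" "\<eta> x \<le> 1" for x by (auto simp: \<eta>_def)
    have \<eta>far: "norm (x - \<xi>) \<ge> d / 2" if "\<eta> x \<noteq> 0" for x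
      using that d0 by (auto simp: \<eta>_def field_simps max_def min_def split: if_splits)
    \<comment> \<open>The bound for \<open>W\<close> where the cutoff is nonzero, that is at
      distance at least d / 2 from \<xi>. Since d >= 5, this distance exceeds 1 and the decay
      estimate applies.\<close>
    define B where "B = c2 * (d / 2) powr (- m)"
    have B0: "B \<ge> 0" using c2 by (simp add: B_def)
    have WB: "W x \<le> B" if "\<eta> x \<noteq> 0" for x
    proof -
      have "W x \<le> c2 * norm (x - \<xi>) powr (- m)" unfolding W_def using \<eta>far[OF that] d by (intro w2) auto
      also have "\<dots> \<le> B" unfolding B_def using \<eta>far[OF that] d0 m0 c2 by (intro mult_left_mono powr_mono2') auto
      finally show ?thesis .
    qed
    have Kapp: "sobolev s (\<lambda>x. (\<eta> x)\<^sup>2 * W x)"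
      "hs_inner s (\<lambda>x. \<eta> x * W x) (\<lambda>x. \<eta> x * W x) \<le> hs_inner s W (\<lambda>x. (\<eta> x)\<^sup>2 * W x) + K * B * N * (2 / d) powr (2 * s)"
      using K sW W0 cut WB B0 unfolding W1[symmetric] by blast+
    have sv: "sobolev s (\<lambda>x. \<eta> x * W x)" by (rule sobolev_lipschitz_mult[OF s sW cut])
    have off: "\<eta> x * W x = W x" if "x \<notin> U" for x
    proof -
      have "x \<notin> ball \<xi> d" using ball_subset_of_infdist_frontier[OF \<xi>, of d] d that by auto
      then have "norm (x - \<xi>) \<ge> d" by (simp add: dist_norm norm_minus_commute)
      then have "2 / d * norm (x - \<xi>) - 1 \<ge> 1" using d0 by (simp add: field_simps)
      then show ?thesis by (simp add: \<eta>_def)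
    qed
    have "interaction p w U h \<xi> \<le> hs_inner s (\<lambda>x. \<eta> x * W x) (\<lambda>x. \<eta> x * W x)"
      using interaction_le_energy[OF s assms(10) even _ assms(13) U sW W0 fm f2 f0 eqW sv off h] pos
      unfolding interaction_def f_def W_def by simp
    moreover have "hs_inner s W (\<lambda>x. (\<eta> x)\<^sup>2 * W x) \<le> A powr (p - 1) * B * c2 * ((d / 2) powr (- (2 * s)) * T)"
    proof -
      have R: "d / 2 > 0" using d0 by simp
      note tail = tail_integral[OF R T1, folded T_def]
      let ?g = "\<lambda>x::'a. indicator {x. norm x \<ge> d / 2} x * norm x powr (- m)"
      have gi: "integrable lborel (\<lambda>x. ?g (x - \<xi>))" and gI: "(LINT x|lborel. ?g (x - \<xi>)) = (LINT x|lborel. ?g x)"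
        using lborel_translate[of ?g "- \<xi>"] tail(1) by simp_all
      have nm: "real DIM('a) - m = - (2 * s)" by (simp add: m_def n_def)
      have "hs_inner s W (\<lambda>x. (\<eta> x)\<^sup>2 * W x) = (LINT x|lborel. f x * ((\<eta> x)\<^sup>2 * W x))" by (rule eqW[OF Kapp(1)])
      also have "\<dots> \<le> (LINT x|lborel. A powr (p - 1) * B * c2 * ?g (x - \<xi>))"
      proof (rule integral_mono)
        show "integrable lborel (\<lambda>x. f x * ((\<eta> x)\<^sup>2 * W x))"
          using L12D[OF sobolev_L12[OF Kapp(1)]] f2 by (intro integrable_L2_mult) auto
        show "integrable lborel (\<lambda>x. A powr (p - 1) * B * c2 * ?g (x - \<xi>))" by (intro integrable_mult_right gi)
        fix x
        show "f x * ((\<eta> x)\<^sup>2 * W x) \<le> A powr (p - 1) * B * c2 * ?g (x - \<xi>)"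
        proof (cases "\<eta> x = 0")
          case True then show ?thesis using B0 c2 by simp
        next
          case False
          \<comment> \<open>Of the two factors of \<open>W\<close> one is bounded by
            \<open>B\<close> and the other is kept as a power, whose tail integral gains a further
            (d / 2)^(-2s).\<close>
          have "W x \<le> c2 * ?g (x - \<xi>)"
            using w2[of "x - \<xi>"] \<eta>far[OF False] d by (simp add: W_def)
          moreover have "f x \<le> A powr (p - 1) * B"
            using fA[of x] mult_left_mono[OF WB[OF False], of "A powr (p - 1)"] by simp
          moreover have "(\<eta> x)\<^sup>2 * W x \<le> 1 * W x" using \<eta>01[of x] W0 by (intro mult_right_mono) (auto simp: power_le_one)
          ultimately have "f x * ((\<eta> x)\<^sup>2 * W x) \<le> (A powr (p - 1) * B) * (c2 * ?g (x - \<xi>))"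
            using W0[of x] B0 by (intro mult_mono[of "f x"]) (linarith | simp)+
          then show ?thesis by (simp add: mult.assoc)
        qed
      qed
      also have "\<dots> = A powr (p - 1) * B * c2 * ((d / 2) powr (- (2 * s)) * T)"
        unfolding integral_mult_right_zero gI tail(2) nm ..
      finally show ?thesis .
    qed
    moreover have "A powr (p - 1) * B * c2 * ((d / 2) powr (- (2 * s)) * T) + K * B * N * (2 / d) powr (2 * s) \<le> C / d powr (n + 4 * s)"
    proof -
      \<comment> \<open>The exponents n + 2s from \<open>B\<close> and 2s from the tail or the slope
        of the cutoff add up to n + 4s.\<close>
      have 1: "(d / 2) powr (- m) * (d / 2) powr (- (2 * s)) = 2 powr (n + 4 * s) / d powr (n + 4 * s)"
      proof -
        have "(d / 2) powr (- m) * (d / 2) powr (- (2 * s)) = (d / 2) powr (- (n + 4 * s))"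
          by (simp add: m_def algebra_simps flip: powr_add)
        also have "\<dots> = 2 powr (n + 4 * s) / d powr (n + 4 * s)"
          using d0 unfolding powr_minus by (simp add: powr_divide)
        finally show ?thesis .
      qed
      have 2: "(2 / d) powr (2 * s) = (d / 2) powr (- (2 * s))"
        using d0 unfolding powr_minus by (simp add: powr_divide)
      have "A powr (p - 1) * B * c2 * ((d / 2) powr (- (2 * s)) * T) + K * B * N * (2 / d) powr (2 * s)
        = (A powr (p - 1) * c2 * c2 * T + K * c2 * N) * ((d / 2) powr (- m) * (d / 2) powr (- (2 * s)))"
        unfolding 2 B_def by (simp add: algebra_simps)
      also have "\<dots> = ((A powr (p - 1) * c2 * c2 * T + K * c2 * N) * 2 powr (n + 4 * s)) / d powr (n + 4 * s)"
        unfolding 1 by simp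
      also have "\<dots> \<le> C / d powr (n + 4 * s)" unfolding C_def by (intro divide_right_mono) auto
      finally show ?thesis .
    qed
    ultimately show ?thesis using Kapp(2) by linarith
  qed
  have "interaction p w (dilated \<Omega> \<epsilon>) (H \<epsilon>) \<xi> \<le> C / infdist \<xi> (frontier (dilated \<Omega> \<epsilon>)) powr (n + 4 * s)"
    if \<epsilon>: "0 < \<epsilon>" and \<xi>: "\<xi> \<in> dilated \<Omega> \<epsilon>" and d: "5 \<le> infdist \<xi> (frontier (dilated \<Omega> \<epsilon>))" for \<epsilon> \<xi>
  proof -
    have "open \<Omega>" "bounded \<Omega>" using assms(6) by (auto simp: bounded_smooth_domain_def)
    moreover have e: "dilated \<Omega> \<epsilon> = (\<lambda>x. inverse \<epsilon> *\<^sub>R x) ` \<Omega>" by (simp add: dilated_def)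
    ultimately have U: "open (dilated \<Omega> \<epsilon>)" "bounded (dilated \<Omega> \<epsilon>)"
      unfolding e using \<epsilon> by (auto intro: open_scaling bounded_scaling)
    show ?thesis
      by (rule main[OF U \<xi> refl d]) (use assms(15) \<epsilon> in blast)
  qed
  \<comment> \<open>The constant is independent of the dilation, so 1 can be taken as the
    threshold.\<close>
  then have "\<forall>\<epsilon>. 0 < \<epsilon> \<and> \<epsilon> < 1 \<longrightarrow> (\<forall>\<xi>\<in>dilated \<Omega> \<epsilon>. infdist \<xi> (frontier (dilated \<Omega> \<epsilon>)) \<ge> 5 \<longrightarrow>
      interaction p w (dilated \<Omega> \<epsilon>) (H \<epsilon>) \<xi> \<le> C / infdist \<xi> (frontier (dilated \<Omega> \<epsilon>)) powr (real DIM('a) + 4 * s))"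
    unfolding n_def by blast
  then show ?thesis using C0 zero_less_one by blast
qed

end
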